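(* Let $q>2$ be a prime power and $t\ge 3$ an integer. Let $\Sigma$ be a $q$-order canonical subgeometry of $\mathrm{PG}(t-1,q^t)$. Assume that $\Gamma$ is a $(t-3)$-dimensional subspace and $\ell_0$ is a line of $\mathrm{PG}(t-1,q^t)$ such that $\Sigma\cap\Gamma=\emptyset=\ell_0\cap\Gamma$. Then the following assertions are equivalent: (i) the set $p_{\Gamma,\ell_0}(\Sigma)$ is a scattered $\mathbb{F}_q$-linear set of pseudoregulus type; (ii) there exists a generator $\hat\sigma$ of the subgroup $G_\Sigma$ of $\mathrm{P\Gamma L}(t,q^t)$ fixing $\Sigma$ pointwise such that $\dim(\Gamma\cap\Gamma^{\hat\sigma})=t-4$, and moreover $\Gamma$ is not contained in the span (in $\mathrm{PG}(t-1,q^t)$) of any hyperplane of $\Sigma$; (iii) there exist a point $P_\Gamma$ and a generator $\hat\sigma$ of $G_\Sigma$ such that $\langle P_\Gamma,P_\Gamma^{\hat\sigma},\ldots,P_\Gamma^{\hat\sigma^{t-1}}\rangle=\mathrm{PG}(t-1,q^t)$ and $\Gamma=\langle P_\Gamma,P_\Gamma^{\hat\sigma},\ldots,P_\Gamma^{\hat\sigma^{t-3}}\rangle$. Furthermore, if these conditions hold, then (a) for a fixed $\hat\sigma$ as in (iii), the point $P_\Gamma$ with $\Gamma=\langle P_\Gamma,P_\Gamma^{\hat\sigma},\ldots,P_\Gamma^{\hat\sigma^{t-3}}\rangle$ (and whose orbit spans the whole space) is unique; and (b) the two transversal points of $p_{\Gamma,\ell_0}(\Sigma)$ are precisely $\ell_0\cap\langle\Gamma,P_\Gamma^{\hat\sigma^{i}}\rangle$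 for $i=t-2$ and $i=t-1$.
   Context: For a vector space $V$ over $\mathbb{F}_{q^t}$, $\mathrm{PG}_{q^t}(V)$ is the projective space of one-dimensional $\mathbb{F}_{q^t}$-subspaces; $\langle T\rangle$ denotes the projective span of a point set $T$. If $\mathrm{PG}_{q^t}(V)=\mathrm{PG}(n-1,q^t)$ and $W$ is an $n$-dimensional $\mathbb{F}_q$-subspace of $V$ such that $\Sigma=\{\langle w\rangle_{q^t}: w\in W\setminus\{0\}\}$ spans $\mathrm{PG}(n-1,q^t)$, then $\Sigma$ is a ($q$-order) canonical subgeometry (it is isomorphic to $\mathrm{PG}(n-1,q)$; its hyperplanes are the sets of points of $\Sigma$ in a hyperplane of this $\mathrm{PG}(n-1,q)$). The subgroup $G_\Sigma$ of $\mathrm{P\Gamma L}(t,q^t)$ fixing $\Sigma$ pointwise is cyclic of order $t$ (in coordinates where $\Sigma$ is the set of points with all coordinates in $\mathbb{F}_q$, it consists of the maps $\langle(x_1,\ldots,x_t)\rangle\mapsto\langle(x_1^{\sigma},\ldots,x_t^{\sigma})\rangle$, $\sigma\in\mathrm{Gal}(\mathbb{F}_{q^t}/\mathbb{F}_q)$). For a subspace $\Gamma$ and a line $\ell_0$ disjoint from $\Gamma$ with $\dim\Gamma=t-3$, and a point set $X$ disjoint from $\Gamma$, the projection is $p_{\Gamma,\ell_0}(X)=\{\langle\Gamma,P\rangle\cap\ell_0: P\in X\}$. Field reduction: for $R=\mathbb{F}_{q^t}^r$ and a point $P=\langle u\rangle_{q^t}$ of $\mathrm{PG}(r-1,q^t)$,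 $\mathcal{F}(P)$ is the set of one-dimensional $\mathbb{F}_q$-subspaces of $\langle u\rangle_{q^t}$, a subspace of $\mathrm{PG}(rt-1,q)=\mathrm{PG}_q(R)$. A point set $L\subseteq\mathrm{PG}(r-1,q^t)$ is $\mathbb{F}_q$-linear of rank $n$ if $L=\{P:\mathcal{F}(P)\cap S\neq\emptyset\}$ for some $(n-1)$-dimensional subspace $S$ of $\mathrm{PG}(rt-1,q)$; it is scattered if $|L|=(q^n-1)/(q-1)$. A point set $\mathbb{L}$ of $\mathrm{PG}(1,q^t)$, $t\ge 2$, is a linear set of pseudoregulus type if there is a projectivity $\phi$ of $\mathrm{PG}(1,q^t)$ mapping $\mathbb{L}_0=\{\langle(\lambda,\lambda^q)\rangle_{q^t}:\lambda\in\mathbb{F}_{q^t}^*\}$ onto $\mathbb{L}$; then $\langle(1,0)\rangle^\phi$ and $\langle(0,1)\rangle^\phi$ are its transversal points (there are exactly two of them, independent of $\phi$). Here the line $\ell_0$ is identified with $\mathrm{PG}(1,q^t)$. *)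

theory Defs
  imports "HOL-Analysis.Cartesian_Space" "HOL-Algebra.Bij" "HOL-Algebra.Generated_Groups"
begin

section \<open>Projective spaces\<close>

text \<open>
  Everything is parametrised by a scalar multiplication \<open>s\<close>, so that the same notions serve for
  \<open>PG(n-1,q^t)\<close>, with scalar multiplication \<open>(*s)\<close> on \<open>'a ^ 'n\<close>, and for the space over the
  smaller field used in field reduction.  A point is a one-dimensional vector subspace, and
  projective subspaces are sets of points, so the empty subspace has dimension \<open>-1\<close>.
\<close>

definition pg_points :: "('c::field \<Rightarrow> 'v::ab_group_add \<Rightarrow> 'v) \<Rightarrow> 'v set set"
  where "pg_points s = {P. module.subspace s P \<and> vector_space.dim s P = 1}"

definition points_in :: "('c::field \<Rightarrow> 'v::ab_group_add \<Rightarrow> 'v) \<Rightarrow> 'v set \<Rightarrow> 'v set set"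
  where "points_in s U = {P \<in> pg_points s. P \<subseteq> U}"

definition psubspace :: "('c::field \<Rightarrow> 'v::ab_group_add \<Rightarrow> 'v) \<Rightarrow> 'v set set \<Rightarrow> bool"
  where "psubspace s S \<longleftrightarrow> (\<exists>U. module.subspace s U \<and> S = points_in s U)"

definition pspan :: "('c::field \<Rightarrow> 'v::ab_group_add \<Rightarrow> 'v) \<Rightarrow> 'v set set \<Rightarrow> 'v set set"
  where "pspan s T = points_in s (module.span s (\<Union>T))"

definition pdim :: "('c::field \<Rightarrow> 'v::ab_group_add \<Rightarrow> 'v) \<Rightarrow> 'v set set \<Rightarrow> int"
  where "pdim s S = int (vector_space.dim s (\<Union>S)) - 1"

abbreviation point_of :: "('a::field ^ 'n) \<Rightarrow> ('a ^ 'n) set"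
  where "point_of v \<equiv> module.span (*s) {v}"

section \<open>Collineations\<close>

definition field_embedding :: "('k::field \<Rightarrow> 'a::field) \<Rightarrow> bool"
  where "field_embedding h \<longleftrightarrow>
    h 1 = 1 \<and> (\<forall>x y. h (x + y) = h x + h y) \<and> (\<forall>x y. h (x * y) = h x * h y)"

definition semilinear_bij :: "('a::field ^ 'n \<Rightarrow> 'a ^ 'n) \<Rightarrow> bool"
  where "semilinear_bij f \<longleftrightarrow> bij f \<and> (\<forall>x y. f (x + y) = f x + f y) \<and>
    (\<exists>\<tau>. field_embedding \<tau> \<and> bij \<tau> \<and> (\<forall>c x. f (c *s x) = \<tau> c *s f x))"

text \<open>
  Restricting to the set of points makes elements of \<open>P\<Gamma>L\<close> and \<open>PGL\<close> extensional, hence members of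
  the library group \<^const>\<open>BijGroup\<close>; semilinear maps that differ by a scalar give the same element.
\<close>

definition PGammaL :: "(('a::field ^ 'n) set \<Rightarrow> ('a ^ 'n) set) set"
  where "PGammaL = {restrict (\<lambda>P. f ` P) (pg_points (*s)) | f. semilinear_bij f}"

definition PGL :: "(('a::field ^ 'n) set \<Rightarrow> ('a ^ 'n) set) set"
  where "PGL = {restrict (\<lambda>P. f ` P) (pg_points (*s)) | f. Vector_Spaces.linear (*s) (*s) f \<and> bij f}"

definition pointwise_stabilizer ::
    "('a::field ^ 'n) set set \<Rightarrow> (('a ^ 'n) set \<Rightarrow> ('a ^ 'n) set) set"
  where "pointwise_stabilizer \<Sigma> = {\<sigma> \<in> PGammaL. \<forall>P\<in>\<Sigma>. \<sigma> P = P}"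

definition stabilizer_generator ::
    "('a::field ^ 'n) set set \<Rightarrow> (('a ^ 'n) set \<Rightarrow> ('a ^ 'n) set) \<Rightarrow> bool"
  where "stabilizer_generator \<Sigma> \<sigma> \<longleftrightarrow> \<sigma> \<in> pointwise_stabilizer \<Sigma> \<and>
    generate (BijGroup (pg_points (*s))) {\<sigma>} = pointwise_stabilizer \<Sigma>"

section \<open>Canonical subgeometries\<close>

text \<open>
  The small field is a type \<open>'k\<close> with an embedding \<open>emb\<close> into \<open>'a\<close>; it acts on \<open>'a ^ 'n\<close> through
  this embedding.
\<close>

definition sub_scale :: "('k::field \<Rightarrow> 'a::field) \<Rightarrow> 'k \<Rightarrow> 'a ^ 'n \<Rightarrow> 'a ^ 'n"
  where "sub_scale emb c v = emb c *s v"

lemma vector_space_sub_scale: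
  assumes "field_embedding emb"
  shows "vector_space (sub_scale emb)"
  using assms
  by unfold_locales
    (auto simp: sub_scale_def field_embedding_def vec.scale_right_distrib vec.scale_left_distrib)

definition subgeometry_of ::
    "('k::field \<Rightarrow> 'a::field) \<Rightarrow> ('a ^ 'n) set \<Rightarrow> ('a ^ 'n) set set \<Rightarrow> bool"
  where "subgeometry_of emb W \<Sigma> \<longleftrightarrow>
    module.subspace (sub_scale emb) W \<and>
    vector_space.dim (sub_scale emb) W = CARD('n) \<and>
    \<Sigma> = point_of ` (W - {0}) \<and>
    pspan (*s) \<Sigma> = pg_points (*s)"

definition canonical_subgeometry ::
    "('k::field \<Rightarrow> 'a::field) \<Rightarrow> ('a ^ 'n) set set \<Rightarrow> bool"
  where "canonical_subgeometry emb \<Sigma> \<longleftrightarrow> (\<exists>W. subgeometry_of emb W \<Sigma>)"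

definition subgeometry_hyperplane ::
    "('k::field \<Rightarrow> 'a::field) \<Rightarrow> ('a ^ 'n) set set \<Rightarrow> ('a ^ 'n) set set \<Rightarrow> bool"
  where "subgeometry_hyperplane emb \<Sigma> H \<longleftrightarrow>
    (\<exists>W U. subgeometry_of emb W \<Sigma> \<and> U \<subseteq> W \<and>
      module.subspace (sub_scale emb) U \<and>
      vector_space.dim (sub_scale emb) U = CARD('n) - 1 \<and>
      H = point_of ` (U - {0}))"

section \<open>Projection\<close>

definition projection ::
    "('a::field ^ 'n) set set \<Rightarrow> ('a ^ 'n) set set \<Rightarrow> ('a ^ 'n) set set \<Rightarrow> ('a ^ 'n) set set"
  where "projection \<Gamma> l X = {Q. \<exists>P\<in>X. pspan (*s) (insert P \<Gamma>) \<inter> l = {Q}}"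

section \<open>Linear sets\<close>

definition field_reduction ::
    "('k::field \<Rightarrow> 'a::field) \<Rightarrow> ('a ^ 'r) set \<Rightarrow> ('a ^ 'r) set set"
  where "field_reduction emb P = points_in (sub_scale emb) P"

definition linear_set ::
    "('k::field \<Rightarrow> 'a::field) \<Rightarrow> nat \<Rightarrow> ('a ^ 'r) set set \<Rightarrow> bool"
  where "linear_set emb n L \<longleftrightarrow>
    (\<exists>S. psubspace (sub_scale emb) S \<and> pdim (sub_scale emb) S = int n - 1 \<and>
      L = {P \<in> pg_points (*s). field_reduction emb P \<inter> S \<noteq> {}})"

definition scattered_linear_set ::
    "('k::field \<Rightarrow> 'a::field) \<Rightarrow> ('a ^ 'r) set set \<Rightarrow> bool"
  where "scattered_linear_set emb L \<longleftrightarrow>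
    (\<exists>n. linear_set emb n L \<and> card L = (CARD('k) ^ n - 1) div (CARD('k) - 1))"

definition pseudoregulus_L0 :: "nat \<Rightarrow> ('a::field ^ 2) set set"
  where "pseudoregulus_L0 q = {point_of (vector [c, c ^ q]) | c. c \<noteq> 0}"

definition pseudoregulus_type :: "nat \<Rightarrow> ('a::field ^ 2) set set \<Rightarrow> bool"
  where "pseudoregulus_type q L \<longleftrightarrow> (\<exists>\<phi>\<in>PGL. \<phi> ` pseudoregulus_L0 q = L)"

text \<open>The union is over all admissible projectivities; the pair does not depend on the choice.\<close>

definition transversal_points :: "nat \<Rightarrow> ('a::field ^ 2) set set \<Rightarrow> ('a ^ 2) set set"
  where "transversal_points q L =
    (\<Union>\<phi>\<in>{\<phi> \<in> PGL. \<phi> ` pseudoregulus_L0 q = L}.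
       {\<phi> (point_of (vector [1, 0])), \<phi> (point_of (vector [0, 1]))})"

section \<open>Identifying a line with the projective line\<close>

definition line_coordinates ::
    "('a::field ^ 2 \<Rightarrow> 'a ^ 'n) \<Rightarrow> ('a ^ 'n) set set \<Rightarrow> bool"
  where "line_coordinates \<psi> l \<longleftrightarrow>
    Vector_Spaces.linear (*s) (*s) \<psi> \<and> inj \<psi> \<and> l = points_in (*s) (range \<psi>)"

definition pull_back ::
    "('a::field ^ 2 \<Rightarrow> 'a ^ 'n) \<Rightarrow> ('a ^ 'n) set set \<Rightarrow> ('a ^ 2) set set"
  where "pull_back \<psi> X = {P \<in> pg_points (*s). \<psi> ` P \<in> X}"

section \<open>Spanning by an orbit segment\<close>

definition orbit_span ::
    "(('a::field ^ 'n) set \<Rightarrow> ('a ^ 'n) set) \<Rightarrow> ('a ^ 'n) set \<Rightarrow> nat \<Rightarrow> ('a ^ 'n) set set"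
  where "orbit_span \<sigma> P m = pspan (*s) ((\<lambda>i. (\<sigma> ^^ i) P) ` {0..m})"

text \<open>\<open>P\<close> is a point with \<open>\<Gamma> = \<langle>P, \<dots>, P^(\<sigma>^(t-3))\<rangle>\<close> whose orbit segment of length \<open>t\<close> spans
  everything, where \<open>t = CARD('n)\<close>.\<close>

definition generating_point ::
    "('a::field ^ 'n) set set \<Rightarrow> (('a ^ 'n) set \<Rightarrow> ('a ^ 'n) set) \<Rightarrow> ('a ^ 'n) set \<Rightarrow> bool"
  where "generating_point \<Gamma> \<sigma> P \<longleftrightarrow> P \<in> pg_points (*s) \<and>
    orbit_span \<sigma> P (CARD('n) - 1) = pg_points (*s) \<and>
    \<Gamma> = orbit_span \<sigma> P (CARD('n) - 3)"

end

theory Submission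
  imports Defs "HOL-Computational_Algebra.Polynomial" "HOL-Number_Theory.Cong"
begin

text \<open>
  Let \<open>\<phi>\<close> be the \<open>q\<close>-semilinear map of order \<open>t\<close> whose fixed vectors form \<open>W\<close>; the generators of the
  stabilizer of \<open>\<Sigma>\<close> are induced by the powers \<open>f = \<phi>\<^sup>s\<close> with \<open>s\<close> coprime to \<open>t\<close>.  All three conditions
  are equivalent to: the vertex \<open>U\<close> of the projection is \<open>{x. v x = 0 \<and> v (f x) = 0}\<close> for such an \<open>f\<close> and a linear
  functional \<open>v\<close> that is injective on \<open>W\<close>.  The maps \<open>x \<mapsto> v (f\<^sup>i x)\<close> with \<open>i < t\<close> form a system of semilinear
  coordinates, and the generating point is spanned by the vector \<open>p\<close> for which all of them except the
  last one vanish.  For (ii) the functional \<open>v\<close> vanishes on the hyperplane \<open>U + f U\<close>; the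
  condition on the hyperplanes of \<open>\<Sigma>\<close> says that this hyperplane is not stable under \<open>f\<close>.  For (i), the
  projection is \<open>w \<mapsto> (g\<^sub>1 w, g\<^sub>2 w)\<close> in suitable coordinates, with \<open>g\<^sub>1\<close> and \<open>g\<^sub>2\<close> of equal norm on \<open>W\<close>.  An additive
  map preserving the norm has the form \<open>x \<mapsto> a x\<^bsup>q^s\<^esup>\<close> (a case of the theorem of Carlitz and McConnel, which
  needs \<open>q > 2\<close>), and therefore \<open>g\<^sub>2\<close> is a conjugate of \<open>g\<^sub>1\<close>.
\<close>

text \<open>The numbers \<open>c ^ q / c\<close> with \<open>c \<noteq> 0\<close> are the slopes of
  the points of \<open>pseudoregulus_L0\<close>, and they all have norm 1. This is how a condition
  on a set of points becomes the equality of norms of two coordinates of the projection on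
  \<open>W\<close>. The definition of pseudoregulus type fixes the exponent \<open>q\<close>,
  whereas the form of the vertex allows every \<open>s\<close> coprime to \<open>t\<close>; the two
  are reconciled because \<open>c ^ (q ^ s) / c\<close> runs through the same set as
  \<open>c ^ q / c\<close> exactly when \<open>s\<close> is coprime to \<open>t\<close>. The two
  hyperplanes that cut out a vertex can trade places when \<open>s\<close> is changed. Hence the
  transversal points are determined only as an unordered pair, while the generating point is unique
  once the generator of the stabilizer is fixed. Many maps below are additive but not linear over
  the large field, so surjectivity is obtained from injectivity by finiteness instead of from a
  dimension count.\<close>

declare One_nat_def [simp del]

section \<open>Power sums over a finite field\<close>

lemma card_field_gt_1: "CARD('a::{field,finite}) > 1"
proof -
  have "card {0, 1::'a} \<le> CARD('a)" by (intro card_mono) auto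
  thus ?thesis by simp
qed

lemma finite_field_power_card_minus_1:
  fixes x :: "'a::{field,finite}"
  assumes "x \<noteq> 0"
  shows "x ^ (CARD('a) - 1) = 1"
proof -
  let ?U = "UNIV - {0::'a}"
  have "(\<Prod>y\<in>?U. y) = (\<Prod>y\<in>?U. x * y)"
    by (rule prod.reindex_bij_witness[where i = "\<lambda>y. x * y" and j = "\<lambda>y. y / x"]) (use assms in auto)
  also have "\<dots> = x ^ card ?U * (\<Prod>y\<in>?U. y)" by (simp add: prod.distrib)
  finally have "x ^ card ?U = 1" by (simp add: prod_zero_iff)
  thus ?thesis by (simp add: card_Diff_singleton)
qed

lemma finite_field_power_card:
  fixes x :: "'a::{field,finite}"
  shows "x ^ CARD('a) = x"
proof (cases "x = 0")
  case False
  have "x ^ CARD('a) = x * x ^ (CARD('a) - 1)"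
    using card_field_gt_1[where 'a='a] by (subst power_Suc[symmetric]) simp
  thus ?thesis using finite_field_power_card_minus_1[OF False] by simp
qed (use card_field_gt_1[where 'a='a] in simp)

lemma card_power_eq_le:
  fixes a :: "'a::idom"
  assumes "n > 0"
  shows "card {x. x ^ n = a} \<le> n" "finite {x. x ^ n = a}"
proof -
  let ?p = "monom 1 n - [:a:] :: 'a poly"
  have c: "coeff ?p n = 1" using assms by (cases n) auto
  hence p: "?p \<noteq> 0" by force
  have "degree ?p \<le> n" by (intro degree_diff_le) (auto simp: degree_monom_le)
  moreover have "{x. poly ?p x = 0} = {x. x ^ n = a}" by (auto simp: poly_monom)
  ultimately show "card {x. x ^ n = a} \<le> n" "finite {x. x ^ n = a}"
    using card_poly_roots_bound[OF p] poly_roots_finite[OF p] by auto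
qed

lemma exists_power_neq_1:
  assumes "0 < n" "n < CARD('a::{field,finite}) - 1"
  shows "\<exists>g::'a. g \<noteq> 0 \<and> g ^ n \<noteq> 1"
proof (rule ccontr)
  assume "\<not> ?thesis"
  hence "UNIV - {0::'a} \<subseteq> {x. x ^ n = 1}" by auto
  hence "card (UNIV - {0::'a}) \<le> n"
    using card_power_eq_le[OF assms(1), of "1::'a"] by (meson card_mono le_trans)
  thus False using assms by (simp add: card_Diff_singleton)
qed

text \<open>If some \<open>g \<noteq> 0\<close> has \<open>g ^ n \<noteq> 1\<close>, then replacing
  \<open>x\<close> by \<open>g * x\<close> multiplies the sum by \<open>g ^ n\<close>, so it is 0.
  Otherwise every nonzero \<open>x\<close> contributes 1, and the number of these terms is
  \<open>- 1\<close> in the field.\<close>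

lemma sum_power_finite_field:
  assumes "n > 0"
  shows "(\<Sum>x\<in>UNIV. (x::'a::{field,finite}) ^ n) = (if CARD('a) - 1 dvd n then - 1 else 0)"
proof (cases "CARD('a) - 1 dvd n")
  case True
  then obtain k where k: "n = (CARD('a) - 1) * k" by auto
  have "(\<Sum>x\<in>UNIV. (x::'a) ^ n) = (\<Sum>x\<in>UNIV - {0}. x ^ n)"
    by (rule sum.mono_neutral_right) (use assms in auto)
  also have "\<dots> = (\<Sum>x\<in>UNIV - {0::'a}. 1)"
    by (rule sum.cong) (simp_all add: k power_mult finite_field_power_card_minus_1 del: One_nat_def)
  also have "\<dots> = of_nat CARD('a) - 1"
    using card_field_gt_1[where 'a='a] by (simp add: card_Diff_singleton of_nat_diff)
  \<comment> \<open>Translation by 1 permutes the field, so summing \<open>x + 1\<close> over it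
    shows that the number of elements vanishes in the field.\<close>
  also have "of_nat CARD('a) = (0::'a)"
  proof -
    have "(\<Sum>x\<in>UNIV. x + 1) = (\<Sum>x\<in>UNIV. x::'a)"
      by (rule sum.reindex_bij_witness[where i = "\<lambda>x. x - 1" and j = "\<lambda>x. x + 1"]) auto
    thus ?thesis by (simp add: sum.distrib)
  qed
  finally show ?thesis using True by simp
next
  case False
  let ?r = "n mod (CARD('a) - 1)"
  have Q: "CARD('a) - 1 > 0" using card_field_gt_1[where 'a='a] by simp
  have r: "0 < ?r" "?r < CARD('a) - 1" using False Q by (auto simp: dvd_eq_mod_eq_0)
  then obtain g :: 'a where g: "g \<noteq> 0" "g ^ ?r \<noteq> 1" using exists_power_neq_1 by blast
  have "g ^ n = g ^ (n div (CARD('a) - 1) * (CARD('a) - 1) + ?r)"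
    by (simp only: div_mult_mod_eq)
  also have "\<dots> = g ^ ?r"
    by (simp only: power_add power_mult mult.commute[of _ "CARD('a) - 1"]
        finite_field_power_card_minus_1[OF g(1)] power_one mult_1_left)
  finally have gn: "g ^ n \<noteq> 1" using g by simp
  have "(\<Sum>x\<in>UNIV. x ^ n) = (\<Sum>x\<in>UNIV. (g * x) ^ n)"
    by (rule sum.reindex_bij_witness[where i = "\<lambda>x. g * x" and j = "\<lambda>x. x / g"]) (use g in auto)
  also have "\<dots> = g ^ n * (\<Sum>x\<in>UNIV. x ^ n)"
    by (simp add: power_mult_distrib sum_distrib_left)
  finally have "(\<Sum>x\<in>UNIV. (x::'a) ^ n) = 0" using gn by simp
  thus ?thesis using False by simp
qed

text \<open>Multiplying by \<open>x ^ (CARD('a) - 1 - b)\<close> and summing extracts the coefficient of \<open>x ^ b\<close>.\<close>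

lemma power_orthogonality:
  assumes "a < CARD('a) - 1" "0 < b" "b < CARD('a) - 1"
  shows "(\<Sum>x\<in>UNIV. (x::'a::{field,finite}) ^ a * x ^ (CARD('a) - 1 - b)) = (if a = b then - 1 else 0)"
proof -
  let ?n = "CARD('a) - 1" and ?k = "a + (CARD('a) - 1 - b)"
  have pos: "?k > 0" using assms by simp
  have "?n dvd ?k \<longleftrightarrow> a = b"
  proof
    assume "?n dvd ?k"
    then obtain c where c: "?k = ?n * c" by auto
    have "c = 1"
    proof (rule ccontr)
      assume "c \<noteq> 1"
      hence "c = 0 \<or> c \<ge> 2" by auto
      thus False
      proof
        assume "c \<ge> 2"
        hence "?n * 2 \<le> ?k" unfolding c by (intro mult_le_mono) auto
        thus False using assms by linarith
      qed (use c pos in simp)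
    qed
    thus "a = b" using c assms by simp
  qed (use assms in auto)
  thus ?thesis
    using sum_power_finite_field[OF pos, where 'a='a] by (simp only: power_add)
qed

text \<open>The exponents compared below are sums of multiples of powers of \<open>q\<close>;
  remainder and quotient by \<open>q\<close> peel off their digits one at a time.\<close>

lemma digits_unique:
  fixes q :: nat
  assumes "(\<Sum>j<t. d j * q ^ j) = (\<Sum>j<t. d' j * q ^ j)"
    and "\<And>j. j < t \<Longrightarrow> d j < q" "\<And>j. j < t \<Longrightarrow> d' j < q" and "j < t"
  shows "d j = d' j"
  using assms
proof (induction t arbitrary: d d' j)
  case (Suc t)
  have split: "(\<Sum>j<Suc t. e j * q ^ j) = e 0 + q * (\<Sum>j<t. e (Suc j) * q ^ j)" for e :: "nat \<Rightarrow> nat"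
    by (simp add: sum.lessThan_Suc_shift sum_distrib_left mult_ac del: sum.lessThan_Suc)
  have q: "q > 0" using Suc.prems(2)[of 0] by simp
  have eq: "d 0 + q * (\<Sum>j<t. d (Suc j) * q ^ j) = d' 0 + q * (\<Sum>j<t. d' (Suc j) * q ^ j)"
    using Suc.prems(1) by (simp only: split)
  have small: "d 0 < q" "d' 0 < q" using Suc.prems(2,3) by auto
  have "d 0 = d' 0" using arg_cong[OF eq, of "\<lambda>n. n mod q"] small by simp
  moreover have "(\<Sum>j<t. d (Suc j) * q ^ j) = (\<Sum>j<t. d' (Suc j) * q ^ j)"
    using arg_cong[OF eq, of "\<lambda>n. n div q"] small by simp
  hence "d (Suc i) = d' (Suc i)" if "i < t" for i
    using Suc.IH[of "\<lambda>i. d (Suc i)" "\<lambda>i. d' (Suc i)"] Suc.prems(2,3) that by simp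
  ultimately show ?case using Suc.prems(4) by (cases j) auto
qed simp

section \<open>Additive maps preserving the norm\<close>

text \<open>The subfield of order \<open>q\<close> is not a type here; it appears only through the
  equation \<open>c ^ q = c\<close>. Additivity of \<open>x \<mapsto> x ^ q\<close> is derived from
  the embedding of the small field in \<open>frobenius_additive\<close>.\<close>

locale finite_extension =
  fixes field_type :: "'a::{field,finite} itself" and q t :: nat
  assumes q_gt_2: "q > 2" and t_ge_3: "t \<ge> 3" and card_field: "CARD('a) = q ^ t"
    and frob_add: "\<And>x y :: 'a. (x + y) ^ q = x ^ q + y ^ q"
begin

section \<open>Exponents with base \<open>q\<close> digits 0 and 1, and the norm\<close>

definition expo :: "nat set \<Rightarrow> nat"
  where "expo S = (\<Sum>j\<in>S. q ^ j)"

text \<open>The norm to the subfield of \<open>q\<close> elements, as the product of the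
  conjugates.\<close>

definition nrm :: "'a \<Rightarrow> 'a"
  where "nrm x = (\<Prod>j<t. x ^ (q ^ j))"

lemma frob_iter_add: "((x::'a) + y) ^ (q ^ i) = x ^ (q ^ i) + y ^ (q ^ i)"
  by (induction i) (auto simp: power_mult mult.commute[of q] frob_add)

lemma frob_iter_sum: "(sum f A :: 'a) ^ (q ^ i) = (\<Sum>x\<in>A. f x ^ (q ^ i))"
  using q_gt_2 by (induction A rule: infinite_finite_induct) (auto simp: frob_iter_add)

lemma frob_iter_diff: "((x::'a) - y) ^ (q ^ i) = x ^ (q ^ i) - y ^ (q ^ i)"
  using frob_iter_add[of "x - y" y i] by (simp add: algebra_simps)

lemma frob_t: "(x::'a) ^ (q ^ t) = x"
  using finite_field_power_card[of x] by (simp add: card_field)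

lemma frob_add_exp: "((x::'a) ^ (q ^ i)) ^ (q ^ j) = x ^ (q ^ (i + j))"
  by (simp add: power_add power_mult)

lemma frob_mod: "(x::'a) ^ (q ^ (i mod t)) = x ^ (q ^ i)"
proof -
  have mult: "(x::'a) ^ (q ^ (t * k)) = x" for k and x :: 'a
    by (induction k) (auto simp: frob_add_exp[symmetric] frob_t)
  have "x ^ (q ^ i) = x ^ (q ^ (t * (i div t) + i mod t))" by simp
  thus ?thesis by (simp only: frob_add_exp[symmetric] mult)
qed

lemma frob_eq_0_iff [simp]: "(x::'a) ^ (q ^ i) = 0 \<longleftrightarrow> x = 0"
  using q_gt_2 by simp

lemma prod_expo: "finite S \<Longrightarrow> (\<Prod>j\<in>S. (x::'a) ^ (q ^ j)) = x ^ expo S"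
  by (simp add: expo_def power_sum)

lemma nrm_eq_0_iff [simp]: "nrm x = 0 \<longleftrightarrow> x = 0"
  using t_ge_3 by (auto simp: nrm_def lessThan_empty_iff)

text \<open>Each conjugate of \<open>x + y\<close> contributes one of its two terms, and
  \<open>B\<close> records where \<open>x\<close> is chosen. Distinct \<open>B\<close> give distinct
  exponents, which is what makes the coefficients accessible to
  \<open>power_orthogonality\<close>.\<close>

lemma nrm_add:
  "nrm (x + y) = (\<Sum>B\<in>Pow {..<t}. x ^ expo B * y ^ expo ({..<t} - B))"
proof -
  have "nrm (x + y) = (\<Prod>j<t. x ^ (q ^ j) + y ^ (q ^ j))" by (simp add: nrm_def frob_iter_add)
  also have "\<dots> = (\<Sum>B\<in>Pow {..<t}. (\<Prod>j\<in>B. x ^ (q ^ j)) * (\<Prod>j\<in>{..<t} - B. y ^ (q ^ j)))"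
    by (rule prod_add) auto
  also have "\<dots> = (\<Sum>B\<in>Pow {..<t}. x ^ expo B * y ^ expo ({..<t} - B))"
    by (intro sum.cong) (auto simp: prod_expo finite_subset)
  finally show ?thesis .
qed

lemma power_expo_add:
  assumes "finite S"
  shows "((x::'a) + y) ^ expo S = (\<Sum>B\<in>Pow S. x ^ expo B * y ^ expo (S - B))"
proof -
  have "(x + y) ^ expo S = (\<Prod>j\<in>S. x ^ (q ^ j) + y ^ (q ^ j))"
    using assms by (simp add: prod_expo[symmetric] frob_iter_add)
  also have "\<dots> = (\<Sum>B\<in>Pow S. (\<Prod>j\<in>B. x ^ (q ^ j)) * (\<Prod>j\<in>S - B. y ^ (q ^ j)))"
    by (rule prod_add) (fact assms)
  also have "\<dots> = (\<Sum>B\<in>Pow S. x ^ expo B * y ^ expo (S - B))"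
    using assms by (intro sum.cong) (auto simp: prod_expo finite_subset)
  finally show ?thesis .
qed

lemma expo_digits: "S \<subseteq> {..<t} \<Longrightarrow> expo S = (\<Sum>j<t. of_bool (j \<in> S) * q ^ j)"
  unfolding expo_def by (intro sum.mono_neutral_cong_left) auto

lemma expo_inj: "S \<subseteq> {..<t} \<Longrightarrow> T \<subseteq> {..<t} \<Longrightarrow> expo S = expo T \<longleftrightarrow> S = T"
proof
  assume S: "S \<subseteq> {..<t}" and T: "T \<subseteq> {..<t}" and "expo S = expo T"
  hence "(\<Sum>j<t. of_bool (j \<in> S) * q ^ j) = (\<Sum>j<t. of_bool (j \<in> T) * q ^ j)"
    by (simp add: expo_digits)
  hence "of_bool (j \<in> S) = (of_bool (j \<in> T) :: nat)" if "j < t" for j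
    by (rule digits_unique) (use q_gt_2 that in auto)
  hence "j \<in> S \<longleftrightarrow> j \<in> T" if "j < t" for j using that by (metis of_bool_eq_iff)
  thus "S = T" using S T by blast
qed simp

lemma expo_full: "(q - 1) * expo {..<t} = q ^ t - 1"
proof -
  have "(q - 1) * (\<Sum>j<n. q ^ j) = q ^ n - 1" for n
  proof (induction n)
    case (Suc n)
    have "(q - 1) * (\<Sum>j<Suc n. q ^ j) = (q ^ n - 1) + (q - 1) * q ^ n"
      by (simp only: Suc.IH[symmetric] sum.lessThan_Suc distrib_left)
    also have "\<dots> = q ^ Suc n - 1"
      using q_gt_2 by (simp add: diff_mult_distrib)
    finally show ?case .
  qed simp
  thus ?thesis by (simp only: expo_def)
qed

text \<open>The factor \<open>q - 1 \<ge> 2\<close> in \<open>expo_full\<close> makes the inequality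
  strict; for \<open>q = 2\<close> the full digit set would give \<open>CARD('a) - 1\<close> itself,
  outside the range of \<open>power_orthogonality\<close>.\<close>

lemma expo_less: "S \<subseteq> {..<t} \<Longrightarrow> expo S < CARD('a) - 1"
proof -
  assume "S \<subseteq> {..<t}"
  hence "expo S \<le> expo {..<t}" unfolding expo_def by (intro sum_mono2) auto
  also have "expo {..<t} < (q - 1) * expo {..<t}"
    using q_gt_2 t_ge_3 by (simp add: expo_def sum_pos lessThan_empty_iff)
  finally show ?thesis by (simp only: expo_full card_field)
qed

lemma two_powers_less: "i < t \<Longrightarrow> j < t \<Longrightarrow> q ^ i + q ^ j < CARD('a) - 1"
proof -
  assume "i < t" "j < t"
  hence "q ^ i \<le> q ^ (t - 1)" "q ^ j \<le> q ^ (t - 1)"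
    using q_gt_2 by (auto intro!: power_increasing)
  moreover have "q ^ (t - 1) > 1" using q_gt_2 t_ge_3 by (intro one_less_power) auto
  moreover have "q ^ t = q * q ^ (t - 1)" using t_ge_3 by (simp flip: power_Suc)
  moreover have "3 * q ^ (t - 1) \<le> q * q ^ (t - 1)" using q_gt_2 by (intro mult_right_mono) auto
  ultimately show ?thesis unfolding card_field by linarith
qed

lemma power_less: "i < t \<Longrightarrow> q ^ i < CARD('a) - 1"
  using two_powers_less[of i i] by linarith

lemma power_as_digits: "i < t \<Longrightarrow> q ^ i = (\<Sum>l<t. of_bool (l = i) * q ^ l)"
  using expo_digits[of "{i}"] by (simp add: expo_def del: sum_of_bool_mult_eq sum_mult_of_bool_eq)

lemma two_powers_eq_iff:
  assumes "i < t" "j < t" "k < t"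
  shows "q ^ i + q ^ j = 2 * q ^ k \<longleftrightarrow> i = k \<and> j = k"
proof
  assume "q ^ i + q ^ j = 2 * q ^ k"
  hence "(\<Sum>l<t. (of_bool (l = i) + of_bool (l = j)) * q ^ l) = (\<Sum>l<t. (2 * of_bool (l = k)) * q ^ l)"
    unfolding distrib_right sum.distrib mult.assoc sum_distrib_left[symmetric]
    by (simp only: power_as_digits[OF assms(1), symmetric] power_as_digits[OF assms(2), symmetric]
        power_as_digits[OF assms(3), symmetric])
  hence "of_bool (k = i) + of_bool (k = j) = 2 * (of_bool (k = k) :: nat)"
    by (rule digits_unique) (use q_gt_2 assms in auto)
  thus "i = k \<and> j = k" by (auto simp: of_bool_def split: if_splits)
qed simp

lemma expo_neq_two_power:
  assumes "S \<subseteq> {..<t}" "k < t"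
  shows "expo S \<noteq> 2 * q ^ k"
proof
  assume "expo S = 2 * q ^ k"
  hence "(\<Sum>l<t. of_bool (l \<in> S) * q ^ l) = (\<Sum>l<t. (2 * of_bool (l = k)) * q ^ l)"
    unfolding mult.assoc sum_distrib_left[symmetric]
    by (simp only: power_as_digits[OF assms(2), symmetric] expo_digits[OF assms(1), symmetric])
  hence "of_bool (k \<in> S) = 2 * (of_bool (k = k) :: nat)"
    by (rule digits_unique) (use q_gt_2 assms in auto)
  thus False by (auto simp: of_bool_def split: if_splits)
qed

lemma expo_pos: "S \<subseteq> {..<t} \<Longrightarrow> S \<noteq> {} \<Longrightarrow> expo S > 0"
  unfolding expo_def using q_gt_2 finite_subset[of S "{..<t}"] by (intro sum_pos) auto

text \<open>Independence of the powers of the Frobenius map: multiplying by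
  \<open>x ^ (CARD('a) - 1 - q ^ j)\<close> and summing over the field leaves only
  \<open>- a j\<close>.\<close>

lemma frob_independent:
  assumes "\<And>x::'a. (\<Sum>i<t. a i * x ^ (q ^ i)) = 0" and "j < t"
  shows "a j = 0"
proof -
  let ?c = "CARD('a) - 1 - q ^ j"
  have "0 = (\<Sum>x\<in>UNIV. (\<Sum>i<t. a i * x ^ (q ^ i)) * x ^ ?c)" using assms(1) by simp
  also have "\<dots> = (\<Sum>i<t. a i * (\<Sum>x\<in>UNIV. x ^ (q ^ i) * x ^ ?c))"
    unfolding sum_distrib_right sum_distrib_left by (subst sum.swap) (simp add: mult.assoc)
  also have "\<dots> = (\<Sum>i<t. a i * (if i = j then - 1 else 0))"
    using q_gt_2 assms(2) by (intro sum.cong refl, subst power_orthogonality) (auto simp: power_less)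
  also have "\<dots> = - a j" using assms(2) by (simp add: if_distrib cong: if_cong)
  finally show ?thesis by simp
qed

section \<open>Norm-preserving additive maps are monomials\<close>

context
  fixes h :: "'a \<Rightarrow> 'a"
  assumes h_add: "\<And>x y. h (x + y) = h x + h y" and h_nrm: "\<And>x. nrm (h x) = nrm x"
begin

lemma h_0: "h 0 = 0" using h_add[of 0 0] by (metis add_cancel_right_right)

lemma h_bij: "bij h"
proof -
  have "h x = 0 \<longleftrightarrow> x = 0" for x using h_nrm[of x] nrm_eq_0_iff by metis
  moreover have "h (x - y) = h x - h y" for x y using h_add[of "x - y" y] by simp
  ultimately have "inj h" by (intro injI) (metis right_minus_eq)
  thus ?thesis by (simp add: bij_def finite_UNIV_inj_surj)
qed

text \<open>Compare the coefficients of \<open>z ^ expo ({..<t} - S)\<close> in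
  \<open>nrm (h x + z) = nrm (x + h\<inverse> z)\<close>.\<close>

lemma norm_preserving_power_expo:
  assumes S: "S \<subset> {..<t}"
  shows "\<exists>c. \<forall>x. h x ^ expo S = (\<Sum>T\<in>Pow {..<t}. c T * x ^ expo T)"
proof -
  let ?e = "CARD('a) - 1 - expo ({..<t} - S)"
  define c where "c T = - (\<Sum>y\<in>UNIV. y ^ expo ({..<t} - T) * h y ^ ?e)" for T
  have pos: "0 < expo ({..<t} - S)" using S by (intro expo_pos) auto
  have "h x ^ expo S = (\<Sum>T\<in>Pow {..<t}. c T * x ^ expo T)" for x
  proof -
    have "(\<Sum>z\<in>UNIV. nrm (h x + z) * z ^ ?e) = (\<Sum>B\<in>Pow {..<t}. h x ^ expo B * (\<Sum>z\<in>UNIV. z ^ expo ({..<t} - B) * z ^ ?e))"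
      unfolding nrm_add sum_distrib_right sum_distrib_left by (subst sum.swap) (simp add: mult.assoc)
    also have "\<dots> = (\<Sum>B\<in>Pow {..<t}. h x ^ expo B * (if B = S then - 1 else 0))"
    proof (intro sum.cong refl)
      fix B assume B: "B \<in> Pow {..<t}"
      have "expo ({..<t} - B) = expo ({..<t} - S) \<longleftrightarrow> B = S"
        using B S by (subst expo_inj) auto
      thus "h x ^ expo B * (\<Sum>z\<in>UNIV. z ^ expo ({..<t} - B) * z ^ ?e) =
          h x ^ expo B * (if B = S then - 1 else 0)"
        using pos by (subst power_orthogonality) (auto intro!: expo_less)
    qed
    also have "\<dots> = - (h x ^ expo S)" using S by (auto simp: if_distrib cong: if_cong)
    finally have "h x ^ expo S = - (\<Sum>z\<in>UNIV. nrm (h x + z) * z ^ ?e)" by simp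
    also have "(\<Sum>z\<in>UNIV. nrm (h x + z) * z ^ ?e) = (\<Sum>y\<in>UNIV. nrm (h x + h y) * h y ^ ?e)"
      using sum.reindex_bij_betw[OF h_bij, symmetric] by simp
    also have "\<dots> = (\<Sum>y\<in>UNIV. nrm (x + y) * h y ^ ?e)" by (simp add: h_nrm flip: h_add)
    also have "\<dots> = (\<Sum>T\<in>Pow {..<t}. (\<Sum>y\<in>UNIV. y ^ expo ({..<t} - T) * h y ^ ?e) * x ^ expo T)"
      unfolding nrm_add sum_distrib_right by (subst sum.swap) (simp add: mult_ac)
    finally show ?thesis by (simp add: c_def sum_negf)
  qed
  thus ?thesis by blast
qed

text \<open>Since \<open>expo {0} = 1\<close>, the map \<open>h\<close> itself is a combination of
  the \<open>x ^ expo T\<close>, and the \<open>T\<close> that are not singletons have to be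
  removed. The coefficient of \<open>y ^ (q ^ b)\<close> in \<open>h (x + y)\<close> does not depend
  on \<open>x\<close>, because \<open>h\<close> is additive. Expanded, it is the sum of
  \<open>c T * x ^ expo (T - {b})\<close> over all \<open>T\<close> containing \<open>b\<close>, so
  only \<open>T = {b}\<close> survives. The constant term is \<open>h 0 = 0\<close>.\<close>

lemma norm_preserving_linearized: "\<exists>a. \<forall>x. h x = (\<Sum>i<t. a i * x ^ (q ^ i))"
proof -
  have "1 \<in> {..<t} - {0}" "0 \<in> {..<t}" using t_ge_3 by auto
  hence "{0} \<subset> {..<t}" by blast
  then obtain c where "\<And>x. h x ^ expo {0} = (\<Sum>T\<in>Pow {..<t}. c T * x ^ expo T)"
    using norm_preserving_power_expo by blast
  hence c: "h x = (\<Sum>T\<in>Pow {..<t}. c T * x ^ expo T)" for x by (simp add: expo_def)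
  have vanish: "c T0 = 0" if T0: "T0 \<subseteq> {..<t}" "b \<in> T0" "T0 \<noteq> {b}" for T0 b
  proof -
    let ?e = "CARD('a) - 1 - q ^ b"
    have b: "b < t" using T0 by auto
    have qb: "0 < q ^ b" "q ^ b < CARD('a) - 1" using q_gt_2 b by (auto simp: power_less)
    define R where "R = {T \<in> Pow {..<t}. b \<in> T}"
    have key: "(\<Sum>T\<in>R. c T * x ^ expo (T - {b})) = - (\<Sum>y\<in>UNIV. h y * y ^ ?e)" for x
    proof -
      have inner: "(\<Sum>y\<in>UNIV. (x + y) ^ expo T * y ^ ?e) =
          (if b \<in> T then - (x ^ expo (T - {b})) else 0)" if T: "T \<in> Pow {..<t}" for T
      proof -
        have fin: "finite T" using T finite_subset by auto
        have "(\<Sum>y\<in>UNIV. (x + y) ^ expo T * y ^ ?e) =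
            (\<Sum>B\<in>Pow T. x ^ expo B * (\<Sum>y\<in>UNIV. y ^ expo (T - B) * y ^ ?e))"
          unfolding power_expo_add[OF fin] sum_distrib_right sum_distrib_left
          by (subst sum.swap) (simp add: mult.assoc)
        also have "\<dots> = (\<Sum>B\<in>Pow T. if B = T - {b} then (if b \<in> T then - (x ^ expo B) else 0) else 0)"
        proof (intro sum.cong refl)
          fix B assume B: "B \<in> Pow T"
          have "expo (T - B) = q ^ b \<longleftrightarrow> T - B = {b}"
            using expo_inj[of "T - B" "{b}"] T b by (auto simp: expo_def)
          also have "\<dots> \<longleftrightarrow> B = T - {b} \<and> b \<in> T" using B by auto
          finally show "x ^ expo B * (\<Sum>y\<in>UNIV. y ^ expo (T - B) * y ^ ?e) =
              (if B = T - {b} then (if b \<in> T then - (x ^ expo B) else 0) else 0)"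
            using T qb by (subst power_orthogonality) (auto intro!: expo_less)
        qed
        finally show ?thesis using fin by simp
      qed
      \<comment> \<open>This is the only part of the sum for \<open>h (x + y)\<close> that involves
        \<open>x\<close> once additivity is applied; as it vanishes, the sum is the same for all
        \<open>x\<close>.\<close>
      have "h x * (\<Sum>y\<in>UNIV. y ^ ?e) = 0"
      proof -
        have "(\<Sum>y\<in>UNIV. (y::'a) ^ ?e) = (\<Sum>y\<in>UNIV. y ^ 0 * y ^ ?e)" by simp
        thus ?thesis using qb by (subst (asm) power_orthogonality) auto
      qed
      hence "(\<Sum>y\<in>UNIV. h y * y ^ ?e) = (\<Sum>y\<in>UNIV. h (x + y) * y ^ ?e)"
        by (simp add: h_add distrib_right sum.distrib sum_distrib_left)
      also have "\<dots> = (\<Sum>T\<in>Pow {..<t}. c T * (\<Sum>y\<in>UNIV. (x + y) ^ expo T * y ^ ?e))"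
        unfolding c sum_distrib_right sum_distrib_left by (subst sum.swap) (simp add: mult.assoc)
      also have "\<dots> = (\<Sum>T\<in>Pow {..<t}. if b \<in> T then - (c T * x ^ expo (T - {b})) else 0)"
        proof (intro sum.cong refl)
        fix T assume T: "T \<in> Pow {..<t}"
        show "c T * (\<Sum>y\<in>UNIV. (x + y) ^ expo T * y ^ ?e) =
            (if b \<in> T then - (c T * x ^ expo (T - {b})) else 0)"
          unfolding inner[OF T] by simp
      qed
      also have "\<dots> = - (\<Sum>T\<in>R. c T * x ^ expo (T - {b}))"
        unfolding sum_negf[symmetric] R_def by (subst sum.inter_filter) auto
      finally show ?thesis by simp
    qed
    have sub: "T0 - {b} \<subseteq> {..<t}" "T0 - {b} \<noteq> {}" using T0 by auto
    let ?d = "CARD('a) - 1 - expo (T0 - {b})"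
    have pos: "0 < expo (T0 - {b})" "expo (T0 - {b}) < CARD('a) - 1"
      using sub expo_pos expo_less by auto
    have R: "T0 \<in> R" "finite R" using T0 by (auto simp: R_def)
    have "(\<Sum>x\<in>UNIV. (\<Sum>T\<in>R. c T * x ^ expo (T - {b})) * x ^ ?d) =
        (\<Sum>T\<in>R. c T * (\<Sum>x\<in>UNIV. x ^ expo (T - {b}) * x ^ ?d))"
      unfolding sum_distrib_right sum_distrib_left by (subst sum.swap) (simp add: mult.assoc)
    also have "\<dots> = (\<Sum>T\<in>R. if T = T0 then - c T else 0)"
    proof (intro sum.cong refl)
      fix T assume T: "T \<in> R"
      have "expo (T - {b}) = expo (T0 - {b}) \<longleftrightarrow> T - {b} = T0 - {b}"
        using T T0 by (intro expo_inj) (auto simp: R_def)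
      also have "\<dots> \<longleftrightarrow> T = T0" using T T0 by (auto simp: R_def)
      finally show "c T * (\<Sum>x\<in>UNIV. x ^ expo (T - {b}) * x ^ ?d) = (if T = T0 then - c T else 0)"
        using T pos by (subst power_orthogonality) (auto simp: R_def intro!: expo_less)
    qed
    also have "\<dots> = - c T0" using R by simp
    finally have "c T0 = - (\<Sum>x\<in>UNIV. (\<Sum>T\<in>R. c T * x ^ expo (T - {b})) * x ^ ?d)" by simp
    \<comment> \<open>By \<open>key\<close> the function is constant in \<open>x\<close>, and a
      constant has no coefficient at the positive exponent \<open>expo (T0 - {b})\<close>.\<close>
    also have "\<dots> = (\<Sum>y\<in>UNIV. h y * y ^ ?e) * (\<Sum>x\<in>UNIV. x ^ 0 * x ^ ?d)"
      by (simp add: key sum_negf sum_distrib_left)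
    also have "\<dots> = 0" using pos by (subst power_orthogonality) auto
    finally show ?thesis .
  qed
  have c0: "c {} = 0"
  proof -
    have "0 = (\<Sum>T\<in>Pow {..<t}. c T * 0 ^ expo T)" using c[of 0] h_0 by simp
    also have "\<dots> = (\<Sum>T\<in>Pow {..<t}. if T = {} then c T else 0)"
      by (intro sum.cong refl) (auto simp: expo_pos, simp add: expo_def)
    finally show ?thesis by simp
  qed
  have "h x = (\<Sum>i<t. c {i} * x ^ (q ^ i))" for x
  proof -
    have "h x = (\<Sum>T\<in>(\<lambda>i. {i}) ` {..<t}. c T * x ^ expo T)"
      unfolding c
    proof (rule sum.mono_neutral_right)
      show "\<forall>T\<in>Pow {..<t} - (\<lambda>i. {i}) ` {..<t}. c T * x ^ expo T = 0"
      proof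
        fix T assume T: "T \<in> Pow {..<t} - (\<lambda>i. {i}) ` {..<t}"
        show "c T * x ^ expo T = 0"
        proof (cases "T = {}")
          case False
          then obtain b where "b \<in> T" by auto
          thus ?thesis using vanish[of T b] T by auto
        qed (simp add: c0)
      qed
    qed auto
    also have "\<dots> = (\<Sum>i<t. c {i} * x ^ (q ^ i))" by (subst sum.reindex) (auto simp: expo_def)
    finally show ?thesis .
  qed
  thus ?thesis by (intro exI[of _ "\<lambda>i. c {i}"] allI)
qed

text \<open>The digits of \<open>expo S\<close> are at most \<open>1\<close>, so the coefficient of \<open>x ^ (2 * q ^ j)\<close> in
  \<open>h x ^ expo {0, k}\<close> vanishes.  This is where \<open>q > 2\<close> enters.\<close>

lemma norm_preserving_monomial: "\<exists>a s. s < t \<and> (\<forall>x. h x = a * x ^ (q ^ s))"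
proof -
  obtain a where a: "\<And>x. h x = (\<Sum>i<t. a i * x ^ (q ^ i))"
    using norm_preserving_linearized by blast
  have cross: "a j * a i = 0" if ij: "i < j" "j < t" for i j
  proof -
    \<comment> \<open>With this shift, \<open>h x * h x ^ (q ^ k)\<close> produces
      \<open>x ^ (2 * q ^ j)\<close> only from the term \<open>j\<close> of the first factor and the
      term \<open>i\<close> of the second.\<close>
    define k where "k = j - i"
    have k: "0 < k" "k < t" using ij by (auto simp: k_def)
    \<comment> \<open>\<open>norm_preserving_power_expo\<close> applies to proper subsets only;
      \<open>t \<ge> 3\<close> leaves an index outside \<open>{0, k}\<close>.\<close>
    have "{0, k} \<subset> {..<t}"
    proof -
      have "card {0, k} \<noteq> card {..<t}" using t_ge_3 by (simp add: card_insert_if)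
      hence "{0, k} \<noteq> {..<t}" by metis
      thus ?thesis using k by (intro psubsetI) auto
    qed
    then obtain c where c: "\<And>x. h x ^ expo {0, k} = (\<Sum>T\<in>Pow {..<t}. c T * x ^ expo T)"
      using norm_preserving_power_expo by blast
    let ?e = "CARD('a) - 1 - 2 * q ^ j"
    have qj: "0 < 2 * q ^ j" "2 * q ^ j < CARD('a) - 1"
      using q_gt_2 two_powers_less[of j j] ij by auto
    have "(\<Sum>x\<in>UNIV. h x ^ expo {0, k} * x ^ ?e) =
        (\<Sum>T\<in>Pow {..<t}. c T * (\<Sum>x\<in>UNIV. x ^ expo T * x ^ ?e))"
      unfolding c sum_distrib_right sum_distrib_left by (subst sum.swap) (simp add: mult.assoc)
    also have "\<dots> = 0"
    proof (intro sum.neutral ballI)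
      fix T assume "T \<in> Pow {..<t}"
      thus "c T * (\<Sum>x\<in>UNIV. x ^ expo T * x ^ ?e) = 0"
        using qj expo_neq_two_power[of T j] ij by (subst power_orthogonality) (auto intro!: expo_less)
    qed
    finally have zero: "(\<Sum>x\<in>UNIV. h x ^ expo {0, k} * x ^ ?e) = 0" .
    have pw: "h x ^ expo {0, k} =
        (\<Sum>r<t. \<Sum>l<t. a r * a l ^ (q ^ k) * x ^ (q ^ r + q ^ ((l + k) mod t)))" for x
    proof -
      have "h x ^ expo {0, k} = h x * h x ^ (q ^ k)"
        using k by (simp add: expo_def power_add)
      also have "h x ^ (q ^ k) = (\<Sum>l<t. a l ^ (q ^ k) * x ^ (q ^ ((l + k) mod t)))"
        by (simp add: a frob_iter_sum power_mult_distrib frob_mod frob_add_exp)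
      finally show ?thesis
        by (simp add: a sum_product power_add mult_ac)
    qed
    have "0 = (\<Sum>r<t. \<Sum>l<t. a r * a l ^ (q ^ k) * (\<Sum>x\<in>UNIV. x ^ (q ^ r + q ^ ((l + k) mod t)) * x ^ ?e))"
      unfolding zero[symmetric] pw sum_distrib_right sum_distrib_left
      by (subst sum.swap, rule sum.cong[OF refl], subst sum.swap) (simp add: mult.assoc)
    also have "\<dots> = (\<Sum>r<t. \<Sum>l<t. if r = j \<and> l = i then - (a r * a l ^ (q ^ k)) else 0)"
    proof (intro sum.cong refl)
      fix r l assume "r \<in> {..<t}" "l \<in> {..<t}"
      hence rl: "r < t" "l < t" by auto
      have m: "(l + k) mod t < t" using t_ge_3 by simp
      have "q ^ r + q ^ ((l + k) mod t) = 2 * q ^ j \<longleftrightarrow> r = j \<and> (l + k) mod t = j"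
        using two_powers_eq_iff rl m ij by blast
      also have "(l + k) mod t = j \<longleftrightarrow> l = i"
        using rl ij by (auto simp: k_def mod_if)
      finally show "a r * a l ^ (q ^ k) * (\<Sum>x\<in>UNIV. x ^ (q ^ r + q ^ ((l + k) mod t)) * x ^ ?e) =
          (if r = j \<and> l = i then - (a r * a l ^ (q ^ k)) else 0)"
        using qj two_powers_less[OF rl(1) m] by (subst power_orthogonality) auto
    qed
    also have "\<dots> = (\<Sum>r<t. if r = j then - (a r * a i ^ (q ^ k)) else 0)"
      using ij by (intro sum.cong refl) auto
    also have "\<dots> = - (a j * a i ^ (q ^ k))" using ij by simp
    finally show ?thesis by auto
  qed
  show ?thesis
  proof (cases "\<exists>s<t. a s \<noteq> 0")
    case True
    then obtain s where s: "s < t" "a s \<noteq> 0" by auto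
    have other: "a i = 0" if "i < t" "i \<noteq> s" for i
      using cross[of i s] cross[of s i] s that by (metis linorder_neqE_nat mult_eq_0_iff)
    have "h x = a s * x ^ (q ^ s)" for x
    proof -
      have "h x = (\<Sum>i<t. if i = s then a i * x ^ (q ^ i) else 0)"
        unfolding a by (intro sum.cong refl) (auto simp: other)
      thus ?thesis using s by simp
    qed
    thus ?thesis using s by blast
  next
    case False
    hence "h x = 0 * x ^ (q ^ 0)" for x by (simp add: a)
    moreover have "0 < t" using t_ge_3 by simp
    ultimately show ?thesis by blast
  qed
qed

end

end

section \<open>Frobenius powers and the embedded subfield\<close>

lemma field_embedding_inj:
  fixes h :: "'k::field \<Rightarrow> 'a::field"
  assumes "field_embedding h"
  shows "inj h"
proof -
  have h: "h 1 = 1" "\<And>x y. h (x + y) = h x + h y" "\<And>x y. h (x * y) = h x * h y"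
    using assms by (auto simp: field_embedding_def)
  have "x = y" if "h x = h y" for x y
  proof (rule ccontr)
    assume "x \<noteq> y"
    hence "h (x - y) * h (inverse (x - y)) = 1" using h(1) by (simp flip: h(3))
    moreover have "h (x - y) = 0" using h(2)[of "x - y" y] that by simp
    ultimately show False by simp
  qed
  thus ?thesis by (rule injI)
qed

lemma field_embedding_power: "field_embedding h \<Longrightarrow> h (x ^ n) = h x ^ n"
  by (induction n) (auto simp: field_embedding_def)

text \<open>The image consists of roots of \<open>X ^ CARD('k) - X\<close>, and the degree allows no
  more roots than the image has elements.\<close>

lemma range_embedding_eq:
  fixes emb :: "'k::{field,finite} \<Rightarrow> 'a::field"
  assumes "field_embedding emb"
  shows "range emb = {c. c ^ CARD('k) = c}"
proof (rule card_seteq)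
  let ?q = "CARD('k)"
  have q: "?q > 1" by (rule card_field_gt_1)
  let ?p = "monom 1 ?q - monom 1 1 :: 'a poly"
  have "coeff ?p ?q = 1" using q by simp
  hence p: "?p \<noteq> 0" by (metis coeff_0 zero_neq_one)
  have "degree ?p \<le> ?q"
    using q by (intro degree_diff_le) (auto simp: degree_monom_eq)
  moreover have eq: "{x. poly ?p x = 0} = {c. c ^ ?q = c}" by (auto simp: poly_monom)
  ultimately have "card {c::'a. c ^ ?q = c} \<le> ?q" using card_poly_roots_bound[OF p] by simp
  also have "?q = card (range emb)"
    using card_image[OF field_embedding_inj[OF assms]] by simp
  finally show "card {c::'a. c ^ ?q = c} \<le> card (range emb)" .
  show "finite {c::'a. c ^ ?q = c}" using poly_roots_finite[OF p] eq by simp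
  show "range emb \<subseteq> {c. c ^ ?q = c}"
    using field_embedding_power[OF assms, of _ ?q] by (auto simp: finite_field_power_card)
qed

text \<open>\<open>(X + 1)^q - X^q - 1\<close> has degree less than \<open>q\<close> but vanishes on the embedded subfield.\<close>

lemma frobenius_additive:
  fixes emb :: "'k::{field,finite} \<Rightarrow> 'a::field" and x y :: 'a
  assumes emb: "field_embedding emb"
  shows "(x + y) ^ CARD('k) = x ^ CARD('k) + y ^ CARD('k)"
proof (cases "y = 0")
  case True
  thus ?thesis using card_field_gt_1[where 'a='k] by simp
next
  case False
  let ?q = "CARD('k)"
  have q: "?q > 1" by (rule card_field_gt_1)
  define R where "R = [:1, 1:] ^ ?q - monom 1 ?q - (1 :: 'a poly)"
  have R_eval: "poly R u = (u + 1) ^ ?q - u ^ ?q - 1" for u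
    by (simp add: R_def poly_monom add.commute)
  have deg1: "degree ([:1, 1:] ^ ?q :: 'a poly) = ?q" by (simp add: degree_power_eq)
  have "degree R \<le> ?q"
    unfolding R_def by (intro degree_diff_le) (auto simp: deg1 degree_monom_le)
  moreover have "coeff R ?q = 0"
  proof -
    have "lead_coeff ([:1, 1:] ^ ?q :: 'a poly) = 1" by (simp add: lead_coeff_power)
    thus ?thesis using q by (simp add: R_def deg1)
  qed
  ultimately have deg: "R = 0 \<or> degree R < ?q"
    by (metis leading_coeff_0_iff le_neq_implies_less)
  have "range emb \<subseteq> {u. poly R u = 0}"
  proof
    fix c assume c: "c \<in> range emb"
    have "emb 1 + c \<in> range emb"
      using c emb unfolding field_embedding_def by (metis (no_types, lifting) imageE rangeI)
    hence "(c + 1) ^ ?q = c + 1" "c ^ ?q = c"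
      using c emb range_embedding_eq[OF emb] by (auto simp: field_embedding_def add.commute)
    thus "c \<in> {u. poly R u = 0}" by (simp add: R_eval)
  qed
  hence "?q \<le> card {u. poly R u = 0}" if "R \<noteq> 0"
    using card_mono[OF poly_roots_finite[OF that], of "range emb"]
      card_image[OF field_embedding_inj[OF emb]] by simp
  hence "R = 0" using card_poly_roots_bound[of R] deg by fastforce
  hence "(x / y + 1) ^ ?q = (x / y) ^ ?q + 1" using R_eval[of "x / y"] by (simp add: diff_eq_eq add.commute)
  moreover have "x + y = y * (x / y + 1)" using False by (simp add: field_simps)
  ultimately have "(x + y) ^ ?q = y ^ ?q * ((x / y) ^ ?q + 1)" by (simp only: power_mult_distrib)
  thus ?thesis using False by (simp add: power_divide distrib_left)
qed

section \<open>The values of \<open>c ^ (q ^ s) / c\<close>, and the automorphisms fixing the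
  subfield\<close>

context finite_extension
begin

lemma frob_surj: "\<exists>c::'a. c ^ (q ^ i) = y"
proof -
  have "(y ^ (q ^ (t * i - i))) ^ (q ^ i) = y ^ (q ^ (t * i))"
    using t_ge_3 by (simp add: frob_add_exp)
  also have "\<dots> = y" using frob_mod[of y "t * i"] by simp
  finally show ?thesis by blast
qed

lemma frob_inj: "(x::'a) ^ (q ^ i) = y ^ (q ^ i) \<Longrightarrow> x = y"
  using frob_iter_diff[of x y i] by simp

lemma frob_mult_exp: "((x::'a) ^ (q ^ i)) ^ n = (x ^ n) ^ (q ^ i)"
  by (simp flip: power_mult add: mult.commute)

lemma telescoping_product:
  "(x::'a) \<noteq> 0 \<Longrightarrow> (\<Prod>i<k. x ^ (r ^ i)) ^ r / (\<Prod>i<k. x ^ (r ^ i)) = x ^ (r ^ k) / x"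
proof (induction k)
  case (Suc k)
  let ?P = "\<Prod>i<k. x ^ (r ^ i)"
  have P: "?P \<noteq> 0" using Suc.prems by simp
  have "(?P * x ^ (r ^ k)) ^ r / (?P * x ^ (r ^ k)) = (?P ^ r / ?P) * (x ^ (r ^ Suc k) / x ^ (r ^ k))"
    by (simp add: power_mult_distrib power_mult mult.commute[of r])
  also have "\<dots> = x ^ (r ^ Suc k) / x"
    unfolding Suc.IH[OF Suc.prems] using Suc.prems by simp
  finally show ?case by (simp only: prod.lessThan_Suc)
qed simp

text \<open>\<open>frob_quot 1 c\<close> is the slope of the point of
  \<open>pseudoregulus_L0\<close> spanned by \<open>(c, c ^ q)\<close>.\<close>

definition frob_quot :: "nat \<Rightarrow> 'a \<Rightarrow> 'a"
  where "frob_quot s c = c ^ (q ^ s) / c"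

text \<open>The witness is the product of the first \<open>k\<close> iterates of
  \<open>x \<mapsto> x ^ (q ^ s)\<close> at \<open>c\<close>, for which the quotient
  telescopes.\<close>

lemma frob_quot_telescope: "c \<noteq> 0 \<Longrightarrow> \<exists>d. d \<noteq> 0 \<and> frob_quot s d = frob_quot (s * k) c"
  using telescoping_product[of c "q ^ s" k]
  by (intro exI[of _ "\<Prod>i<k. c ^ ((q ^ s) ^ i)"]) (auto simp: frob_quot_def power_mult)

lemma coprime_inverse_mod:
  assumes "coprime s t"
  obtains k where "(s * k) mod t = 1"
proof -
  obtain k where "[s * k = 1] (mod t)" using cong_solve_coprime_nat[OF assms] by (auto simp: One_nat_def)
  hence "(s * k) mod t = 1" using t_ge_3 by (simp add: cong_def)
  thus ?thesis by (rule that)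
qed

text \<open>Both inclusions telescope: \<open>s\<close> is a multiple of 1, and 1 is congruent to a
  multiple of \<open>s\<close> modulo \<open>t\<close>.\<close>

lemma frob_quot_coprime:
  assumes "coprime s t"
  shows "frob_quot s ` (- {0}) = frob_quot 1 ` (- {0})"
proof (intro equalityI subsetI)
  fix y assume "y \<in> frob_quot s ` (- {0})"
  then obtain c where c: "c \<noteq> 0" "y = frob_quot s c" by auto
  then obtain d where "d \<noteq> 0" "frob_quot 1 d = y"
    using frob_quot_telescope[of c 1 s] by auto
  thus "y \<in> frob_quot 1 ` (- {0})" by blast
next
  fix y assume "y \<in> frob_quot 1 ` (- {0})"
  then obtain c where c: "c \<noteq> 0" "y = frob_quot 1 c" by auto
  obtain k where k: "(s * k) mod t = 1" using coprime_inverse_mod[OF assms] .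
  have "frob_quot (s * k) c = frob_quot 1 c"
    using frob_mod[of c "s * k"] by (simp add: k frob_quot_def)
  then obtain d where "d \<noteq> 0" "frob_quot s d = y"
    using frob_quot_telescope[of c s k] c by auto
  thus "y \<in> frob_quot s ` (- {0})" by blast
qed

text \<open>If \<open>d = gcd s t > 1\<close>, then the norm to the subfield of order \<open>q ^ d\<close> kills every
  \<open>frob_quot s c\<close>, but not every \<open>frob_quot 1 c\<close>.\<close>

lemma coprime_of_frob_quot:
  assumes sub: "frob_quot 1 ` (- {0}) \<subseteq> frob_quot s ` (- {0})"
  shows "coprime s t"
proof (rule ccontr)
  assume "\<not> coprime s t"
  define d where "d = gcd s t"
  have d: "d > 1" "d dvd s" "d dvd t"
  proof -
    have "gcd s t \<noteq> 1" "gcd s t > 0" using \<open>\<not> coprime s t\<close> t_ge_3 by (auto simp: coprime_iff_gcd_eq_1)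
    thus "d > 1" unfolding d_def by linarith
  qed (auto simp: d_def)
  obtain j r where j: "s = d * j" and r: "t = d * r" using d by (auto elim!: dvdE)
  have rpos: "r > 0" using r t_ge_3 by (cases r) auto
  \<comment> \<open>The indices congruent to \<open>e\<close> modulo \<open>d\<close>. The norm to
    the subfield of order \<open>q ^ d\<close> has exponent \<open>expo (S 0)\<close>, and
    multiplication by \<open>q\<close> turns this exponent into \<open>expo (S 1)\<close>.\<close>
  define S where "S e = (\<lambda>i. d * i + e) ` {..<r}" for e
  have S_sub: "S e \<subseteq> {..<t}" if "e < d" for e
  proof
    fix l assume "l \<in> S e"
    then obtain i where i: "i < r" "l = d * i + e" by (auto simp: S_def)
    have "d * (i + 1) \<le> d * r" using i by (intro mult_left_mono) auto
    thus "l \<in> {..<t}" using i that r by (simp add: algebra_simps)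
  qed
  have expo_S: "expo (S e) = (\<Sum>i<r. q ^ (d * i + e))" for e
    unfolding expo_def S_def using d by (subst sum.reindex) (auto simp: inj_on_def)
  define M where "M c = (c::'a) ^ expo (S 0)" for c
  have M_prod: "M c = (\<Prod>i<r. c ^ ((q ^ d) ^ i))" for c
    by (simp add: M_def expo_S power_sum power_mult)
  have M_quot: "M (frob_quot s c) = 1" if c0: "c \<noteq> 0" for c
  proof -
    obtain z where z: "z \<noteq> 0" "frob_quot d z = frob_quot s c"
      using frob_quot_telescope[OF c0, of d j] by (auto simp: j)
    have "M (z ^ (q ^ d)) / M z = z ^ ((q ^ d) ^ r) / z"
      using telescoping_product[OF z(1), of "q ^ d" r]
      by (simp add: M_prod prod_power_distrib frob_mult_exp)
    also have "\<dots> = 1" using z frob_t[of z] by (simp add: r power_mult)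
    finally show ?thesis
      unfolding z(2)[symmetric] by (simp add: frob_quot_def M_def power_divide)
  qed
  \<comment> \<open>By the assumed inclusion this norm kills \<open>c ^ q / c\<close> as well, so
    two powers with different exponents agree as functions. Orthogonality excludes this
    below.\<close>
  have eq: "c ^ expo (S 1) = c ^ expo (S 0)" for c :: 'a
  proof (cases "c = 0")
    case False
    have "frob_quot 1 c \<in> frob_quot s ` (- {0})" using sub False by auto
    then obtain x where "x \<noteq> 0" "frob_quot 1 c = frob_quot s x" by auto
    hence "M (frob_quot 1 c) = 1" using M_quot by simp
    hence "(c ^ q) ^ expo (S 0) = c ^ expo (S 0)"
      using False by (simp add: M_def frob_quot_def power_divide)
    moreover have "q * expo (S 0) = expo (S 1)" by (simp add: expo_S sum_distrib_left power_add mult.commute)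
    ultimately show ?thesis by (metis power_mult)
  next
    case True
    have "S e \<noteq> {}" for e using rpos by (auto simp: S_def lessThan_empty_iff)
    thus ?thesis using expo_pos S_sub d(1) True by (metis less_trans zero_less_one power_0_left less_irrefl)
  qed
  have ne: "expo (S 0) \<noteq> expo (S 1)"
  proof -
    have "0 \<in> S 0" using rpos by (auto simp: S_def)
    moreover have "0 \<notin> S 1" by (auto simp: S_def)
    ultimately have "S 0 \<noteq> S 1" by metis
    thus ?thesis using expo_inj S_sub d(1) by auto
  qed
  have bounds: "0 < expo (S 0)" "expo (S 0) < CARD('a) - 1" "expo (S 1) < CARD('a) - 1"
  proof -
    have "S 0 \<subseteq> {..<t}" "S 1 \<subseteq> {..<t}" using S_sub d(1) by auto
    moreover have "S 0 \<noteq> {}" using rpos by (auto simp: S_def lessThan_empty_iff)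
    ultimately show "0 < expo (S 0)" "expo (S 0) < CARD('a) - 1" "expo (S 1) < CARD('a) - 1"
      using expo_pos[of "S 0"] expo_less by auto
  qed
  have "(\<Sum>c\<in>UNIV. (c::'a) ^ expo (S 0) * c ^ (CARD('a) - 1 - expo (S 0))) =
      (\<Sum>c\<in>UNIV. c ^ expo (S 1) * c ^ (CARD('a) - 1 - expo (S 0)))"
    by (simp only: eq)
  thus False using bounds ne by (subst (asm) (1 2) power_orthogonality) auto
qed

text \<open>The values \<open>c ^ (q - 1)\<close> are roots of \<open>X ^ expo {..<t} - 1\<close>,
  which bounds their number from above. The fibres of this power map have at most
  \<open>q - 1\<close> elements, which bounds it from below.\<close>

lemma card_frob_quot: "card (frob_quot 1 ` (- {0})) = (q ^ t - 1) div (q - 1)"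
proof -
  let ?A = "- {0::'a}" and ?I = "frob_quot 1 ` (- {0})" and ?m = "expo {..<t}"
  note m = expo_full
  have quot: "frob_quot 1 c = c ^ (q - 1)" if "c \<noteq> 0" for c
    using q_gt_2 that power_diff[of c 1 q] by (simp add: frob_quot_def)
  have "?I \<subseteq> {y. y ^ ?m = 1}"
    using finite_field_power_card_minus_1[where 'a='a]
    by (auto simp: quot card_field simp flip: power_mult m)
  hence "card ?I \<le> ?m"
    using card_power_eq_le[of ?m "1::'a"] expo_pos[of "{..<t}"] t_ge_3 card_mono[of "{y. y ^ ?m = 1}" ?I]
    by (simp add: lessThan_empty_iff)
  moreover have "(q - 1) * ?m \<le> (q - 1) * card ?I"
  proof -
    have "(q - 1) * ?m = card ?A" by (simp add: m card_field Compl_eq_Diff_UNIV card_Diff_singleton)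
    also have "\<dots> = (\<Sum>y\<in>?I. card {c \<in> ?A. frob_quot 1 c = y})"
      using sum.image_gen[of ?A "\<lambda>_. 1::nat" "frob_quot 1"] by simp
    also have "\<dots> \<le> (\<Sum>y\<in>?I. q - 1)"
    proof (rule sum_mono)
      fix y
      have "{c \<in> ?A. frob_quot 1 c = y} \<subseteq> {c. c ^ (q - 1) = y}" by (auto simp: quot)
      thus "card {c \<in> ?A. frob_quot 1 c = y} \<le> q - 1"
        using card_power_eq_le[of "q - 1" y] q_gt_2 card_mono order_trans
        by (metis (no_types, lifting) zero_less_diff less_trans one_less_numeral_iff semiring_norm(76))
    qed
    finally show ?thesis by (simp add: mult.commute)
  qed
  ultimately have "card ?I = ?m" using q_gt_2 by simp
  thus ?thesis using q_gt_2 by (simp flip: m)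
qed

lemma nrm_0 [simp]: "nrm 0 = 0"
  by (simp only: nrm_eq_0_iff)

text \<open>Raising to the power \<open>q\<close> shifts the conjugates cyclically; the extra factor
  \<open>x\<close> closes the cycle and is cancelled when it is nonzero.\<close>

lemma nrm_frob: "nrm x ^ q = nrm x"
proof -
  have "x * (\<Prod>j<t. x ^ (q ^ Suc j)) = (\<Prod>j<Suc t. x ^ (q ^ j))"
    by (subst prod.lessThan_Suc_shift) simp
  also have "\<dots> = nrm x * x" by (simp add: nrm_def frob_t)
  finally have "x * (\<Prod>j<t. x ^ (q ^ Suc j)) = x * nrm x" by (simp add: mult.commute)
  moreover have "nrm x ^ q = (\<Prod>j<t. x ^ (q ^ Suc j))"
    by (simp add: nrm_def prod_power_distrib power_mult mult.commute[of q])
  ultimately show ?thesis proof (cases "x = 0")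
    case True
    thus ?thesis using q_gt_2 by simp
  qed simp
qed

lemma nrm_quot: "x \<noteq> 0 \<Longrightarrow> nrm (x ^ q / x) = 1"
proof -
  assume "x \<noteq> 0"
  have "nrm (x ^ q / x) = nrm (x ^ q) / nrm x" by (simp add: nrm_def power_divide prod_dividef)
  also have "nrm (x ^ q) = nrm x ^ q"
    by (simp add: nrm_def prod_power_distrib frob_mult_exp)
  finally show ?thesis using \<open>x \<noteq> 0\<close> by (simp add: nrm_frob)
qed

lemma nrm_mult: "nrm (x * y) = nrm x * nrm y"
  by (simp add: nrm_def power_mult_distrib prod.distrib)

text \<open>Norms lie in the fixed subfield, so such a map preserves the norm and is a monomial by
  \<open>norm_preserving_monomial\<close>; its value at 1 makes the coefficient 1. Thus the theorem
  on norm-preserving maps also determines the Galois group.\<close>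

lemma automorphism_is_frob:
  assumes "field_embedding \<theta>" "\<And>c::'a. c ^ q = c \<Longrightarrow> \<theta> c = c"
  shows "\<exists>s<t. \<forall>x. \<theta> x = x ^ (q ^ s)"
proof -
  have \<theta>: "\<theta> 1 = 1" "\<And>x y. \<theta> (x + y) = \<theta> x + \<theta> y" "\<And>x y. \<theta> (x * y) = \<theta> x * \<theta> y"
    using assms(1) by (auto simp: field_embedding_def)
  have "\<theta> (prod g A) = (\<Prod>j\<in>A. \<theta> (g j))" for g and A :: "nat set"
    by (induction A rule: infinite_finite_induct) (auto simp: \<theta>)
  hence "nrm (\<theta> x) = \<theta> (nrm x)" for x
    by (simp add: nrm_def field_embedding_power[OF assms(1)])
  hence "nrm (\<theta> x) = nrm x" for x using assms(2)[OF nrm_frob] by simp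
  then obtain a s where as: "s < t" "\<And>x. \<theta> x = a * x ^ (q ^ s)"
    using norm_preserving_monomial[of \<theta>] \<theta>(2) by blast
  thus ?thesis using \<theta>(1) as(2)[of 1] by auto
qed

end

section \<open>Semilinear maps fixing a subgeometry\<close>

definition functional :: "('a::field ^ 'n \<Rightarrow> 'a) \<Rightarrow> bool"
  where "functional v \<longleftrightarrow> (\<forall>x y. v (x + y) = v x + v y) \<and> (\<forall>c x. v (c *s x) = c * v x)"

lemma functional_add: "functional v \<Longrightarrow> v (x + y) = v x + v y"
  and functional_scale: "functional v \<Longrightarrow> v (c *s x) = c * v x"
  by (auto simp: functional_def)

lemma functional_0: "functional v \<Longrightarrow> v 0 = 0"
  using functional_scale[of v 0 0] by simp

lemma functional_diff: "functional v \<Longrightarrow> v (x - y) = v x - v y"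
  using functional_add[of v "x - y" y] by simp

lemma functional_sum: "functional v \<Longrightarrow> v (sum g A) = (\<Sum>i\<in>A. v (g i))"
  by (induction A rule: infinite_finite_induct) (auto simp: functional_0 functional_add)

lemma functional_kernel: "functional v \<Longrightarrow> vec.subspace {x. v x = 0}"
  by (rule vec.subspaceI) (auto simp: functional_0 functional_add functional_scale)

lemma functional_eq_on_span:
  assumes "functional u" "functional v" "\<And>w. w \<in> W \<Longrightarrow> u w = v w" "x \<in> vec.span W"
  shows "u x = v x"
  using assms(4)
proof (induction rule: vec.span_induct_alt)
  case base
  thus ?case using assms by (simp add: functional_0)
next
  case (step c w y)
  thus ?case using assms by (simp add: functional_add functional_scale)
qed

text \<open>The small field is absent here as well: \<open>W\<close> is known through the
  fixed-point equation, its span over the large field and its cardinality.\<close>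

locale subgeometry_frobenius = finite_extension field_type q t
  for field_type :: "'a::{field,finite} itself" and q t +
  fixes \<phi> :: "'a ^ 'n \<Rightarrow> 'a ^ 'n" and W :: "('a ^ 'n) set"
  assumes card_n: "CARD('n) = t"
    and phi_add: "\<phi> (x + y) = \<phi> x + \<phi> y"
    and phi_scale: "\<phi> (c *s x) = c ^ q *s \<phi> x"
    and phi_t: "(\<phi> ^^ t) x = x"
    and W_eq: "W = {x. \<phi> x = x}"
    and span_W: "vec.span W = UNIV"
    and card_W: "card W = q ^ t"
begin

lemma iter_add: "(\<phi> ^^ i) (x + y) = (\<phi> ^^ i) x + (\<phi> ^^ i) y"
  by (induction i) (auto simp: phi_add)

lemma iter_scale: "(\<phi> ^^ i) (c *s x) = c ^ (q ^ i) *s (\<phi> ^^ i) x"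
  by (induction i) (auto simp: phi_scale simp flip: power_mult intro!: arg_cong2[where f = "(*s)"] simp: mult.commute)

lemma iter_0: "(\<phi> ^^ i) 0 = 0"
  using iter_add[of i 0 0] by (metis add_cancel_right_right)

lemma iter_diff: "(\<phi> ^^ i) (x - y) = (\<phi> ^^ i) x - (\<phi> ^^ i) y"
  using iter_add[of i "x - y" y] by (simp add: algebra_simps)

lemma iter_sum: "(\<phi> ^^ i) (sum g A) = (\<Sum>x\<in>A. (\<phi> ^^ i) (g x))"
  by (induction A rule: infinite_finite_induct) (auto simp: iter_0 iter_add)

lemma iter_iter: "(\<phi> ^^ i) ((\<phi> ^^ j) x) = (\<phi> ^^ (i + j)) x"
  by (simp add: funpow_add)

lemma iter_t_mult: "(\<phi> ^^ (t * k)) x = x"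
  by (induction k) (auto simp: funpow_add phi_t)

lemma iter_mod: "(\<phi> ^^ (i mod t)) x = (\<phi> ^^ i) x"
proof -
  have "(\<phi> ^^ i) x = (\<phi> ^^ (i mod t + t * (i div t))) x" by simp
  thus ?thesis by (simp only: funpow_add comp_apply iter_t_mult)
qed

lemma iter_cong: "i mod t = j mod t \<Longrightarrow> (\<phi> ^^ i) x = (\<phi> ^^ j) x"
  by (metis iter_mod)

lemma iter_inverse: "\<exists>j. \<forall>x. (\<phi> ^^ j) ((\<phi> ^^ i) x) = x \<and> (\<phi> ^^ i) ((\<phi> ^^ j) x) = x"
proof (intro exI allI)
  fix x
  have "t * i - i + i = t * i" using t_ge_3 by simp
  thus "(\<phi> ^^ (t * i - i)) ((\<phi> ^^ i) x) = x \<and> (\<phi> ^^ i) ((\<phi> ^^ (t * i - i)) x) = x"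
    by (simp add: iter_iter iter_t_mult add.commute)
qed

lemma iter_bij: "bij (\<phi> ^^ i)"
proof -
  obtain j where "\<forall>x. (\<phi> ^^ j) ((\<phi> ^^ i) x) = x \<and> (\<phi> ^^ i) ((\<phi> ^^ j) x) = x"
    using iter_inverse by blast
  thus ?thesis by (intro bijI') metis+
qed

lemma iter_W: "w \<in> W \<Longrightarrow> (\<phi> ^^ i) w = w"
  by (induction i) (auto simp: W_eq)

lemma iter_eq_0_iff: "(\<phi> ^^ i) x = 0 \<longleftrightarrow> x = 0"
  using iter_bij[of i] iter_0[of i] by (metis bij_def inj_eq)

lemma iter_fixed_W:
  assumes "coprime s t" "(\<phi> ^^ s) x = x"
  shows "x \<in> W"
proof -
  obtain k where k: "(s * k) mod t = 1" using coprime_inverse_mod[OF assms(1)] .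
  have "(\<phi> ^^ (s * k)) x = x" for k
    using assms(2) by (induction k) (auto simp: funpow_add)
  hence "(\<phi> ^^ (s * k mod t)) x = x" by (simp add: iter_mod)
  thus ?thesis by (simp add: k W_eq One_nat_def)
qed

lemma mult_bij_mod:
  assumes "coprime s t"
  shows "bij_betw (\<lambda>i. s * i mod t) {..<t} {..<t}"
proof -
  have "inj_on (\<lambda>i. s * i mod t) {..<t}"
  proof (rule inj_onI)
    fix i j assume ij: "i \<in> {..<t}" "j \<in> {..<t}" "s * i mod t = s * j mod t"
    hence "[s * i = s * j] (mod t)" by (simp add: cong_def)
    hence "[i = j] (mod t)" using assms cong_mult_lcancel_nat by blast
    thus "i = j" using ij by (simp add: cong_def)
  qed
  moreover have "(\<lambda>i. s * i mod t) ` {..<t} \<subseteq> {..<t}" using t_ge_3 by auto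
  ultimately show ?thesis
    by (intro bij_betw_imageI) (auto simp: endo_inj_surj)
qed

text \<open>Multiplication by \<open>s\<close> permutes the residues modulo \<open>t\<close>, so
  this is \<open>frob_independent\<close> with relabelled coefficients.\<close>

lemma frob_mult_independent:
  assumes "coprime s t" "\<And>c::'a. (\<Sum>i<t. a i * c ^ (q ^ (s * i))) = 0" "j < t"
  shows "a j = 0"
proof -
  let ?\<beta> = "\<lambda>i. s * i mod t"
  note b = mult_bij_mod[OF assms(1)]
  define a' where "a' l = a (inv_into {..<t} ?\<beta> l)" for l
  have a': "a' (?\<beta> i) = a i" if "i < t" for i
    using bij_betw_inv_into_left[OF b] that by (simp add: a'_def)
  have "(\<Sum>l<t. a' l * c ^ (q ^ l)) = 0" for c
  proof -
    have "(\<Sum>l<t. a' l * c ^ (q ^ l)) = (\<Sum>i<t. a' (?\<beta> i) * c ^ (q ^ ?\<beta> i))"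
      using sum.reindex_bij_betw[OF b, symmetric] .
    also have "\<dots> = 0" using assms(2)[of c] by (simp add: a' frob_mod)
    finally show ?thesis .
  qed
  moreover have "?\<beta> j < t" using t_ge_3 by simp
  ultimately have "a' (?\<beta> j) = 0" by (rule frob_independent)
  thus ?thesis using a' assms(3) by simp
qed

text \<open>Descent by a trace: for \<open>x\<close> in \<open>K\<close> and every scalar
  \<open>c\<close>, the sum of the images of \<open>c *s x\<close> under the powers of
  \<open>\<phi> ^^ s\<close> lies in \<open>K\<close> and is fixed, so it lies in \<open>W\<close>
  and is 0. Read in one coordinate, this is a vanishing combination of Frobenius powers of
  \<open>c\<close>, so the coordinate of \<open>x\<close> is 0.\<close>

lemma stable_subspace_fixed_vector:
  assumes s: "coprime s t" and K: "vec.subspace K" "\<And>x. x \<in> K \<Longrightarrow> (\<phi> ^^ s) x \<in> K"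
    and W0: "K \<inter> W \<subseteq> {0}"
  shows "K \<subseteq> {0}"
proof
  fix x assume x: "x \<in> K"
  have iterK: "(\<phi> ^^ (s * i)) y \<in> K" if "y \<in> K" for y i
    using that by (induction i) (auto simp: funpow_add K(2))
  have y0: "(\<Sum>i<t. c ^ (q ^ (s * i)) *s (\<phi> ^^ (s * i)) x) = 0" (is "?y = 0") for c
  proof -
    let ?g = "\<lambda>i. (\<phi> ^^ (s * i)) (c *s x)"
    have y: "?y = (\<Sum>i<t. ?g i)" by (simp add: iter_scale)
    \<comment> \<open>The shifted sum differs only in its end terms, and these agree since
      \<open>\<phi> ^^ (t * s)\<close> is the identity.\<close>
    have "?g 0 + (\<Sum>i<t. ?g (Suc i)) = (\<Sum>i<t. ?g i) + ?g t"
      using sum.lessThan_Suc_shift[of ?g t] by (simp del: mult_Suc_right)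
    moreover have "?g t = ?g 0" using iter_t_mult[of s "c *s x"] by (simp add: mult.commute)
    ultimately have "(\<Sum>i<t. ?g (Suc i)) = (\<Sum>i<t. ?g i)" by simp
    hence "(\<phi> ^^ s) ?y = ?y" unfolding y iter_sum by (simp add: iter_iter)
    hence "?y \<in> W" by (rule iter_fixed_W[OF s])
    moreover have "?y \<in> K"
      using x K(1) iterK by (intro vec.subspace_sum vec.subspace_scale) auto
    ultimately show ?thesis using W0 by blast
  qed
  have "(\<Sum>i<t. ((\<phi> ^^ (s * i)) x) $ j * c ^ (q ^ (s * i))) = 0" for c j
    using arg_cong[OF y0[of c], of "\<lambda>y. y $ j"] by (simp add: sum_component mult.commute)
  hence "((\<phi> ^^ (s * 0)) x) $ j = 0" for j
    using frob_mult_independent[OF s, of "\<lambda>i. ((\<phi> ^^ (s * i)) x) $ j" 0] t_ge_3 by simp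
  thus "x \<in> {0}" by (simp add: vec_eq_iff)
qed

section \<open>Functionals injective on \<open>W\<close>, their vertices and dual vectors\<close>

definition admissible :: "('a ^ 'n \<Rightarrow> 'a) \<Rightarrow> bool"
  where "admissible v \<longleftrightarrow> functional v \<and> (\<forall>w\<in>W. v w = 0 \<longrightarrow> w = 0)"

definition vertex :: "nat \<Rightarrow> ('a ^ 'n \<Rightarrow> 'a) \<Rightarrow> ('a ^ 'n) set"
  where "vertex s v = {x. v x = 0 \<and> v ((\<phi> ^^ s) x) = 0}"

lemma admissible_functional: "admissible v \<Longrightarrow> functional v"
  by (simp add: admissible_def)

lemma functional_iter_kernel: "functional v \<Longrightarrow> vec.subspace {x. v ((\<phi> ^^ i) x) = 0}"
  by (rule vec.subspaceI)
    (auto simp: iter_0 iter_add iter_scale functional_0 functional_add functional_scale)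

text \<open>The common kernel of the maps \<open>x \<mapsto> v (\<phi>\<^sup>s\<^sup>i x)\<close> is
  stable under \<open>\<phi> ^^ s\<close>, since the index \<open>t\<close> leads back to 0, and it
  meets \<open>W\<close> trivially, so descent applies.\<close>

lemma admissible_zero:
  assumes s: "coprime s t" and v: "admissible v" and x: "\<And>i. i < t \<Longrightarrow> v ((\<phi> ^^ (s * i)) x) = 0"
  shows "x = 0"
proof -
  define K where "K = {x. \<forall>i<t. v ((\<phi> ^^ (s * i)) x) = 0}"
  have K0: "v y = 0" if "y \<in> K" for y
  proof -
    have "0 < t" using t_ge_3 by simp
    hence "v ((\<phi> ^^ (s * 0)) y) = 0" using that unfolding K_def by blast
    thus ?thesis by simp
  qed
  have eq: "K = (\<Inter>i\<in>{..<t}. {x. v ((\<phi> ^^ (s * i)) x) = 0})" by (auto simp: K_def)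
  have "vec.subspace K"
    unfolding eq using admissible_functional[OF v] by (intro vec.subspace_Int functional_iter_kernel)
  moreover have "(\<phi> ^^ s) y \<in> K" if "y \<in> K" for y
  proof -
    have "v ((\<phi> ^^ (s * i)) ((\<phi> ^^ s) y)) = 0" if "i < t" for i
    proof (cases "Suc i < t")
      case True
      hence "v ((\<phi> ^^ (s * Suc i)) y) = 0" using \<open>y \<in> K\<close> unfolding K_def by blast
      thus ?thesis by (simp add: iter_iter add.commute)
    next
      case False
      hence "t = Suc i" using that by simp
      hence "(\<phi> ^^ (s * i)) ((\<phi> ^^ s) y) = y"
        using iter_t_mult[of s y] by (simp add: iter_iter mult.commute add.commute)
      thus ?thesis using K0[OF \<open>y \<in> K\<close>] by simp
    qed
    thus ?thesis by (simp add: K_def)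
  qed
  moreover have "K \<inter> W \<subseteq> {0}"
  proof
    fix w assume w: "w \<in> K \<inter> W"
    thus "w \<in> {0}" using v K0 by (auto simp: admissible_def)
  qed
  ultimately have "K \<subseteq> {0}" using stable_subspace_fixed_vector[OF s] by blast
  thus ?thesis using x by (auto simp: K_def)
qed

lemma index_bij: obtains e :: "'n \<Rightarrow> nat" where "bij_betw e UNIV {..<t}"
  using finite_same_card_bij[of "UNIV :: 'n set" "{..<t}"] card_n by auto

text \<open>The \<open>t\<close> values determine \<open>x\<close> by
  \<open>admissible_zero\<close>. The coordinate map is additive but not linear, and it is
  surjective because it is an injective map of a finite space to itself.\<close>

lemma admissible_interpolation:
  assumes s: "coprime s t" and v: "admissible v"
  shows "\<exists>x. \<forall>i<t. v ((\<phi> ^^ (s * i)) x) = c i"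
proof -
  obtain e :: "'n \<Rightarrow> nat" where e: "bij_betw e UNIV {..<t}" by (rule index_bij)
  define \<Psi> :: "'a ^ 'n \<Rightarrow> 'a ^ 'n" where "\<Psi> x = (\<chi> j. v ((\<phi> ^^ (s * e j)) x))" for x
  note fv = admissible_functional[OF v]
  have "inj \<Psi>"
  proof (rule injI)
    fix x y assume "\<Psi> x = \<Psi> y"
    hence *: "v ((\<phi> ^^ (s * e j)) (x - y)) = 0" for j
      by (simp add: \<Psi>_def vec_eq_iff iter_diff functional_diff[OF fv])
    have "x - y = 0"
    proof (rule admissible_zero[OF s v])
      fix i assume "i < t"
      then obtain j where "e j = i" using e by (auto simp: bij_betw_def image_iff) (metis UNIV_I imageE lessThan_iff)
      thus "v ((\<phi> ^^ (s * i)) (x - y)) = 0" using * by blast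
    qed
    thus "x = y" by simp
  qed
  hence "surj \<Psi>" by (simp add: finite_UNIV_inj_surj)
  then obtain x where x: "\<Psi> x = (\<chi> j. c (e j))" by (metis surjD)
  have "v ((\<phi> ^^ (s * i)) x) = c i" if "i < t" for i
  proof -
    obtain j where "e j = i" using e \<open>i < t\<close> by (metis bij_betw_def imageE lessThan_iff)
    thus ?thesis using x by (auto simp: \<Psi>_def vec_eq_iff)
  qed
  thus ?thesis by blast
qed

definition dual_vector :: "nat \<Rightarrow> ('a ^ 'n \<Rightarrow> 'a) \<Rightarrow> 'a ^ 'n \<Rightarrow> bool"
  where "dual_vector s v p \<longleftrightarrow> (\<forall>i<t. v ((\<phi> ^^ (s * i)) p) = of_bool (i = t - 1))"

definition orbit_comb :: "nat \<Rightarrow> 'a ^ 'n \<Rightarrow> nat \<Rightarrow> (nat \<Rightarrow> 'a) \<Rightarrow> 'a ^ 'n"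
  where "orbit_comb s p m c = (\<Sum>k<m. c k *s (\<phi> ^^ (s * k)) p)"

text \<open>The coordinates of the orbit of \<open>p\<close> form an antidiagonal matrix:
  \<open>v (\<phi> ^^ (s * (i + k))) p\<close> is nonzero only for \<open>i + k = t - 1\<close>.
  Semilinearity adds the Frobenius power to the coefficient.\<close>

lemma dual_vector_eval:
  assumes v: "functional v" and p: "dual_vector s v p" and i: "i < t"
  shows "v ((\<phi> ^^ (s * i)) (orbit_comb s p t c)) = c (t - 1 - i) ^ (q ^ (s * i))"
proof -
  \<comment> \<open>When \<open>i + k\<close> exceeds the range, reduction modulo \<open>t\<close>
    gives at most \<open>t - 2\<close>, so the index \<open>t - 1\<close> is not hit a second
    time.\<close>
  have ev: "v ((\<phi> ^^ (s * (i + k))) p) = of_bool (k = t - 1 - i)" if "k < t" for k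
  proof (cases "i + k < t")
    case True
    thus ?thesis using p i by (auto simp: dual_vector_def of_bool_def)
  next
    case False
    have "(s * (i + k)) mod t = (s * (i + k - t)) mod t"
      using False by (metis le_add_diff_inverse not_less add_mult_distrib2 mult.commute mod_mult_self3)
    hence "(\<phi> ^^ (s * (i + k))) p = (\<phi> ^^ (s * (i + k - t))) p" by (rule iter_cong)
    moreover have "v ((\<phi> ^^ (s * (i + k - t))) p) = of_bool (i + k - t = t - 1)"
      using p i that unfolding dual_vector_def by auto
    moreover have "i + k - t \<noteq> t - 1" "k \<noteq> t - 1 - i" using False i that by auto
    ultimately show ?thesis by simp
  qed
  have "v ((\<phi> ^^ (s * i)) (orbit_comb s p t c)) = (\<Sum>k<t. c k ^ (q ^ (s * i)) * v ((\<phi> ^^ (s * (i + k))) p))"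
    by (simp add: orbit_comb_def iter_sum iter_scale functional_sum[OF v] functional_scale[OF v]
        iter_iter distrib_left)
  also have "\<dots> = (\<Sum>k<t. if k = t - 1 - i then c k ^ (q ^ (s * i)) else 0)"
    by (intro sum.cong) (auto simp: ev)
  also have "\<dots> = c (t - 1 - i) ^ (q ^ (s * i))" using i by simp
  finally show ?thesis .
qed

lemma dual_vector_exists:
  "coprime s t \<Longrightarrow> admissible v \<Longrightarrow> \<exists>p. dual_vector s v p"
  unfolding dual_vector_def by (rule admissible_interpolation)

lemma dual_vector_expansion:
  assumes s: "coprime s t" and v: "admissible v" and p: "dual_vector s v p"
  shows "\<exists>c. x = orbit_comb s p t c"
proof -
  note fv = admissible_functional[OF v]
  \<comment> \<open>The coordinate with index \<open>t - 1 - k\<close> sees \<open>c k\<close>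
    through a power of the Frobenius map, so the coefficient is found by inverting that
    power.\<close>
  have "\<exists>c. \<forall>k. c k ^ (q ^ (s * (t - 1 - k))) = v ((\<phi> ^^ (s * (t - 1 - k))) x)"
    by (intro choice allI frob_surj)
  then obtain c where c: "\<And>k. c k ^ (q ^ (s * (t - 1 - k))) = v ((\<phi> ^^ (s * (t - 1 - k))) x)" by blast
  have "x - orbit_comb s p t c = 0"
  proof (rule admissible_zero[OF s v])
    fix i assume i: "i < t"
    thus "v ((\<phi> ^^ (s * i)) (x - orbit_comb s p t c)) = 0"
      using c[of "t - 1 - i"] by (simp add: iter_diff functional_diff[OF fv] dual_vector_eval[OF fv p])
  qed
  thus ?thesis by auto
qed

text \<open>The coordinates with index 0 and 1 see only the last two coefficients, so the vertex
  consists of the combinations without them.\<close>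

lemma vertex_eq_orbit_combs:
  assumes s: "coprime s t" and v: "admissible v" and p: "dual_vector s v p"
  shows "vertex s v = range (orbit_comb s p (t - 2))"
proof -
  note fv = admissible_functional[OF v]
  define m where "m = t - 2"
  hence m: "t = Suc (Suc m)" using t_ge_3 by simp
  have zero: "v (orbit_comb s p t c) = c (t - 1)" "v ((\<phi> ^^ s) (orbit_comb s p t c)) = c (t - 2) ^ (q ^ s)" for c
    using dual_vector_eval[OF fv p, of 0 c] dual_vector_eval[OF fv p, of 1 c] t_ge_3
    by (auto simp: diff_diff_left)
  show ?thesis
  proof (intro equalityI subsetI)
    fix x assume x: "x \<in> vertex s v"
    obtain c where c: "x = orbit_comb s p t c" using dual_vector_expansion[OF s v p] by blast
    hence "c (t - 1) = 0" "c (t - 2) = 0" using x zero[of c] by (auto simp: vertex_def)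
    hence "x = orbit_comb s p (t - 2) c" by (simp add: c orbit_comb_def m)
    thus "x \<in> range (orbit_comb s p (t - 2))" by blast
  next
    fix x assume "x \<in> range (orbit_comb s p (t - 2))"
    then obtain c where c: "x = orbit_comb s p (t - 2) c" by auto
    define d where "d k = (if k < t - 2 then c k else 0)" for k
    have "x = orbit_comb s p t d" by (simp add: c orbit_comb_def m d_def)
    thus "x \<in> vertex s v" using zero[of d] q_gt_2 t_ge_3 by (auto simp: vertex_def d_def)
  qed
qed

text \<open>A description of the point spanned by \<open>p\<close> that involves no choice of
  \<open>p\<close> and depends only on the kernel of \<open>v\<close>; uniqueness of the generating
  point rests on it.\<close>

lemma dual_vector_span:
  assumes s: "coprime s t" and v: "admissible v" and p: "dual_vector s v p"
  shows "{x. \<forall>i<t - 1. v ((\<phi> ^^ (s * i)) x) = 0} = vec.span {p}"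
proof (intro equalityI subsetI)
  note fv = admissible_functional[OF v]
  fix x assume x: "x \<in> {x. \<forall>i<t - 1. v ((\<phi> ^^ (s * i)) x) = 0}"
  obtain c where c: "c ^ (q ^ (s * (t - 1))) = v ((\<phi> ^^ (s * (t - 1))) x)" using frob_surj by blast
  have "x - c *s p = 0"
  proof (rule admissible_zero[OF s v])
    fix i assume "i < t"
    hence "v ((\<phi> ^^ (s * i)) p) = of_bool (i = t - 1)" "i = t - 1 \<or> i < t - 1"
      using p by (auto simp: dual_vector_def)
    thus "v ((\<phi> ^^ (s * i)) (x - c *s p)) = 0"
      using x c by (auto simp: iter_diff iter_scale functional_diff[OF fv] functional_scale[OF fv])
  qed
  thus "x \<in> vec.span {p}" by (auto simp: vec.span_singleton)
next
  note fv = admissible_functional[OF v]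
  fix x assume "x \<in> vec.span {p}"
  then obtain c where "x = c *s p" by (auto simp: vec.span_singleton)
  thus "x \<in> {x. \<forall>i<t - 1. v ((\<phi> ^^ (s * i)) x) = 0}"
    using p by (auto simp: dual_vector_def iter_scale functional_scale[OF fv])
qed

lemma dual_vector_nonzero: "functional v \<Longrightarrow> dual_vector s v p \<Longrightarrow> p \<noteq> 0"
proof
  assume v: "functional v" and p: "dual_vector s v p" and "p = 0"
  have "v ((\<phi> ^^ (s * (t - 1))) p) = 1" using p t_ge_3 by (auto simp: dual_vector_def)
  thus False using v \<open>p = 0\<close> by (simp add: iter_0 functional_0)
qed

text \<open>The functional reads off the last coefficient with respect to \<open>p\<close> and its
  images. It is injective on \<open>W\<close> because the other coefficients are, up to Frobenius
  powers, values of \<open>v\<close> at images of the vector under powers of \<open>\<phi>\<close>,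
  which do not move vectors of \<open>W\<close>.\<close>

lemma functional_of_cyclic_vector:
  assumes gen: "\<And>x. \<exists>c. x = orbit_comb s p t c"
  shows "\<exists>v. admissible v \<and> dual_vector s v p"
proof -
  obtain e :: "'n \<Rightarrow> nat" where e: "bij_betw e UNIV {..<t}" by (rule index_bij)
  define C where "C (a::'a ^ 'n) = (\<Sum>j\<in>UNIV. a $ j *s (\<phi> ^^ (s * e j)) p)" for a
  have C: "orbit_comb s p t c = C (\<chi> j. c (e j))" for c
    unfolding orbit_comb_def C_def using sum.reindex_bij_betw[OF e, symmetric] by simp
  have "surj C" unfolding surj_def using gen C by metis
  \<comment> \<open>Spanning plus counting gives uniqueness of the coefficients, so no separate
    proof of independence is made.\<close>
  hence injC: "inj C" by (simp add: finite_UNIV_surj_inj)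
  have uniq: "c k = d k" if "orbit_comb s p t c = orbit_comb s p t d" "k < t" for c d k
  proof -
    have "(\<chi> j. c (e j)) = (\<chi> j. d (e j))" by (rule injD[OF injC]) (use that(1) in \<open>simp only: C\<close>)
    hence "c (e j) = d (e j)" for j by (simp add: vec_eq_iff)
    moreover obtain j where "e j = k" using e \<open>k < t\<close> by (metis bij_betw_def imageE lessThan_iff)
    ultimately show ?thesis by blast
  qed
  define coef where "coef x = (SOME c. x = orbit_comb s p t c)" for x
  have coef: "x = orbit_comb s p t (coef x)" for x
    unfolding coef_def by (rule someI_ex[OF gen])
  define v where "v x = coef x (t - 1)" for x
  have v_eq: "v (orbit_comb s p t c) = c (t - 1)" for c
    unfolding v_def by (rule uniq[OF coef[symmetric]]) (use t_ge_3 in auto)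
  have v: "functional v"
    unfolding functional_def
  proof (intro conjI allI)
    fix x y c
    have "x + y = orbit_comb s p t (\<lambda>k. coef x k + coef y k)"
      by (subst (1) coef[of x], subst (1) coef[of y])
        (simp add: orbit_comb_def sum.distrib vec.scale_left_distrib)
    thus "v (x + y) = v x + v y" by (simp only: v_eq) (simp add: v_def)
    have "c *s x = orbit_comb s p t (\<lambda>k. c * coef x k)"
      by (subst (1) coef[of x]) (simp add: orbit_comb_def vec.scale_sum_right)
    thus "v (c *s x) = c * v x" by (simp only: v_eq) (simp add: v_def)
  qed
  have dual: "dual_vector s v p"
    unfolding dual_vector_def
  proof (intro allI impI)
    fix i assume i: "i < t"
    have "(\<phi> ^^ (s * i)) p = orbit_comb s p t (\<lambda>k. of_bool (k = i))"
      using i by (simp add: orbit_comb_def of_bool_def if_distrib[where f = "\<lambda>c. c *s _"] cong: if_cong)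
    thus "v ((\<phi> ^^ (s * i)) p) = of_bool (i = t - 1)" by (simp add: v_eq of_bool_def)
  qed
  have "w = 0" if w: "w \<in> W" "v w = 0" for w
  proof -
    have "coef w k = 0" if "k < t" for k
    proof -
      have "coef w k ^ (q ^ (s * (t - 1 - k))) = v ((\<phi> ^^ (s * (t - 1 - k))) (orbit_comb s p t (coef w)))"
        using dual_vector_eval[OF v dual, of "t - 1 - k" "coef w"] that by simp
      also have "\<dots> = 0" using w by (simp flip: coef add: iter_W)
      finally show ?thesis by simp
    qed
    thus ?thesis by (subst coef) (simp add: orbit_comb_def)
  qed
  thus ?thesis using v dual by (auto simp: admissible_def)
qed

end

lemma functional_separation:
  fixes X :: "('a::field ^ 'n) set"
  assumes X: "vec.subspace X" and x0: "x0 \<notin> X"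
  shows "\<exists>u. functional u \<and> (\<forall>x\<in>X. u x = 0) \<and> u x0 = 1"
proof -
  interpret vp: vector_space_pair "(*s) :: 'a \<Rightarrow> 'a ^ 'n \<Rightarrow> 'a ^ 'n" "(*) :: 'a \<Rightarrow> 'a \<Rightarrow> 'a"
    by unfold_locales
  obtain B where B: "B \<subseteq> X" "vec.independent B" "X \<subseteq> vec.span B"
    using vec.basis_exists by metis
  have span: "vec.span B = X" using B X by (simp add: vec.span_subspace)
  have "vec.independent (insert x0 B)" using x0 B span by (intro vec.independent_insertI) auto
  then obtain g where g: "Vector_Spaces.linear (*s) (*) g"
      "\<forall>x\<in>insert x0 B. g x = (if x = x0 then 1 else 0)"
    using vp.linear_independent_extend[of "insert x0 B" "\<lambda>x. if x = x0 then 1 else 0"] by blast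
  interpret g: Vector_Spaces.linear "(*s)" "(*)" g by (fact g(1))
  have gB: "g x = 0" if "x \<in> B" for x using g(2) x0 B(1) that by auto
  have "g x = 0" if "x \<in> X" for x
    using g.eq_0_on_span[OF gB] that by (simp add: span)
  moreover have "functional g" by (simp add: functional_def g.add g.scale)
  ultimately show ?thesis using g(2) by auto
qed

lemma dim_kernel_functional:
  fixes u :: "'a::field ^ 'n \<Rightarrow> 'a"
  assumes u: "functional u" and x0: "u x0 \<noteq> 0"
  shows "vec.dim {x. u x = 0} + 1 = CARD('n)"
proof -
  let ?K = "{x. u x = 0}"
  have K: "vec.span ?K = ?K" using functional_kernel[OF u] by (simp add: vec.span_eq_iff)
  have "y \<in> vec.span (insert x0 ?K)" for y
    unfolding vec.span_breakdown_eq K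
    by (rule exI[of _ "u y / u x0"]) (use x0 in \<open>simp add: functional_diff[OF u] functional_scale[OF u]\<close>)
  hence "vec.span (insert x0 ?K) = vec.span UNIV" by auto
  hence "vec.dim (insert x0 ?K) = vec.dim (UNIV :: ('a ^ 'n) set)" by (rule vec.span_eq_dim)
  thus ?thesis using x0 by (simp add: vec.dim_insert K card_cart_basis)
qed

section \<open>Twisted functionals, uniqueness of presentations, and stability under powers of
  \<open>\<phi>\<close>\<close>

context subgeometry_frobenius
begin

text \<open>For \<open>s \<le> t\<close> the power \<open>q ^ (t - s)\<close> undoes the
  semilinearity of \<open>x \<mapsto> v (\<phi>\<^sup>s x)\<close>: the result is a linear
  functional with the same kernel.\<close>

definition twist :: "nat \<Rightarrow> ('a ^ 'n \<Rightarrow> 'a) \<Rightarrow> 'a ^ 'n \<Rightarrow> 'a"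
  where "twist s v x = v ((\<phi> ^^ s) x) ^ (q ^ (t - s))"

lemma frob_complement: "s \<le> t \<Longrightarrow> ((c::'a) ^ (q ^ s)) ^ (q ^ (t - s)) = c"
  "s \<le> t \<Longrightarrow> ((c::'a) ^ (q ^ (t - s))) ^ (q ^ s) = c"
  by (simp_all add: frob_add_exp frob_t)

lemma functional_twist: "s \<le> t \<Longrightarrow> functional v \<Longrightarrow> functional (twist s v)"
  unfolding functional_def[of "twist s v"] twist_def
  by (simp add: iter_add iter_scale functional_add functional_scale frob_iter_add
      power_mult_distrib frob_complement)

lemma twist_eq_0_iff: "twist s v x = 0 \<longleftrightarrow> v ((\<phi> ^^ s) x) = 0"
  using q_gt_2 by (auto simp: twist_def)

lemma vertex_twist: "vertex s v = {x. v x = 0 \<and> twist s v x = 0}"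
  by (simp add: vertex_def twist_eq_0_iff)

lemma twist_W: "s \<le> t \<Longrightarrow> w \<in> W \<Longrightarrow> v w = twist s v w ^ (q ^ s)"
  by (simp add: twist_def iter_W frob_complement)

lemma coprime_nonzero: "coprime s t \<Longrightarrow> s \<noteq> 0"
  using t_ge_3 by (cases "s = 0") auto

text \<open>Interpolate the constant value \<open>c\<close>: the vectors \<open>x\<close> and
  \<open>\<phi>\<^sup>s x\<close> then have the same coordinates, so \<open>x\<close> is fixed and
  lies in \<open>W\<close>.\<close>

lemma admissible_surj_W:
  assumes s: "coprime s t" and v: "admissible v"
  shows "\<exists>w\<in>W. v w = c"
proof -
  note fv = admissible_functional[OF v]
  obtain x where x: "\<And>i. i < t \<Longrightarrow> v ((\<phi> ^^ (s * i)) x) = c"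
    using admissible_interpolation[OF s v, of "\<lambda>_. c"] by blast
  have x': "v ((\<phi> ^^ (s * i)) x) = c" if "i \<le> t" for i
  proof (cases "i = t")
    case True
    have "v ((\<phi> ^^ (s * 0)) x) = c" using x[of 0] t_ge_3 by linarith
    thus ?thesis using iter_t_mult[of s x] by (simp add: True mult.commute)
  qed (use x that in auto)
  have "(\<phi> ^^ s) x - x = 0"
  proof (rule admissible_zero[OF s v])
    fix i assume "i < t"
    hence "v ((\<phi> ^^ (s * Suc i)) x) = c" "v ((\<phi> ^^ (s * i)) x) = c" by (intro x'; simp)+
    thus "v ((\<phi> ^^ (s * i)) ((\<phi> ^^ s) x - x)) = 0"
      by (simp add: iter_diff iter_iter functional_diff[OF fv] add.commute)
  qed
  hence "x \<in> W" by (intro iter_fixed_W[OF s]) simp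
  moreover have "v x = c" using x'[of 0] by simp
  ultimately show ?thesis by blast
qed

lemma twist_surj_W:
  assumes "coprime s t" "s \<le> t" "admissible v"
  shows "\<exists>w\<in>W. twist s v w = c"
  using admissible_surj_W[OF assms(1,3), of "c ^ (q ^ s)"] frob_inj twist_W[OF assms(2)] by metis

text \<open>Interpolation provides vectors \<open>y\<close> and \<open>z\<close> dual to
  \<open>v\<close> and \<open>twist s v\<close>; subtracting the matching combination moves any
  vector into the vertex.\<close>

lemma functional_vanishing_on_vertex:
  assumes s: "coprime s t" "s \<le> t" and v: "admissible v"
    and u: "functional u" "\<And>x. x \<in> vertex s v \<Longrightarrow> u x = 0"
  shows "\<exists>a b. \<forall>x. u x = a * v x + b * twist s v x"
proof -
  note fv = admissible_functional[OF v] and ft = functional_twist[OF s(2) admissible_functional[OF v]]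
  have "\<exists>y. v y = a \<and> twist s v y = b ^ (q ^ (t - s))" for a b
  proof -
    obtain y where "\<And>i. i < t \<Longrightarrow> v ((\<phi> ^^ (s * i)) y) = (if i = 0 then a else b)"
      using admissible_interpolation[OF s(1) v, of "\<lambda>i. if i = 0 then a else b"] by blast
    from this[of 0] this[of 1] have "v y = a" "v ((\<phi> ^^ s) y) = b" using t_ge_3 by auto
    thus ?thesis by (auto simp: twist_def)
  qed
  from this[of 1 0] this[of 0 1] obtain y z
    where y: "v y = 1" "twist s v y = 0" and z: "v z = 0" "twist s v z = 1"
    using q_gt_2 by auto
  have "u x = u y * v x + u z * twist s v x" for x
  proof -
    have "u (x - v x *s y - twist s v x *s z) = 0"
      by (rule u(2)) (simp add: vertex_twist y z functional_diff[OF fv] functional_diff[OF ft]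
          functional_scale[OF fv] functional_scale[OF ft])
    hence "u x - v x * u y - twist s v x * u z = 0"
      by (simp only: functional_diff[OF u(1)] functional_scale[OF u(1)])
    thus ?thesis by (simp add: algebra_simps)
  qed
  thus ?thesis by blast
qed

text \<open>Comparing the two descriptions of the same vertex on \<open>W\<close> gives an identity between linearized
  polynomials with two terms on each side.\<close>

lemma vertex_unique:
  assumes s: "coprime s t" "s < t" and v: "admissible v"
    and s': "coprime s' t" "s' < t" and v': "admissible v'"
    and eq: "vertex s v = vertex s' v'"
  shows "s = s' \<and> {x. v x = 0} = {x. v' x = 0} \<and> {x. twist s v x = 0} = {x. twist s' v' x = 0} \<or>
    s \<noteq> s' \<and> {x. v x = 0} = {x. twist s' v' x = 0} \<and> {x. twist s v x = 0} = {x. v' x = 0}"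
proof -
  have st: "s \<le> t" "s' \<le> t" using s s' by auto
  note fv = admissible_functional[OF v] and fv' = admissible_functional[OF v']
  have van: "v' x = 0" "twist s' v' x = 0" if "x \<in> vertex s v" for x
  proof -
    have "x \<in> vertex s' v'" using that by (simp only: eq)
    thus "v' x = 0" "twist s' v' x = 0" by (auto simp: vertex_twist)
  qed
  obtain a b where ab: "\<And>x. v' x = a * v x + b * twist s v x"
    using functional_vanishing_on_vertex[OF s(1) st(1) v fv' van(1)] by blast
  obtain c d where cd: "\<And>x. twist s' v' x = c * v x + d * twist s v x"
    using functional_vanishing_on_vertex[OF s(1) st(1) v functional_twist[OF st(2) fv'] van(2)] by blast
  define C D where "C = c ^ (q ^ s')" and "D = d ^ (q ^ s')"
  let ?r = "(s + s') mod t"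
  \<comment> \<open>With \<open>x = twist s v w\<close> for \<open>w\<close> in \<open>W\<close>,
    the value \<open>v' w\<close> is both \<open>a * x ^ (q ^ s) + b * x\<close> and
    \<open>C * x ^ (q ^ ?r) + D * x ^ (q ^ s')\<close>; \<open>A\<close> holds the coefficients of
    the difference.\<close>
  define A where "A i = of_bool (i = s) * a + of_bool (i = 0) * b - of_bool (i = ?r) * C - of_bool (i = s') * D" for i
  have "(\<Sum>i<t. A i * x ^ (q ^ i)) = 0" for x
  proof -
    obtain w where w: "w \<in> W" "twist s v w = x" using twist_surj_W[OF s(1) st(1) v] by blast
    have "v' w = a * x ^ (q ^ s) + b * x" using ab[of w] twist_W[OF st(1) w(1), of v] w(2) by simp
    moreover have "v' w = (c * x ^ (q ^ s) + d * x) ^ (q ^ s')"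
      using twist_W[OF st(2) w(1), of v'] cd[of w] twist_W[OF st(1) w(1), of v] w(2) by simp
    hence "v' w = C * x ^ (q ^ ?r) + D * x ^ (q ^ s')"
      by (simp add: C_def D_def frob_iter_add power_mult_distrib frob_add_exp frob_mod)
    ultimately have *: "a * x ^ (q ^ s) + b * x - C * x ^ (q ^ ?r) - D * x ^ (q ^ s') = 0"
      by (simp add: diff_diff_eq)
    have pick: "(\<Sum>i<t. of_bool (i = j) * e * x ^ (q ^ i)) = e * x ^ (q ^ j)" if "j < t" for j e
    proof -
      have "(\<Sum>i<t. of_bool (i = j) * e * x ^ (q ^ i)) = (\<Sum>i<t. if i = j then e * x ^ (q ^ i) else 0)"
        by (intro sum.cong) auto
      thus ?thesis using that by simp
    qed
    have "(\<Sum>i<t. A i * x ^ (q ^ i)) =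
        (\<Sum>i<t. of_bool (i = s) * a * x ^ (q ^ i)) + (\<Sum>i<t. of_bool (i = 0) * b * x ^ (q ^ i))
        - (\<Sum>i<t. of_bool (i = ?r) * C * x ^ (q ^ i)) - (\<Sum>i<t. of_bool (i = s') * D * x ^ (q ^ i))"
      by (simp only: A_def left_diff_distrib distrib_right sum.distrib sum_subtractf)
    also have "\<dots> = a * x ^ (q ^ s) + b * x ^ (q ^ 0) - C * x ^ (q ^ ?r) - D * x ^ (q ^ s')"
      using t_ge_3 s(2) s'(2) by (subst (1 2 3 4) pick) auto
    finally show ?thesis using * by simp
  qed
  hence A: "A i = 0" if "i < t" for i using frob_independent[of A i] that by blast
  have nz: "s \<noteq> 0" "s' \<noteq> 0" using coprime_nonzero s s' by auto
  have r: "?r = (if s + s' < t then s + s' else s + s' - t)"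
    using s s' by (simp add: mod_if)
  have r_ne: "?r \<noteq> s" "?r \<noteq> s'" "?r < t" using r nz s s' t_ge_3 by auto
  have ne: "\<exists>x. v x \<noteq> 0" "\<exists>x. v' x \<noteq> 0" "\<exists>x. twist s v x \<noteq> 0" "\<exists>x. twist s' v' x \<noteq> 0"
    using admissible_surj_W[OF s(1) v, of 1] admissible_surj_W[OF s'(1) v', of 1]
      twist_surj_W[OF s(1) st(1) v, of 1] twist_surj_W[OF s'(1) st(2) v', of 1] by (metis zero_neq_one)+
  show ?thesis
  \<comment> \<open>An exponent that occurs once has coefficient 0. For \<open>s = s'\<close> these
    are 0 and \<open>?r\<close>, so \<open>b\<close> and \<open>C\<close> vanish; otherwise they are
    \<open>s\<close> and \<open>s'\<close>, so \<open>a\<close> and \<open>D\<close> vanish.\<close>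
  proof (cases "s = s'")
    case True
    have "?r \<noteq> 0"
    proof
      assume "?r = 0"
      hence "t dvd s * 2" using True by (simp add: mult_2_right mod_eq_0_iff_dvd)
      hence "t dvd 2" using s(1) by (simp add: coprime_commute coprime_dvd_mult_right_iff)
      thus False using t_ge_3 by (auto dest: dvd_imp_le)
    qed
    hence "b = 0" "C = 0" using A[of 0] A[of ?r] r_ne nz True t_ge_3 by (auto simp: A_def)
    hence "\<And>x. v' x = a * v x" "\<And>x. twist s' v' x = d * twist s v x"
      using ab cd by (auto simp: C_def)
    moreover from this have "a \<noteq> 0" "d \<noteq> 0" using ne by auto
    ultimately show ?thesis using True by auto
  next
    case False
    hence "a = 0" "D = 0" using A[of s] A[of s'] r_ne nz s(2) s'(2) by (auto simp: A_def)
    hence "\<And>x. v' x = b * twist s v x" "\<And>x. twist s' v' x = c * v x"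
      using ab cd by (auto simp: D_def)
    moreover from this have "b \<noteq> 0" "c \<noteq> 0" using ne by auto
    ultimately show ?thesis using False by auto
  qed
qed

lemma subspace_iter_image: "vec.subspace U \<Longrightarrow> vec.subspace ((\<phi> ^^ i) ` U)"
proof (rule vec.subspaceI)
  assume U: "vec.subspace U"
  show "0 \<in> (\<phi> ^^ i) ` U" using vec.subspace_0[OF U] iter_0[of i] by (metis imageI)
  show "x + y \<in> (\<phi> ^^ i) ` U" if "x \<in> (\<phi> ^^ i) ` U" "y \<in> (\<phi> ^^ i) ` U" for x y
    using that vec.subspace_add[OF U] iter_add by (auto simp: image_iff) metis
  show "c *s x \<in> (\<phi> ^^ i) ` U" if "x \<in> (\<phi> ^^ i) ` U" for c x
  proof -
    obtain y where y: "y \<in> U" "x = (\<phi> ^^ i) y" using \<open>x \<in> (\<phi> ^^ i) ` U\<close> by auto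
    obtain d where "d ^ (q ^ i) = c" using frob_surj by blast
    hence "c *s x = (\<phi> ^^ i) (d *s y)" by (simp add: iter_scale y)
    thus ?thesis using vec.subspace_scale[OF U y(1)] by blast
  qed
qed

lemma dim_iter_image_le:
  assumes "vec.subspace U"
  shows "vec.dim ((\<phi> ^^ i) ` U) \<le> vec.dim U"
proof -
  obtain B where B: "B \<subseteq> U" "vec.independent B" "U \<subseteq> vec.span B" "card B = vec.dim U"
    using vec.basis_exists by metis
  have fin: "finite B" by simp
  have "(\<phi> ^^ i) y \<in> vec.span ((\<phi> ^^ i) ` B)" if "y \<in> vec.span B" for y
    using that
  proof (induction rule: vec.span_induct_alt)
    case (step c x y)
    thus ?case by (simp add: iter_add iter_scale vec.span_add vec.span_scale vec.span_base)
  qed (simp add: iter_0 vec.span_zero)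
  hence "vec.dim ((\<phi> ^^ i) ` U) \<le> card ((\<phi> ^^ i) ` B)"
    using B(3) fin by (intro vec.dim_le_card) auto
  also have "\<dots> \<le> card B" by (rule card_image_le[OF fin])
  finally show ?thesis by (simp add: B(4))
qed

text \<open>The inverse of a power of \<open>\<phi>\<close> is again such a power, so the inequality
  works in both directions.\<close>

lemma dim_iter_image:
  assumes U: "vec.subspace U"
  shows "vec.dim ((\<phi> ^^ i) ` U) = vec.dim U"
proof (rule antisym[OF dim_iter_image_le[OF U]])
  obtain j where j: "\<forall>x. (\<phi> ^^ j) ((\<phi> ^^ i) x) = x" using iter_inverse by blast
  hence "U = (\<phi> ^^ j) ` ((\<phi> ^^ i) ` U)" by (simp add: image_image)
  thus "vec.dim U \<le> vec.dim ((\<phi> ^^ i) ` U)"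
    using dim_iter_image_le[OF subspace_iter_image[OF U, of i], of j] by simp
qed

lemma subspace_vertex: "functional v \<Longrightarrow> vec.subspace (vertex s v)"
  unfolding vertex_def Collect_conj_eq
  by (intro vec.subspace_inter functional_kernel functional_iter_kernel)

lemma vertex_Int_W: "admissible v \<Longrightarrow> vertex s v \<inter> W \<subseteq> {0}"
  by (auto simp: vertex_def admissible_def)

text \<open>The vertex and its image both lie in the hyperplane \<open>v x = 0\<close>, so the
  dimension formula gives at least \<open>t - 3\<close>. A larger intersection would make the vertex
  stable, and descent would make it zero.\<close>

lemma dim_vertex_Int:
  assumes s: "coprime s t" and v: "admissible v" and dim: "vec.dim (vertex s v) = t - 2"
  shows "vec.dim (vertex s v \<inter> (\<phi> ^^ s) ` vertex s v) = t - 3"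
proof -
  let ?U = "vertex s v" and ?fU = "(\<phi> ^^ s) ` vertex s v"
  note fv = admissible_functional[OF v]
  have U: "vec.subspace ?U" by (rule subspace_vertex[OF fv])
  have fU: "vec.subspace ?fU" by (rule subspace_iter_image[OF U])
  have dfU: "vec.dim ?fU = t - 2" using dim_iter_image[OF U] dim by simp
  let ?S = "{x + y |x y. x \<in> ?U \<and> y \<in> ?fU}"
  have "?S \<subseteq> {x. v x = 0}" by (auto simp: functional_add[OF fv] vertex_def)
  hence "vec.dim ?S \<le> vec.dim {x. v x = 0}" by (rule vec.dim_subset)
  moreover have "vec.dim {x. v x = 0} + 1 = t"
    using dim_kernel_functional[OF fv] admissible_surj_W[OF s v, of 1] card_n by (metis zero_neq_one)
  moreover have "vec.dim ?S + vec.dim (?U \<inter> ?fU) = 2 * (t - 2)"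
    using vec.dim_sums_Int[OF U fU] dim dfU by simp
  ultimately have ge: "vec.dim (?U \<inter> ?fU) \<ge> t - 3" by linarith
  have "vec.dim (?U \<inter> ?fU) \<noteq> t - 2"
  proof
    assume eq: "vec.dim (?U \<inter> ?fU) = t - 2"
    have sub: "vec.subspace (?U \<inter> ?fU)" using U fU by (rule vec.subspace_inter)
    have "?U \<inter> ?fU = ?fU" using vec.subspace_dim_equal[OF sub fU] eq dfU by simp
    hence "(\<phi> ^^ s) x \<in> ?U" if "x \<in> ?U" for x using that by blast
    hence "?U \<subseteq> {0}" using stable_subspace_fixed_vector[OF s U] vertex_Int_W[OF v] by blast
    hence "vec.dim ?U = 0" by simp
    thus False using dim t_ge_3 by simp
  qed
  moreover have "vec.dim (?U \<inter> ?fU) \<le> t - 2"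
    using vec.dim_subset[of "?U \<inter> ?fU" ?U] dim by simp
  ultimately show ?thesis using ge by linarith
qed

text \<open>Since \<open>t \<ge> 3\<close>, a dual vector lies in the vertex, and its images under
  powers of \<open>\<phi> ^^ s\<close> span the space.\<close>

lemma stable_subspace_containing_vertex:
  assumes s: "coprime s t" and v: "admissible v"
    and X: "vec.subspace X" "\<And>x. x \<in> X \<Longrightarrow> (\<phi> ^^ s) x \<in> X" "vertex s v \<subseteq> X"
  shows "X = UNIV"
proof -
  obtain p where p: "dual_vector s v p" using dual_vector_exists[OF s v] by blast
  have "v ((\<phi> ^^ (s * i)) p) = 0" if "i < t - 1" for i
    using p that unfolding dual_vector_def by auto
  from this[of 0] this[of 1] have "p \<in> X" using X(3) t_ge_3 by (auto simp: vertex_def)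
  hence iterX: "(\<phi> ^^ (s * i)) p \<in> X" for i
    by (induction i) (auto simp: funpow_add X(2))
  have "x \<in> X" for x
  proof -
    obtain c where "x = orbit_comb s p t c" using dual_vector_expansion[OF s v p] by blast
    thus ?thesis unfolding orbit_comb_def
      using iterX by (auto intro!: vec.subspace_sum[OF X(1)] vec.subspace_scale[OF X(1)])
  qed
  thus ?thesis by blast
qed

lemma frob_fixed_coprime:
  assumes "coprime s t" "(c::'a) ^ (q ^ s) = c"
  shows "c ^ q = c"
proof -
  obtain k where k: "(s * k) mod t = 1" using coprime_inverse_mod[OF assms(1)] .
  have "c ^ (q ^ (s * k)) = c" for k
    using assms(2) by (induction k) (auto simp flip: frob_add_exp)
  hence "c ^ (q ^ (s * k mod t)) = c" by (simp add: frob_mod)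
  thus ?thesis by (simp add: k)
qed

text \<open>A functional \<open>u\<close> vanishing on \<open>U\<close> and its image satisfies
  \<open>U \<subseteq> vertex s u\<close>, and dimensions force equality unless the kernel of
  \<open>u\<close> is stable under \<open>\<phi> ^^ s\<close>. In that case a multiple of
  \<open>u\<close> takes values in the small subfield on \<open>W\<close>, that is, it defines a
  hyperplane of the subgeometry, and \<open>hyp\<close> applies. The conditions on subfield values
  in \<open>hyp\<close> express hyperplanes without mentioning the small field.\<close>

lemma vertex_of_intersection:
  assumes s: "coprime s t"
    and U: "vec.subspace U" "vec.dim U = t - 2" "U \<inter> W \<subseteq> {0}"
    and dim: "vec.dim (U \<inter> (\<phi> ^^ s) ` U) = t - 3"
    and hyp: "\<And>u. functional u \<Longrightarrow> \<forall>x\<in>U. u x = 0 \<Longrightarrow> \<forall>w\<in>W. u w ^ q = u w \<Longrightarrow> \<forall>w\<in>W. u w = 0"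
  shows "\<exists>v. admissible v \<and> vertex s v = U"
proof -
  let ?fU = "(\<phi> ^^ s) ` U"
  have fU: "vec.subspace ?fU" by (rule subspace_iter_image[OF U(1)])
  define S where "S = {x + y |x y. x \<in> U \<and> y \<in> ?fU}"
  have S: "vec.subspace S" unfolding S_def by (rule vec.subspace_sums[OF U(1) fU])
  have "vec.dim S + (t - 3) = 2 * (t - 2)"
    using vec.dim_sums_Int[OF U(1) fU] dim_iter_image[OF U(1)] U(2) dim by (simp add: S_def)
  hence "vec.dim S < t" using t_ge_3 by linarith
  hence "S \<noteq> UNIV" using vec_dim_card[where 'a='a and 'n='n] card_n by (metis less_irrefl)
  then obtain x0 where "x0 \<notin> S" by blast
  then obtain u where u: "functional u" "\<And>x. x \<in> S \<Longrightarrow> u x = 0" "u x0 = 1"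
    using functional_separation[OF S \<open>x0 \<notin> S\<close>] by blast
  have "U \<subseteq> S" "?fU \<subseteq> S"
    using vec.subspace_0[OF U(1)] vec.subspace_0[OF fU] by (force simp: S_def)+
  hence uU: "u x = 0" "u ((\<phi> ^^ s) x) = 0" if "x \<in> U" for x using u(2) that by blast+
  let ?H = "{x. u x = 0}"
  have dimH: "vec.dim ?H + 1 = t" using dim_kernel_functional[OF u(1), of x0] u(3) card_n by simp
  have V: "vec.subspace (vertex s u)" by (rule subspace_vertex[OF u(1)])
  have "\<not> ?H \<subseteq> vertex s u"
  proof
    assume H: "?H \<subseteq> vertex s u"
    have "\<exists>w\<in>W. u w \<noteq> 0"
    proof (rule ccontr)
      assume "\<not> ?thesis"
      hence uW: "u w = 0" if "w \<in> W" for w using that by blast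
      have zero: "functional (\<lambda>_ :: 'a ^ 'n. 0 :: 'a)" by (simp add: functional_def)
      have "u x0 = 0"
        by (rule functional_eq_on_span[OF u(1) zero uW, where x = x0]) (auto simp: span_W)
      thus False using u(3) by simp
    qed
    then obtain w0 where w0: "w0 \<in> W" "u w0 \<noteq> 0" by blast
    \<comment> \<open>Normalizing at a vector of \<open>W\<close> is what brings the values on
      \<open>W\<close> into the subfield.\<close>
    define u' where "u' x = u x / u w0" for x
    have fu': "functional u'"
      using u(1) by (auto simp: functional_def u'_def add_divide_distrib)
    have "u' w ^ q = u' w" if w: "w \<in> W" for w
    proof (rule frob_fixed_coprime[OF s])
      \<comment> \<open>This vector lies in the stable kernel. Its image under
        \<open>\<phi> ^^ s\<close> is \<open>w\<close> minus the Frobenius power of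
        \<open>u' w\<close> times \<open>w0\<close>, so \<open>u' w\<close> is fixed by that
        power.\<close>
      have "u (w - u' w *s w0) = 0"
        using w0 by (simp add: functional_diff[OF u(1)] functional_scale[OF u(1)] u'_def)
      hence "u ((\<phi> ^^ s) (w - u' w *s w0)) = 0" using H by (auto simp: vertex_def)
      hence "u w = u' w ^ (q ^ s) * u w0"
        using w w0 by (simp add: iter_diff iter_scale iter_W functional_diff[OF u(1)] functional_scale[OF u(1)])
      thus "u' w ^ (q ^ s) = u' w"
        using w0(2) by (metis u'_def nonzero_mult_div_cancel_right)
    qed
    hence "u' w0 = 0" using hyp[OF fu'] uU w0(1) by (auto simp: u'_def)
    thus False using w0 by (simp add: u'_def)
  qed
  hence "vec.dim (vertex s u) < vec.dim ?H"
    using vec.dim_psubset[of "vertex s u" ?H] functional_kernel[OF u(1)] V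
    by (simp add: vec.span_eq_iff[THEN iffD2]) (auto simp: vertex_def)
  hence "vec.dim (vertex s u) \<le> vec.dim U" using dimH U(2) by linarith
  moreover have "U \<subseteq> vertex s u" using uU by (auto simp: vertex_def)
  ultimately have eq: "U = vertex s u" using vec.subspace_dim_equal[OF U(1) V] by blast
  \<comment> \<open>A vector of \<open>W\<close> is fixed by \<open>\<phi>\<close>, so one zero of
    \<open>u\<close> on \<open>W\<close> already lies in \<open>vertex s u = U\<close>.\<close>
  have "admissible u"
    unfolding admissible_def
  proof (intro conjI ballI impI)
    fix w assume "w \<in> W" "u w = 0"
    hence "w \<in> U \<inter> W" by (auto simp: eq vertex_def iter_W)
    thus "w = 0" using U(3) by blast
  qed (fact u(1))
  thus ?thesis using eq by blast
qed

text \<open>On \<open>W\<close> the quotient is \<open>frob_quot s\<close> of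
  \<open>twist s v w\<close>, and \<open>twist s v\<close> takes every value on \<open>W\<close>;
  coprimality then replaces \<open>s\<close> by 1.\<close>

lemma quotients_of_vertex:
  assumes s: "coprime s t" "s \<le> t" and v: "admissible v"
  shows "(\<lambda>w. v w / twist s v w) ` (W - {0}) = frob_quot 1 ` (- {0})"
    and "\<And>w. w \<in> W \<Longrightarrow> w \<noteq> 0 \<Longrightarrow> twist s v w \<noteq> 0"
proof -
  show nz: "twist s v w \<noteq> 0" if "w \<in> W" "w \<noteq> 0" for w
    using that v by (auto simp: twist_eq_0_iff iter_W admissible_def)
  have quot: "v w / twist s v w = frob_quot s (twist s v w)" if "w \<in> W" for w
    using twist_W[OF s(2) that, of v] by (simp add: frob_quot_def)
  have "(\<lambda>w. v w / twist s v w) ` (W - {0}) = frob_quot s ` (- {0})"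
  proof (intro equalityI subsetI)
    fix y assume "y \<in> frob_quot s ` (- {0})"
    then obtain c where c: "c \<noteq> 0" "y = frob_quot s c" by auto
    obtain w where w: "w \<in> W" "twist s v w = c" using twist_surj_W[OF s v] by blast
    have "w \<noteq> 0"
      using w(2) c(1) functional_0[OF functional_twist[OF s(2) admissible_functional[OF v]]] by auto
    thus "y \<in> (\<lambda>w. v w / twist s v w) ` (W - {0})" using w c quot by force
  qed (use quot nz in auto)
  thus "(\<lambda>w. v w / twist s v w) ` (W - {0}) = frob_quot 1 ` (- {0})"
    using frob_quot_coprime[OF s(1)] by simp
qed

text \<open>By counting, \<open>g1\<close> maps \<open>W\<close> bijectively onto the field, so
  \<open>g2\<close> is an additive function \<open>h\<close> of \<open>g1\<close> on
  \<open>W\<close>. The quotients have norm 1, so \<open>h\<close> preserves the norm and equals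
  \<open>a * x ^ (q ^ s)\<close>. Thus \<open>v = g2 / a\<close> agrees on \<open>W\<close> with the
  power \<open>q ^ s\<close> of \<open>g1\<close>.\<close>

lemma vertex_of_quotients:
  assumes g1: "functional g1" and g2: "functional g2"
    and nz: "\<And>w. w \<in> W \<Longrightarrow> w \<noteq> 0 \<Longrightarrow> g1 w \<noteq> 0"
    and quot: "(\<lambda>w. g2 w / g1 w) ` (W - {0}) = frob_quot 1 ` (- {0})"
  shows "\<exists>s v. s < t \<and> coprime s t \<and> admissible v \<and>
    {x. v x = 0} = {x. g2 x = 0} \<and> {x. twist s v x = 0} = {x. g1 x = 0}"
proof -
  have W_add: "w + w' \<in> W" "w - w' \<in> W" if "w \<in> W" "w' \<in> W" for w w'
    using that iter_add[of 1 w w'] iter_diff[of 1 w w'] by (auto simp: W_eq One_nat_def)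
  have "inj_on g1 W"
  proof (rule inj_onI)
    fix w w' assume "w \<in> W" "w' \<in> W" "g1 w = g1 w'"
    thus "w = w'" using nz[of "w - w'"] W_add by (auto simp: functional_diff[OF g1])
  qed
  moreover from this have img: "g1 ` W = UNIV"
    using card_W by (intro card_subset_eq) (auto simp: card_image card_field)
  ultimately have bij: "bij_betw g1 W UNIV" by (simp add: bij_betw_def)
  define h where "h x = g2 (inv_into W g1 x)" for x
  have h: "h (g1 w) = g2 w" if "w \<in> W" for w
    using bij_betw_inv_into_left[OF bij that] by (simp add: h_def)
  have "h (x + y) = h x + h y" for x y
  proof -
    obtain w w' where "w \<in> W" "x = g1 w" "w' \<in> W" "y = g1 w'" using img by (metis UNIV_I imageE)
    thus ?thesis using h W_add(1) by (simp add: functional_add[OF g2] flip: functional_add[OF g1])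
  qed
  moreover have "nrm (h x) = nrm x" for x
  proof -
    obtain w where w: "w \<in> W" "x = g1 w" using img by (metis UNIV_I imageE)
    show ?thesis
    proof (cases "w = 0")
      case True
      hence "h (g1 0) = g2 0" using w h by blast
      thus ?thesis using True w by (simp add: functional_0[OF g1] functional_0[OF g2])
    next
      case False
      then obtain c where c: "c \<noteq> 0" "g2 w / g1 w = frob_quot 1 c" using quot w(1) by blast
      have "nrm (g2 w / g1 w) = 1" using nrm_quot[OF c(1)] by (simp add: c(2) frob_quot_def)
      moreover have "g2 w = g2 w / g1 w * g1 w" using nz[OF w(1) False] by simp
      ultimately show ?thesis using nrm_mult[of "g2 w / g1 w" "g1 w"] w h by simp
    qed
  qed
  ultimately obtain a s where s: "s < t" and as: "\<And>x. h x = a * x ^ (q ^ s)"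
    using norm_preserving_monomial[of h] by blast
  have g2W: "g2 w = a * g1 w ^ (q ^ s)" if "w \<in> W" for w using h[OF that] as by simp
  have W_nz: "g1 w = 0 \<longleftrightarrow> w = 0" if "w \<in> W" for w
    using nz[OF that] functional_0[OF g1] by auto
  obtain w1 where w1: "w1 \<in> W" "g1 w1 = 1" using img by (metis UNIV_I imageE)
  \<comment> \<open>Evaluating where \<open>g1\<close> is 1 shows that \<open>a\<close> itself has
    the form \<open>c0 ^ q / c0\<close>. This factor can be absorbed into \<open>c\<close>, which
    gives the inclusion from which coprimality of \<open>s\<close> follows.\<close>
  have "g2 w1 / g1 w1 \<in> frob_quot 1 ` (- {0})"
    unfolding quot[symmetric] using w1 W_nz[of w1] by (intro imageI) auto
  then obtain c0 where c0: "c0 \<noteq> 0" "a = frob_quot 1 c0" using w1 g2W by auto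
  have a: "a \<noteq> 0" using c0 q_gt_2 by (auto simp: frob_quot_def)
  have "frob_quot 1 ` (- {0}) \<subseteq> frob_quot s ` (- {0})"
  proof
    fix y assume "y \<in> frob_quot 1 ` (- {0})"
    then obtain c where c: "c \<noteq> 0" "y = frob_quot 1 c" by auto
    have "frob_quot 1 (c0 * c) \<in> (\<lambda>w. g2 w / g1 w) ` (W - {0})"
      unfolding quot using c0 c by (intro imageI) auto
    then obtain w where w: "w \<in> W" "w \<noteq> 0" "frob_quot 1 (c0 * c) = g2 w / g1 w" by auto
    have "a * y = a * frob_quot s (g1 w)"
      using w g2W[OF w(1)] by (simp add: c0(2) c(2) frob_quot_def power_mult_distrib)
    hence "y = frob_quot s (g1 w)" using a by simp
    thus "y \<in> frob_quot s ` (- {0})" using nz w by auto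
  qed
  hence cop: "coprime s t" by (rule coprime_of_frob_quot)
  define v where "v x = g2 x / a" for x
  have fv: "functional v" using g2 by (auto simp: functional_def v_def add_divide_distrib)
  have vW: "v w = g1 w ^ (q ^ s)" if "w \<in> W" for w using g2W[OF that] a by (simp add: v_def)
  have "admissible v"
    unfolding admissible_def using fv by (auto simp: vW W_nz)
  \<comment> \<open>Both sides are linear functionals, so it is enough to compare them on
    \<open>W\<close>, which spans.\<close>
  moreover have "twist s v x = g1 x" for x
  proof (rule functional_eq_on_span[OF functional_twist[OF _ fv] g1])
    show "twist s v w = g1 w" if "w \<in> W" for w
      using that s by (simp add: twist_def iter_W vW frob_complement)
  qed (use s span_W in auto)
  moreover have "{x. v x = 0} = {x. g2 x = 0}" using a by (auto simp: v_def)
  ultimately show ?thesis using s cop by (intro exI[of _ s] exI[of _ v]) auto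
qed

end

section \<open>Points and projective subspaces\<close>

lemma points_in_Int: "points_in s (U \<inter> V) = points_in s U \<inter> points_in s V"
  by (auto simp: points_in_def)

context vector_space
begin

lemma pg_points_iff: "P \<in> pg_points scale \<longleftrightarrow> (\<exists>x. x \<noteq> 0 \<and> P = span {x})"
proof
  assume "P \<in> pg_points scale"
  hence P: "subspace P" "dim P = 1" by (auto simp: pg_points_def)
  obtain B where B: "B \<subseteq> P" "independent B" "P \<subseteq> span B" "card B = dim P"
    using basis_exists by metis
  then obtain x where "B = {x}" using P(2) by (metis card_1_singletonE)
  thus "\<exists>x. x \<noteq> 0 \<and> P = span {x}"
    using B P(1) span_subspace[of B P] by (intro exI[of _ x]) auto
next
  assume "\<exists>x. x \<noteq> 0 \<and> P = span {x}"
  then obtain x where x: "x \<noteq> 0" "P = span {x}" by blast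
  thus "P \<in> pg_points scale"
    using dim_span_eq_card_independent[of "{x}"] by (simp add: pg_points_def)
qed

lemma point_of_in_pg_points: "x \<noteq> 0 \<Longrightarrow> span {x} \<in> pg_points scale"
  by (auto simp: pg_points_iff)

lemma span_singleton_subset: "subspace U \<Longrightarrow> span {x} \<subseteq> U \<longleftrightarrow> x \<in> U"
  using span_minimal[of "{x}" U] span_base[of x "{x}"] by auto

lemma span_singleton_eq: "y \<in> span {x} \<Longrightarrow> y \<noteq> 0 \<Longrightarrow> span {y} = span {x}"
proof -
  assume "y \<in> span {x}" "y \<noteq> 0"
  then obtain c where c: "y = scale c x" "c \<noteq> 0" by (auto simp: span_singleton)
  hence "x = scale (inverse c) y" by simp
  hence "x \<in> span {y}" by (auto simp: span_singleton)
  thus ?thesis using \<open>y \<in> span {x}\<close> by (simp add: span_eq)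
qed

lemma span_singleton_scale: "c \<noteq> 0 \<Longrightarrow> span {scale c x} = span {x}"
proof (cases "x = 0")
  case False
  assume "c \<noteq> 0"
  thus ?thesis using False by (intro span_singleton_eq) (simp_all add: span_base span_scale)
qed simp

lemma points_in_iff:
  "subspace U \<Longrightarrow> P \<in> points_in scale U \<longleftrightarrow> (\<exists>x\<in>U. x \<noteq> 0 \<and> P = span {x})"
  unfolding points_in_def pg_points_iff mem_Collect_eq using span_singleton_subset by blast

text \<open>The zero subspace has no points, so the union loses even the zero vector; the dimension
  is 0 in both cases and \<open>pdim\<close> is not affected.\<close>

lemma Union_points_in: "subspace U \<Longrightarrow> \<Union>(points_in scale U) = (if U = {0} then {} else U)"
proof -
  assume U: "subspace U"
  show ?thesis
  proof (cases "U = {0}")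
    case False
    then obtain y where y: "y \<in> U" "y \<noteq> 0" using subspace_0[OF U] by auto
    have "x \<in> \<Union>(points_in scale U)" if "x \<in> U" for x
    proof (cases "x = 0")
      case True
      have "span {y} \<in> points_in scale U" using y points_in_iff[OF U] by blast
      thus ?thesis using True span_zero by blast
    next
      case False
      hence "span {x} \<in> points_in scale U" using that points_in_iff[OF U] by blast
      thus ?thesis using span_base[of x "{x}"] by blast
    qed
    moreover have "\<Union>(points_in scale U) \<subseteq> U" by (auto simp: points_in_def)
    ultimately show ?thesis using False by auto
  next
    case True
    hence "points_in scale U = {}" using points_in_iff[OF U] by blast
    thus ?thesis using True by simp
  qed
qed

lemma pdim_points_in: "subspace U \<Longrightarrow> pdim scale (points_in scale U) = int (dim U) - 1"
  using span_eq_dim[of "{}" "{0}"] by (simp add: pdim_def Union_points_in)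

lemma points_in_subset_iff:
  "subspace U \<Longrightarrow> subspace V \<Longrightarrow> points_in scale U \<subseteq> points_in scale V \<longleftrightarrow> U \<subseteq> V"
proof
  assume U: "subspace U" and V: "subspace V" and sub: "points_in scale U \<subseteq> points_in scale V"
  show "U \<subseteq> V"
  proof
    fix x assume x: "x \<in> U"
    show "x \<in> V"
    proof (cases "x = 0")
      case False
      hence "span {x} \<in> points_in scale U" using x points_in_iff[OF U] by blast
      hence "span {x} \<in> points_in scale V" using sub by blast
      thus ?thesis using V by (auto simp: points_in_def span_singleton_subset)
    qed (simp add: subspace_0[OF V])
  qed
qed (auto simp: points_in_def)

lemma points_in_eq_iff:
  "subspace U \<Longrightarrow> subspace V \<Longrightarrow> points_in scale U = points_in scale V \<longleftrightarrow> U = V"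
  using points_in_subset_iff[of U V] points_in_subset_iff[of V U] by auto

lemma points_in_UNIV: "points_in scale UNIV = pg_points scale"
  by (simp add: points_in_def)

lemma points_in_span_singleton:
  assumes "x \<noteq> 0"
  shows "points_in scale (span {x}) = {span {x}}"
proof (intro equalityI subsetI)
  fix P assume "P \<in> points_in scale (span {x})"
  then obtain y where "y \<in> span {x}" "y \<noteq> 0" "P = span {y}" using points_in_iff[OF subspace_span] by blast
  thus "P \<in> {span {x}}" using span_singleton_eq by simp
qed (use assms in \<open>auto simp: points_in_def point_of_in_pg_points\<close>)

lemma pspan_insert_points_in:
  assumes U: "subspace U" and x: "x \<noteq> 0"
  shows "pspan scale (insert (span {x}) (points_in scale U)) = points_in scale (span (insert x U))"
proof -
  have "span (\<Union>(insert (span {x}) (points_in scale U))) = span (insert x U)"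
    unfolding span_eq
  proof (intro conjI subsetI)
    fix y assume "y \<in> \<Union>(insert (span {x}) (points_in scale U))"
    hence "y \<in> span {x} \<or> y \<in> U" by (auto simp: points_in_def)
    thus "y \<in> span (insert x U)"
      using span_mono[of "{x}" "insert x U"] span_base[of y "insert x U"] by auto
  next
    fix y assume "y \<in> insert x U"
    moreover have "U \<subseteq> insert 0 (\<Union>(points_in scale U))" by (auto simp: Union_points_in[OF U])
    ultimately consider "y = 0" | "y \<in> span {x}" | "y \<in> \<Union>(points_in scale U)"
      using span_base[of x "{x}"] by blast
    thus "y \<in> span (\<Union>(insert (span {x}) (points_in scale U)))"
      by cases (auto intro: span_base span_zero)
  qed
  thus ?thesis by (simp add: pspan_def)
qed

end

section \<open>The stabilizer of a canonical subgeometry\<close>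

text \<open>A basis of \<open>W\<close> over the small field is also a basis of the whole space over
  the large field, and \<open>\<phi>\<close> raises the coordinates in this basis to the power
  \<open>q\<close>.\<close>

lemma (in finite_extension) subgeometry_frobenius_exists:
  fixes emb :: "'k::{field,finite} \<Rightarrow> 'a" and W :: "('a ^ 'n) set"
  assumes emb: "field_embedding emb" and q: "CARD('k) = q" and n: "CARD('n) = t"
    and sub: "subgeometry_of emb W \<Sigma>"
  shows "\<exists>\<phi>. subgeometry_frobenius q t \<phi> W"
proof -
  interpret sub: vector_space "sub_scale emb :: 'k \<Rightarrow> 'a ^ 'n \<Rightarrow> 'a ^ 'n"
    using emb by (rule vector_space_sub_scale)
  have W: "sub.subspace W" "sub.dim W = t" and \<Sigma>: "\<Sigma> = point_of ` (W - {0})"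
    and span: "pspan (*s) \<Sigma> = pg_points (*s)"
    using sub n by (auto simp: subgeometry_of_def)
  have "\<Union>\<Sigma> \<subseteq> vec.span W"
    unfolding \<Sigma> by (auto intro!: subsetD[OF vec.span_mono[of "{_}" W]])
  hence sW: "vec.span (\<Union>\<Sigma>) \<subseteq> vec.span W" by (rule vec.span_minimal) simp
  have spanW: "vec.span W = UNIV"
  proof -
    have "x \<in> vec.span W" for x
    proof (cases "x = 0")
      case False
      hence "vec.span {x} \<in> pspan (*s) \<Sigma>" by (simp add: span vec.point_of_in_pg_points)
      hence "vec.span {x} \<subseteq> vec.span W" using sW by (auto simp: pspan_def points_in_def)
      thus ?thesis by (simp add: vec.span_singleton_subset)
    qed (simp add: vec.span_zero)
    thus ?thesis by blast
  qed
  obtain B where B: "B \<subseteq> W" "sub.independent B" "W \<subseteq> sub.span B" "card B = t"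
    using sub.basis_exists[of W] W(2) by metis
  have finB: "finite B" by simp
  have WB: "W = sub.span B" using B W(1) by (metis sub.span_subspace)
  have "sub.subspace (vec.span B)"
    by (auto simp: sub.subspace_def sub_scale_def vec.span_zero vec.span_add vec.span_scale)
  hence "sub.span B \<subseteq> vec.span B" by (intro sub.span_minimal vec.span_superset)
  hence "vec.span W \<subseteq> vec.span B" using B(3) by (intro vec.span_minimal) auto
  hence spanB: "vec.span B = UNIV" using spanW by auto
  obtain b :: "'n \<Rightarrow> 'a ^ 'n" where b: "bij_betw b UNIV B"
    using finite_same_card_bij[of "UNIV :: 'n set" B] finB B(4) n by auto
  define M where "M a = (\<Sum>j\<in>UNIV. a $ j *s b j)" for a :: "'a ^ 'n"
  have M_add: "M (a + c) = M a + M c" for a c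
    by (simp add: M_def vec.scale_left_distrib sum.distrib)
  have M_scale: "M (k *s a) = k *s M a" for k a
    by (simp add: M_def vec.scale_sum_right)
  have "surj M"
  proof -
    have "x \<in> range M" for x
    proof -
      have "x \<in> range (\<lambda>u. \<Sum>v\<in>B. u v *s v)" using spanB vec.span_finite[OF finB] by auto
      then obtain u where "x = (\<Sum>v\<in>B. u v *s v)" by auto
      also have "\<dots> = M (\<chi> j. u (b j))"
        unfolding M_def using sum.reindex_bij_betw[OF b, of "\<lambda>v. u v *s v"] by simp
      finally show ?thesis by blast
    qed
    thus ?thesis by blast
  qed
  \<comment> \<open>Independence over the large field comes from counting: \<open>M\<close> is a
    surjection of a finite space onto itself.\<close>
  hence injM: "inj M" by (simp add: finite_UNIV_surj_inj)
  define \<phi> where "\<phi> x = M (\<chi> j. inv_into UNIV M x $ j ^ q)" for x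
  have \<phi>M: "\<phi> (M a) = M (\<chi> j. a $ j ^ q)" for a by (simp add: \<phi>_def inv_f_f[OF injM])
  have ex: "\<exists>a. x = M a" for x using \<open>surj M\<close> by (metis surjD)
  have WM: "W = range (\<lambda>k :: 'k ^ 'n. M (\<chi> j. emb (k $ j)))"
  proof (intro equalityI subsetI)
    fix w assume "w \<in> W"
    hence "w \<in> range (\<lambda>u. \<Sum>v\<in>B. sub_scale emb (u v) v)" using WB sub.span_finite[OF finB] by auto
    then obtain u where "w = (\<Sum>v\<in>B. sub_scale emb (u v) v)" by auto
    also have "\<dots> = M (\<chi> j. emb ((\<chi> j. u (b j)) $ j))"
      unfolding M_def sub_scale_def
      using sum.reindex_bij_betw[OF b, of "\<lambda>v. emb (u v) *s v"] by simp
    finally show "w \<in> range (\<lambda>k :: 'k ^ 'n. M (\<chi> j. emb (k $ j)))" by blast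
  next
    fix w assume "w \<in> range (\<lambda>k :: 'k ^ 'n. M (\<chi> j. emb (k $ j)))"
    then obtain k :: "'k ^ 'n" where "w = (\<Sum>j\<in>UNIV. sub_scale emb (k $ j) (b j))"
      by (auto simp: M_def sub_scale_def)
    moreover have "b j \<in> W" for j using b B(1) by (auto simp: bij_betw_def)
    ultimately show "w \<in> W" by (simp add: sub.subspace_sum[OF W(1)] sub.subspace_scale[OF W(1)])
  qed
  have range: "range emb = {c. c ^ q = c}" using range_embedding_eq[OF emb] q by simp
  have "subgeometry_frobenius q t \<phi> W"
  proof unfold_locales
    show "\<phi> (x + y) = \<phi> x + \<phi> y" for x y
    proof -
      obtain a c where "x = M a" "y = M c" using ex by metis
      moreover have "(\<chi> j. (a + c) $ j ^ q) = (\<chi> j. a $ j ^ q) + (\<chi> j. c $ j ^ q)"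
        by (simp add: vec_eq_iff frob_add)
      ultimately show ?thesis by (simp add: \<phi>M flip: M_add)
    qed
    show "\<phi> (c *s x) = c ^ q *s \<phi> x" for c x
    proof -
      obtain a where "x = M a" using ex by metis
      moreover have "(\<chi> j. (c *s a) $ j ^ q) = c ^ q *s (\<chi> j. a $ j ^ q)"
        by (simp add: vec_eq_iff power_mult_distrib)
      ultimately show ?thesis by (simp add: \<phi>M flip: M_scale)
    qed
    have iter: "(\<phi> ^^ i) (M a) = M (\<chi> j. a $ j ^ (q ^ i))" for i a
      by (induction i) (auto simp: \<phi>M mult.commute simp flip: power_mult)
    show "(\<phi> ^^ t) x = x" for x
    proof -
      obtain a where "x = M a" using ex by metis
      thus ?thesis by (simp add: iter frob_t)
    qed
    show "W = {x. \<phi> x = x}"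
    proof (intro equalityI subsetI)
      fix w assume "w \<in> W"
      then obtain k :: "'k ^ 'n" where "w = M (\<chi> j. emb (k $ j))" using WM by auto
      moreover have "emb c ^ q = emb c" for c using range by blast
      ultimately show "w \<in> {x. \<phi> x = x}" by (simp add: \<phi>M)
    next
      fix x assume x: "x \<in> {x. \<phi> x = x}"
      obtain a where a: "x = M a" using ex by metis
      hence "(\<chi> j. a $ j ^ q) = a" using x \<phi>M injD[OF injM] by simp
      hence "a $ j \<in> range emb" for j unfolding range by (auto simp: vec_eq_iff)
      hence "\<exists>k. \<forall>j. a $ j = emb (k j)" by (intro choice) auto
      then obtain k where "\<And>j. a $ j = emb (k j)" by blast
      hence "a = (\<chi> j. emb ((\<chi> j. k j) $ j))" by (simp add: vec_eq_iff)
      thus "x \<in> W" unfolding WM a by blast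
    qed
    have "inj (\<lambda>k :: 'k ^ 'n. M (\<chi> j. emb (k $ j)))"
    proof (rule injI)
      fix k l :: "'k ^ 'n" assume "M (\<chi> j. emb (k $ j)) = M (\<chi> j. emb (l $ j))"
      hence "(\<chi> j. emb (k $ j)) = (\<chi> j. emb (l $ j) :: 'a ^ 'n)" by (rule injD[OF injM])
      thus "k = l" by (simp add: vec_eq_iff inj_eq[OF field_embedding_inj[OF emb]])
    qed
    thus "card W = q ^ t" unfolding WM by (simp add: card_image q n)
  qed (fact n spanW)+
  thus ?thesis by blast
qed

section \<open>Collineations induced by the powers of \<open>\<phi>\<close>\<close>

context subgeometry_frobenius
begin

lemma iter_image_span: "(\<phi> ^^ i) ` vec.span {x} = vec.span {(\<phi> ^^ i) x}"
proof (intro equalityI subsetI)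
  fix y assume "y \<in> vec.span {(\<phi> ^^ i) x}"
  then obtain c where c: "y = c *s (\<phi> ^^ i) x" by (auto simp: vec.span_singleton)
  obtain d where "d ^ (q ^ i) = c" using frob_surj by blast
  hence "y = (\<phi> ^^ i) (d *s x)" by (simp add: c iter_scale)
  thus "y \<in> (\<phi> ^^ i) ` vec.span {x}" by (auto simp: vec.span_singleton)
qed (auto simp: vec.span_singleton iter_scale)

lemma iter_image_point: "P \<in> pg_points (*s) \<Longrightarrow> (\<phi> ^^ i) ` P \<in> pg_points (*s)"
  unfolding vec.pg_points_iff using iter_image_span iter_eq_0_iff by metis

lemma iter_image_points_in:
  assumes U: "vec.subspace U"
  shows "(\<lambda>P. (\<phi> ^^ i) ` P) ` points_in (*s) U = points_in (*s) ((\<phi> ^^ i) ` U)"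
proof (intro equalityI subsetI)
  fix Q assume "Q \<in> (\<lambda>P. (\<phi> ^^ i) ` P) ` points_in (*s) U"
  thus "Q \<in> points_in (*s) ((\<phi> ^^ i) ` U)"
    by (auto simp: points_in_def iter_image_point)
next
  fix Q assume "Q \<in> points_in (*s) ((\<phi> ^^ i) ` U)"
  then obtain x where x: "x \<in> U" "(\<phi> ^^ i) x \<noteq> 0" "Q = vec.span {(\<phi> ^^ i) x}"
    by (auto simp: vec.points_in_iff[OF subspace_iter_image[OF U]])
  hence "vec.span {x} \<in> points_in (*s) U" by (auto simp: vec.points_in_iff[OF U] iter_eq_0_iff)
  thus "Q \<in> (\<lambda>P. (\<phi> ^^ i) ` P) ` points_in (*s) U" using x(3)
    by (intro image_eqI[of _ _ "vec.span {x}"]) (auto simp: iter_image_span)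
qed

definition coll :: "nat \<Rightarrow> ('a ^ 'n) set \<Rightarrow> ('a ^ 'n) set"
  where "coll s = restrict (\<lambda>P. (\<phi> ^^ s) ` P) (pg_points (*s))"

lemma coll_apply: "P \<in> pg_points (*s) \<Longrightarrow> coll s P = (\<phi> ^^ s) ` P"
  by (simp add: coll_def)

lemma coll_iter: "P \<in> pg_points (*s) \<Longrightarrow> (coll s ^^ i) P = (\<phi> ^^ (s * i)) ` P"
proof (induction i)
  case (Suc i)
  thus ?case by (simp add: coll_apply iter_image_point image_image iter_iter)
qed simp

lemma coll_cong: "i mod t = j mod t \<Longrightarrow> coll i = coll j"
  unfolding coll_def using iter_cong[of i j] by (intro restrict_ext image_cong refl)

lemma coll_compose: "compose (pg_points (*s)) (coll i) (coll j) = coll (i + j)"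
  by (rule ext) (simp add: compose_def coll_def iter_image_point image_image iter_iter restrict_def)

lemma coll_inverse: "\<exists>j. (i + j) mod t = 0 \<and> (j + i) mod t = 0"
proof (intro exI)
  have "i + (t * i - i) = t * i" using t_ge_3 by simp
  thus "(i + (t * i - i)) mod t = 0 \<and> (t * i - i + i) mod t = 0" by (simp add: add.commute)
qed

lemma coll_zero: "coll 0 = (\<lambda>P\<in>pg_points (*s). P)"
  by (simp add: coll_def)

lemma coll_Bij: "coll i \<in> Bij (pg_points (*s))"
proof -
  obtain j where j: "(i + j) mod t = 0" "(j + i) mod t = 0" using coll_inverse[of i] by metis
  have "coll i (coll j P) = P" "coll j (coll i P) = P" if P: "P \<in> pg_points (*s)" for P
  proof -
    have "compose (pg_points (*s)) (coll i) (coll j) P = P" "compose (pg_points (*s)) (coll j) (coll i) P = P"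
      unfolding coll_compose using coll_cong[of "i + j" 0] coll_cong[of "j + i" 0] j P
      by (simp_all add: coll_zero)
    thus "coll i (coll j P) = P" "coll j (coll i P) = P" using P by (simp_all add: compose_eq)
  qed
  moreover have "coll i P \<in> pg_points (*s)" "coll j P \<in> pg_points (*s)" if "P \<in> pg_points (*s)" for P
    using that by (simp_all add: coll_apply iter_image_point)
  ultimately have "bij_betw (coll i) (pg_points (*s)) (pg_points (*s))"
    by (intro bij_betw_byWitness[where f' = "coll j"]) auto
  thus ?thesis by (simp add: Bij_def coll_def)
qed

lemma coll_mult: "coll i \<otimes>\<^bsub>BijGroup (pg_points (*s))\<^esub> coll j = coll (i + j)"
  by (simp add: BijGroup_def coll_Bij coll_compose)

lemma W_scale: "w \<in> W \<Longrightarrow> c ^ q = c \<Longrightarrow> c *s w \<in> W"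
  by (simp add: W_eq phi_scale)

lemma W_add: "w \<in> W \<Longrightarrow> w' \<in> W \<Longrightarrow> w + w' \<in> W"
  by (simp add: W_eq phi_add)

lemma W_nonzero: "\<exists>w\<in>W. w \<noteq> 0"
proof (rule ccontr)
  assume "\<not> ?thesis"
  hence "W \<subseteq> {0}" by blast
  hence "card W \<le> 1" using card_mono[of "{0}" W] by simp
  moreover have "1 < q ^ t" using q_gt_2 t_ge_3 by (intro one_less_power) auto
  ultimately show False using card_W by simp
qed

lemma W_independent: "\<exists>w'\<in>W. w' \<notin> vec.span {w}"
proof (rule ccontr)
  assume "\<not> ?thesis"
  hence "vec.span W \<subseteq> vec.span {w}" by (intro vec.span_minimal) auto
  hence "vec.dim (UNIV :: ('a ^ 'n) set) \<le> vec.dim {w}" unfolding span_W by (rule vec.dim_mono)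
  also have "\<dots> \<le> 1" by (simp add: vec.dim_singleton)
  finally show False using card_n t_ge_3 by (simp add: card_cart_basis)
qed

lemma coefficients_unique:
  assumes "w \<noteq> 0" "w' \<notin> vec.span {w}" "a *s w + b *s w' = c *s w + d *s (w' :: 'a ^ 'n)"
  shows "a = c \<and> b = d"
proof -
  have eq: "(b - d) *s w' = (c - a) *s w"
    using assms(3) by (simp add: vec.scale_left_diff_distrib algebra_simps)
  have "b = d"
  proof (rule ccontr)
    assume "b \<noteq> d"
    hence "w' = (inverse (b - d) * (c - a)) *s w"
      using arg_cong[OF eq, of "\<lambda>x. inverse (b - d) *s x"] by simp
    thus False using assms(2) by (auto simp: vec.span_singleton)
  qed
  thus ?thesis using eq assms(1) by simp
qed

text \<open>On \<open>w + c *s w'\<close> with \<open>w\<close>, \<open>w'\<close> in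
  \<open>W\<close> independent, equal collineations force \<open>c ^ (q ^ i) = c ^ (q ^ j)\<close>;
  as \<open>c\<close> is arbitrary, independence of Frobenius powers applies.\<close>

lemma coll_eq_imp_cong:
  assumes "coll i = coll j"
  shows "i mod t = j mod t"
proof (rule ccontr)
  assume ne: "i mod t \<noteq> j mod t"
  obtain w where w: "w \<in> W" "w \<noteq> 0" using W_nonzero by blast
  obtain w' where w': "w' \<in> W" "w' \<notin> vec.span {w}" using W_independent by blast
  have "c ^ (q ^ i) = c ^ (q ^ j)" for c :: 'a
  proof -
    let ?x = "w + c *s w'"
    have x0: "?x \<noteq> 0" using coefficients_unique[OF w(2) w'(2), of 1 c 0 0] by auto
    hence "(\<phi> ^^ i) ` vec.span {?x} = (\<phi> ^^ j) ` vec.span {?x}"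
      using fun_cong[OF assms, of "vec.span {?x}"] by (simp add: coll_apply vec.point_of_in_pg_points)
    hence "(\<phi> ^^ i) ?x \<in> vec.span {(\<phi> ^^ j) ?x}"
      unfolding iter_image_span using vec.span_base[of "(\<phi> ^^ i) ?x" "{(\<phi> ^^ i) ?x}"] by simp
    then obtain d where "(\<phi> ^^ i) ?x = d *s (\<phi> ^^ j) ?x" by (auto simp: vec.span_singleton)
    hence "1 *s w + c ^ (q ^ i) *s w' = d *s w + (d * c ^ (q ^ j)) *s w'"
      by (simp add: iter_add iter_scale iter_W w w' vec.scale_right_distrib)
    from coefficients_unique[OF w(2) w'(2) this] show ?thesis by simp
  qed
  hence eq: "c ^ (q ^ (i mod t)) = c ^ (q ^ (j mod t))" for c :: 'a by (simp add: frob_mod)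
  define a where "a k = (if k = i mod t then 1 else if k = j mod t then - 1 else 0 :: 'a)" for k
  have "(\<Sum>k<t. a k * c ^ (q ^ k)) = 0" for c
  proof -
    have "(\<Sum>k<t. a k * c ^ (q ^ k)) = (\<Sum>k\<in>{i mod t, j mod t}. a k * c ^ (q ^ k))"
      using t_ge_3 by (intro sum.mono_neutral_right) (auto simp: a_def)
    thus ?thesis using ne eq[of c] by (simp add: a_def)
  qed
  hence "a (i mod t) = 0" by (rule frob_independent) (use t_ge_3 in simp)
  thus False by (simp add: a_def)
qed

text \<open>Every vector of \<open>W\<close> is an eigenvector, and comparing \<open>w\<close>,
  \<open>w'\<close> and \<open>w + w'\<close> shows that the eigenvalue is common. Then the
  companion automorphism fixes the subfield and is a Frobenius power, so the maps agree on
  \<open>W\<close> and on its span.\<close>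

lemma fixing_semilinear_is_iter:
  assumes add: "\<And>x y. g (x + y) = g x + g y" and scale: "\<And>c x. g (c *s x) = \<theta> c *s g x"
    and \<theta>: "field_embedding \<theta>" and inj: "inj g"
    and fixes_pts: "\<And>w. w \<in> W \<Longrightarrow> w \<noteq> 0 \<Longrightarrow> g ` vec.span {w} = vec.span {w}"
  shows "\<exists>c s. c \<noteq> 0 \<and> s < t \<and> (\<forall>x. g x = c *s (\<phi> ^^ s) x)"
proof -
  have g0: "g 0 = 0" using add[of 0 0] by (metis add_cancel_right_right)
  have ex: "\<exists>c. g w = c *s w" if "w \<in> W" for w
  proof (cases "w = 0")
    case False
    have "g w \<in> vec.span {w}" using fixes_pts[OF that False] vec.span_base[of w "{w}"] by blast
    thus ?thesis by (auto simp: vec.span_singleton)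
  qed (simp add: g0)
  have same: "a = b" if asm: "w \<in> W" "w \<noteq> 0" "w' \<in> W" "w' \<notin> vec.span {w}"
      "g w = a *s w" "g w' = b *s w'" for w w' a b
  proof -
    obtain d where "g (w + w') = d *s (w + w')" using ex W_add[OF asm(1,3)] by blast
    hence "a *s w + b *s w' = d *s w + d *s w'" using asm by (simp add: add vec.scale_right_distrib)
    thus ?thesis using coefficients_unique[OF asm(2,4)] by blast
  qed
  obtain w0 where w0: "w0 \<in> W" "w0 \<noteq> 0" using W_nonzero by blast
  then obtain c where c: "g w0 = c *s w0" using ex by blast
  have gW: "g w = c *s w" if wW: "w \<in> W" for w
  proof -
    obtain a where a: "g w = a *s w" using ex wW by blast
    show ?thesis
    proof (cases "w \<in> vec.span {w0}")
      case True
      \<comment> \<open>Proportional vectors cannot be compared through their sum, so both are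
        compared with a third one.\<close>
      obtain w' where w': "w' \<in> W" "w' \<notin> vec.span {w0}" using W_independent by blast
      obtain b where b: "g w' = b *s w'" using ex w' by blast
      show ?thesis
      proof (cases "w = 0")
        case False
        hence "vec.span {w} = vec.span {w0}" using True by (intro vec.span_singleton_eq)
        hence "a = b" using same[OF wW False w'(1) _ a b] w'(2) by simp
        moreover have "c = b" using same[OF w0 w' c b] .
        ultimately show ?thesis using a by simp
      qed (simp add: g0)
    next
      case False
      thus ?thesis using same[OF w0 wW False c a] a by simp
    qed
  qed
  have c0: "c \<noteq> 0" using gW[OF w0(1)] w0(2) g0 injD[OF inj, of w0 0] by auto
  have "\<theta> k = k" if "k ^ q = k" for k
  proof -
    have "c *s (k *s w0) = \<theta> k *s (c *s w0)"
      using gW[OF W_scale[OF w0(1) that]] scale[of k w0] gW[OF w0(1)] by (auto simp: mult.commute)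
    thus ?thesis using c0 w0(2) by auto
  qed
  then obtain s where s: "s < t" "\<And>x. \<theta> x = x ^ (q ^ s)" using automorphism_is_frob[OF \<theta>] by blast
  have "g x = c *s (\<phi> ^^ s) x" for x
  proof -
    have "x \<in> vec.span W" by (simp add: span_W)
    thus ?thesis
    proof (induction rule: vec.span_induct_alt)
      case (step k w y)
      thus ?case
        by (simp add: add scale s gW iter_add iter_scale iter_W vec.scale_right_distrib mult.commute)
    qed (simp add: g0 iter_0)
  qed
  thus ?thesis using c0 s(1) by blast
qed

lemma pointwise_stabilizer_eq:
  assumes \<Sigma>: "\<Sigma> = point_of ` (W - {0})"
  shows "pointwise_stabilizer \<Sigma> = range coll"
proof (intro equalityI subsetI)
  fix \<sigma> assume "\<sigma> \<in> pointwise_stabilizer \<Sigma>"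
  then obtain g where g: "\<sigma> = restrict (\<lambda>P. g ` P) (pg_points (*s))" "semilinear_bij g"
    and fixed: "\<forall>P\<in>\<Sigma>. \<sigma> P = P" by (auto simp: pointwise_stabilizer_def PGammaL_def)
  from g(2) obtain \<theta> where \<theta>: "field_embedding \<theta>" "\<And>c x. g (c *s x) = \<theta> c *s g x"
    and add: "\<And>x y. g (x + y) = g x + g y" and inj: "inj g"
    by (auto simp: semilinear_bij_def bij_def)
  have "g ` vec.span {w} = vec.span {w}" if "w \<in> W" "w \<noteq> 0" for w
  proof -
    have "vec.span {w} \<in> \<Sigma>" using that by (auto simp: \<Sigma>)
    hence "\<sigma> (vec.span {w}) = vec.span {w}" using fixed by blast
    thus ?thesis using that by (simp add: g(1) vec.point_of_in_pg_points)
  qed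
  then obtain c s where cs: "c \<noteq> 0" "\<And>x. g x = c *s (\<phi> ^^ s) x"
    using fixing_semilinear_is_iter[OF add \<theta>(2,1) inj] by metis
  have "g ` P = (\<phi> ^^ s) ` P" if "P \<in> pg_points (*s)" for P
  proof -
    obtain x where x: "x \<noteq> 0" "P = vec.span {x}" using \<open>P \<in> pg_points (*s)\<close> by (auto simp: vec.pg_points_iff)
    \<comment> \<open>The common eigenvalue \<open>c\<close> is invisible on points.\<close>
    have "(\<lambda>y. c *s y) ` vec.span {(\<phi> ^^ s) x} = vec.span {(\<phi> ^^ s) x}"
    proof (intro equalityI subsetI)
      fix y assume "y \<in> vec.span {(\<phi> ^^ s) x}"
      hence "inverse c *s y \<in> vec.span {(\<phi> ^^ s) x}" by (rule vec.span_scale)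
      thus "y \<in> (\<lambda>y. c *s y) ` vec.span {(\<phi> ^^ s) x}"
        using cs(1) by (intro image_eqI[of _ _ "inverse c *s y"]) auto
    qed (auto intro: vec.span_scale)
    thus ?thesis unfolding x(2) by (simp add: cs(2) flip: iter_image_span image_image)
  qed
  hence "\<sigma> = coll s" unfolding g(1) coll_def by (intro restrict_ext)
  thus "\<sigma> \<in> range coll" by blast
next
  fix \<sigma> assume "\<sigma> \<in> range coll"
  then obtain s where \<sigma>: "\<sigma> = coll s" by auto
  have "inj (\<lambda>c :: 'a. c ^ (q ^ s))" by (rule injI) (rule frob_inj)
  hence "bij (\<lambda>c :: 'a. c ^ (q ^ s))" by (simp add: bij_def finite_UNIV_inj_surj)
  moreover have "field_embedding (\<lambda>c :: 'a. c ^ (q ^ s))"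
    by (simp add: field_embedding_def frob_iter_add power_mult_distrib)
  ultimately have "semilinear_bij (\<phi> ^^ s)"
    unfolding semilinear_bij_def using iter_bij iter_add iter_scale by blast
  moreover have "coll s P = P" if "P \<in> \<Sigma>" for P
    using that by (auto simp: \<Sigma> coll_apply vec.point_of_in_pg_points iter_image_span iter_W)
  ultimately show "\<sigma> \<in> pointwise_stabilizer \<Sigma>"
    unfolding pointwise_stabilizer_def PGammaL_def \<sigma> coll_def by blast
qed

lemma generate_coll: "generate (BijGroup (pg_points (*s))) {coll s} = range (\<lambda>k. coll (s * k))"
proof (intro equalityI subsetI)
  let ?G = "BijGroup (pg_points (*s) :: ('a ^ 'n) set set)"
  interpret G: group ?G by (rule group_BijGroup)
  have one_eq: "\<one>\<^bsub>?G\<^esub> = coll 0" by (simp add: BijGroup_def coll_zero)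
  have carr: "coll i \<in> carrier ?G" for i using coll_Bij by (simp add: BijGroup_def)
  {
    fix h assume "h \<in> generate ?G {coll s}"
    thus "h \<in> range (\<lambda>k. coll (s * k))"
    proof (induction rule: generate.induct)
      case one
      have "\<one>\<^bsub>?G\<^esub> = coll (s * 0)" using one_eq by simp
      thus ?case by blast
    next
      case (incl h)
      hence "h = coll (s * 1)" by simp
      thus ?case by blast
    next
      case (inv h)
      have "s * (t - 1) + s = s * t" using t_ge_3 by (simp add: algebra_simps)
      hence "coll (s * (t - 1)) \<otimes>\<^bsub>?G\<^esub> coll s = \<one>\<^bsub>?G\<^esub>"
        using coll_cong[of "s * t" 0] by (simp add: coll_mult one_eq)
      hence "inv\<^bsub>?G\<^esub> coll s = coll (s * (t - 1))" by (rule G.inv_equality) (rule carr)+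
      thus ?case using inv by blast
    next
      case (eng h1 h2)
      then obtain k l where "h1 = coll (s * k)" "h2 = coll (s * l)" by auto
      hence "h1 \<otimes>\<^bsub>?G\<^esub> h2 = coll (s * (k + l))" by (simp add: coll_mult distrib_left)
      thus ?case by blast
    qed
  }
  fix h assume "h \<in> range (\<lambda>k. coll (s * k))"
  then obtain k where "h = coll (s * k)" by auto
  moreover have "coll (s * k) \<in> generate ?G {coll s}" for k
  proof (induction k)
    case 0
    thus ?case using generate.one[of ?G "{coll s}"] by (simp add: one_eq)
  next
    case (Suc k)
    have "coll s \<in> generate ?G {coll s}" by (rule generate.incl) simp
    from generate.eng[OF this Suc] show ?case by (simp add: coll_mult)
  qed
  ultimately show "h \<in> generate ?G {coll s}" by simp
qed

text \<open>The collineation \<open>coll i\<close> depends exactly on \<open>i\<close> modulo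
  \<open>t\<close>, so the stabilizer is cyclic of order \<open>t\<close> and its generators
  correspond to the units: \<open>coll 1\<close> is a power of \<open>coll s\<close> exactly when
  \<open>s\<close> is invertible modulo \<open>t\<close>.\<close>

lemma stabilizer_generator_iff:
  assumes \<Sigma>: "\<Sigma> = point_of ` (W - {0})"
  shows "stabilizer_generator \<Sigma> \<sigma> \<longleftrightarrow> (\<exists>s<t. coprime s t \<and> \<sigma> = coll s)"
proof
  assume gen: "stabilizer_generator \<Sigma> \<sigma>"
  then obtain i where i: "\<sigma> = coll i"
    by (auto simp: stabilizer_generator_def pointwise_stabilizer_eq[OF \<Sigma>])
  define s where "s = i mod t"
  have s: "s < t" "\<sigma> = coll s" using t_ge_3 coll_cong[of i s] by (auto simp: s_def i)
  have "coll 1 \<in> range (\<lambda>k. coll (s * k))"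
    using gen by (simp add: stabilizer_generator_def pointwise_stabilizer_eq[OF \<Sigma>] s generate_coll)
  then obtain k where "coll 1 = coll (s * k)" by auto
  hence "1 mod t = s * k mod t" by (rule coll_eq_imp_cong)
  hence "[s * k = Suc 0] (mod t)" by (simp add: cong_def One_nat_def)
  hence "coprime s t" unfolding coprime_iff_invertible_nat by blast
  thus "\<exists>s<t. coprime s t \<and> \<sigma> = coll s" using s by blast
next
  assume "\<exists>s<t. coprime s t \<and> \<sigma> = coll s"
  then obtain s where s: "s < t" "coprime s t" "\<sigma> = coll s" by blast
  obtain k where k: "(s * k) mod t = 1" using coprime_inverse_mod[OF s(2)] .
  have "coll i = coll (s * (k * i))" for i
  proof (rule coll_cong)
    have "s * (k * i) mod t = (s * k mod t) * i mod t" by (simp add: mod_mult_left_eq mult.assoc)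
    thus "i mod t = s * (k * i) mod t" by (simp add: k)
  qed
  hence "range coll = range (\<lambda>k. coll (s * k))" by blast
  thus "stabilizer_generator \<Sigma> \<sigma>"
    unfolding stabilizer_generator_def pointwise_stabilizer_eq[OF \<Sigma>] generate_coll s(3) by blast
qed

section \<open>Generating points\<close>

lemma orbit_combs_subspace: "vec.subspace (range (orbit_comb s p m))"
proof (rule vec.subspaceI)
  have "orbit_comb s p m (\<lambda>_. 0) = 0" by (simp add: orbit_comb_def)
  thus "0 \<in> range (orbit_comb s p m)" by (metis rangeI)
  show "x + y \<in> range (orbit_comb s p m)" if xy: "x \<in> range (orbit_comb s p m)" "y \<in> range (orbit_comb s p m)" for x y
  proof -
    obtain c d where "x = orbit_comb s p m c" "y = orbit_comb s p m d" using xy by auto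
    hence "x + y = orbit_comb s p m (\<lambda>k. c k + d k)"
      by (simp add: orbit_comb_def vec.scale_left_distrib sum.distrib)
    thus ?thesis by blast
  qed
  show "a *s x \<in> range (orbit_comb s p m)" if xr: "x \<in> range (orbit_comb s p m)" for a x
  proof -
    obtain c where "x = orbit_comb s p m c" using xr by auto
    hence "a *s x = orbit_comb s p m (\<lambda>k. a * c k)"
      by (simp add: orbit_comb_def vec.scale_sum_right)
    thus ?thesis by blast
  qed
qed

lemma orbit_span_coll:
  assumes "p \<noteq> 0"
  shows "orbit_span (coll s) (vec.span {p}) m = points_in (*s) (range (orbit_comb s p (Suc m)))"
proof -
  let ?T = "(\<lambda>i. (coll s ^^ i) (vec.span {p})) ` {0..m}"
  have T: "?T = (\<lambda>i. vec.span {(\<phi> ^^ (s * i)) p}) ` {..<Suc m}"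
    using assms by (auto simp: coll_iter vec.point_of_in_pg_points iter_image_span)
  have "vec.span (\<Union>?T) = range (orbit_comb s p (Suc m))"
  proof (intro equalityI)
    have "vec.span {(\<phi> ^^ (s * i)) p} \<subseteq> range (orbit_comb s p (Suc m))" if i: "i < Suc m" for i
    proof -
      have "orbit_comb s p (Suc m) (\<lambda>k. of_bool (k = i)) = (\<Sum>k<Suc m. if k = i then (\<phi> ^^ (s * k)) p else 0)"
        unfolding orbit_comb_def by (intro sum.cong) auto
      also have "\<dots> = (\<phi> ^^ (s * i)) p" using i by (simp del: sum.lessThan_Suc)
      finally have "(\<phi> ^^ (s * i)) p \<in> range (orbit_comb s p (Suc m))" by (metis rangeI)
      thus ?thesis by (simp add: vec.span_singleton_subset orbit_combs_subspace)
    qed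
    thus "vec.span (\<Union>?T) \<subseteq> range (orbit_comb s p (Suc m))"
      unfolding T by (intro vec.span_minimal orbit_combs_subspace) blast
    have mem: "(\<phi> ^^ (s * i)) p \<in> \<Union>?T" if "i < Suc m" for i
      unfolding T using that vec.span_base[of "(\<phi> ^^ (s * i)) p" "{(\<phi> ^^ (s * i)) p}"] by blast
    have "orbit_comb s p (Suc m) c \<in> vec.span (\<Union>?T)" for c
      unfolding orbit_comb_def
      by (rule vec.span_sum) (intro vec.span_scale vec.span_base mem, simp only: lessThan_iff)
    thus "range (orbit_comb s p (Suc m)) \<subseteq> vec.span (\<Union>?T)" by blast
  qed
  thus ?thesis by (simp add: orbit_span_def pspan_def)
qed

text \<open>For admissible \<open>v\<close> and \<open>s\<close> coprime to \<open>t\<close>, the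
  point spanned by a dual vector, written so that it visibly depends on \<open>s\<close> and the
  kernel of \<open>v\<close> alone.\<close>

definition generator_of :: "nat \<Rightarrow> ('a ^ 'n \<Rightarrow> 'a) \<Rightarrow> ('a ^ 'n) set"
  where "generator_of s v = {x. \<forall>i<t - 1. v ((\<phi> ^^ (s * i)) x) = 0}"

lemma generating_point_iff:
  assumes s: "coprime s t" and U: "vec.subspace U"
  shows "generating_point (points_in (*s) U) (coll s) P \<longleftrightarrow>
    (\<exists>v. admissible v \<and> vertex s v = U \<and> P = generator_of s v)"
proof -
  \<comment> \<open>The orbit segments include their last index, hence one vector more than the
    argument of \<open>orbit_span\<close>.\<close>
  have suc: "Suc (CARD('n) - 1) = t" "Suc (CARD('n) - 3) = t - 2" using card_n t_ge_3 by auto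
  show ?thesis
  proof
    assume gp: "generating_point (points_in (*s) U) (coll s) P"
    then obtain p where p: "p \<noteq> 0" "P = vec.span {p}"
      by (auto simp: generating_point_def vec.pg_points_iff)
    have "points_in (*s) (range (orbit_comb s p t)) = points_in (*s) UNIV"
      using gp unfolding p(2) generating_point_def orbit_span_coll[OF p(1)] suc by (simp add: points_in_def)
    hence "range (orbit_comb s p t) = UNIV"
      by (simp add: vec.points_in_eq_iff orbit_combs_subspace)
    then obtain v where v: "admissible v" "dual_vector s v p"
      using functional_of_cyclic_vector[of s p] by (metis UNIV_I imageE)
    have "points_in (*s) U = points_in (*s) (range (orbit_comb s p (t - 2)))"
      using gp unfolding p(2) generating_point_def orbit_span_coll[OF p(1)] suc by simp
    hence "U = range (orbit_comb s p (t - 2))"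
      by (simp add: vec.points_in_eq_iff orbit_combs_subspace U)
    thus "\<exists>v. admissible v \<and> vertex s v = U \<and> P = generator_of s v"
      using v vertex_eq_orbit_combs[OF s v] dual_vector_span[OF s v] p(2)
      by (intro exI[of _ v]) (auto simp: generator_of_def)
  next
    assume "\<exists>v. admissible v \<and> vertex s v = U \<and> P = generator_of s v"
    then obtain v where v: "admissible v" "vertex s v = U" "P = generator_of s v" by blast
    obtain p where p: "dual_vector s v p" using dual_vector_exists[OF s v(1)] by blast
    have p0: "p \<noteq> 0" by (rule dual_vector_nonzero[OF admissible_functional[OF v(1)] p])
    have P: "P = vec.span {p}" using dual_vector_span[OF s v(1) p] v(3) by (simp add: generator_of_def)
    have "range (orbit_comb s p t) = UNIV" using dual_vector_expansion[OF s v(1) p] by blast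
    thus "generating_point (points_in (*s) U) (coll s) P"
      unfolding generating_point_def P orbit_span_coll[OF p0] suc
      using vertex_eq_orbit_combs[OF s v(1) p] v(2) p0 by (simp add: vec.point_of_in_pg_points vec.points_in_UNIV)
  qed
qed

text \<open>Of the two coordinates that cut out the vertex, \<open>\<phi> ^^ (s * (t - 2))\<close>
  takes \<open>p\<close> to a vector where only the second is nonzero, and
  \<open>\<phi> ^^ (s * (t - 1))\<close> to one where only the first is. Joining either vector to
  the vertex drops the condition that fails.\<close>

lemma generator_join:
  assumes s: "coprime s t" and v: "admissible v"
  shows "\<exists>x. x \<notin> vertex s v \<and> (coll s ^^ (t - 2)) (generator_of s v) = vec.span {x} \<and>
      vec.span (insert x (vertex s v)) = {x. v x = 0}"
    and "\<exists>x. x \<notin> vertex s v \<and> (coll s ^^ (t - 1)) (generator_of s v) = vec.span {x} \<and>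
      vec.span (insert x (vertex s v)) = {x. v ((\<phi> ^^ s) x) = 0}"
proof -
  note fv = admissible_functional[OF v]
  obtain p where p: "dual_vector s v p" using dual_vector_exists[OF s v] by blast
  have p0: "p \<noteq> 0" by (rule dual_vector_nonzero[OF fv p])
  have P: "generator_of s v = vec.span {p}" using dual_vector_span[OF s v p] by (simp add: generator_of_def)
  have pt: "(coll s ^^ i) (generator_of s v) = vec.span {(\<phi> ^^ (s * i)) p}" for i
    unfolding P using p0 by (simp add: coll_iter vec.point_of_in_pg_points iter_image_span)
  have ev: "v ((\<phi> ^^ (s * i)) p) = of_bool (i = t - 1)" if "i < t" for i
    using p that unfolding dual_vector_def by blast
  have shift: "(\<phi> ^^ s) ((\<phi> ^^ (s * i)) p) = (\<phi> ^^ (s * Suc i)) p" for i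
    by (simp add: iter_iter)
  have U: "vec.span (vertex s v) = vertex s v"
    using subspace_vertex[OF fv] by (simp add: vec.span_eq_iff)
  define y where "y = (\<phi> ^^ (s * (t - 2))) p"
  have "Suc (t - 2) = t - 1" using t_ge_3 by simp
  hence y: "v y = 0" "v ((\<phi> ^^ s) y) = 1"
    using ev[of "t - 2"] ev[of "t - 1"] t_ge_3 by (auto simp: y_def shift)
  define z where "z = (\<phi> ^^ (s * (t - 1))) p"
  have "(\<phi> ^^ (s * t)) p = p" using iter_t_mult[of s p] by (simp add: mult.commute)
  moreover have "Suc (t - 1) = t" using t_ge_3 by simp
  ultimately have z: "v z = 1" "v ((\<phi> ^^ s) z) = 0"
    using ev[of "t - 1"] ev[of 0] t_ge_3 by (auto simp: z_def shift)
  have "vec.span (insert y (vertex s v)) = {x. v x = 0}"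
  proof (intro equalityI subsetI)
    fix x assume "x \<in> vec.span (insert y (vertex s v))"
    then obtain k where "x - k *s y \<in> vertex s v" unfolding vec.span_breakdown_eq U by blast
    thus "x \<in> {x. v x = 0}" by (auto simp: vertex_def functional_diff[OF fv] functional_scale[OF fv] y)
  next
    fix x assume x: "x \<in> {x. v x = 0}"
    obtain k where "k ^ (q ^ s) = v ((\<phi> ^^ s) x)" using frob_surj by blast
    hence "x - k *s y \<in> vertex s v"
      using x by (simp add: vertex_def functional_diff[OF fv] functional_scale[OF fv] y iter_diff iter_scale)
    thus "x \<in> vec.span (insert y (vertex s v))" unfolding vec.span_breakdown_eq U by blast
  qed
  moreover have "y \<notin> vertex s v" using y by (simp add: vertex_def)
  ultimately show "\<exists>x. x \<notin> vertex s v \<and> (coll s ^^ (t - 2)) (generator_of s v) = vec.span {x} \<and>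
      vec.span (insert x (vertex s v)) = {x. v x = 0}"
    using pt[of "t - 2"] unfolding y_def[symmetric] by blast
  have "vec.span (insert z (vertex s v)) = {x. v ((\<phi> ^^ s) x) = 0}"
  proof (intro equalityI subsetI)
    fix x assume "x \<in> vec.span (insert z (vertex s v))"
    then obtain k where "x - k *s z \<in> vertex s v" unfolding vec.span_breakdown_eq U by blast
    thus "x \<in> {x. v ((\<phi> ^^ s) x) = 0}"
      by (auto simp: vertex_def functional_diff[OF fv] functional_scale[OF fv] z iter_diff iter_scale)
  next
    fix x assume x: "x \<in> {x. v ((\<phi> ^^ s) x) = 0}"
    have "x - v x *s z \<in> vertex s v"
      using x by (simp add: vertex_def functional_diff[OF fv] functional_scale[OF fv] z iter_diff iter_scale)
    thus "x \<in> vec.span (insert z (vertex s v))" unfolding vec.span_breakdown_eq U by blast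
  qed
  moreover have "z \<notin> vertex s v" using z by (simp add: vertex_def)
  ultimately show "\<exists>x. x \<notin> vertex s v \<and> (coll s ^^ (t - 1)) (generator_of s v) = vec.span {x} \<and>
      vec.span (insert x (vertex s v)) = {x. v ((\<phi> ^^ s) x) = 0}"
    using pt[of "t - 1"] unfolding z_def[symmetric] by blast
qed

end

section \<open>Projection from the vertex\<close>

lemma linear_image_span_singleton:
  "Vector_Spaces.linear (*s) (*s) f \<Longrightarrow> f ` vec.span {x} = vec.span {f x}"
  by (simp add: vec.linear_span_image[symmetric])

text \<open>The dimensions make \<open>U\<close> and the range of \<open>\<psi>\<close>
  complementary. The linear map obtained expresses the projection from the vertex in the coordinates
  of the line.\<close>

lemma projection_along_exists:
  fixes \<psi> :: "'a::field ^ 'm \<Rightarrow> 'a ^ 'n"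
  assumes U: "vec.subspace U" "vec.dim U + CARD('m) = CARD('n)"
    and lin: "Vector_Spaces.linear (*s) (*s) \<psi>" and inj: "inj \<psi>" and disj: "range \<psi> \<inter> U \<subseteq> {0}"
  shows "\<exists>\<pi>. Vector_Spaces.linear (*s) (*s) \<pi> \<and> (\<forall>y. \<pi> (\<psi> y) = y) \<and> (\<forall>x. \<pi> x = 0 \<longleftrightarrow> x \<in> U)"
proof -
  interpret psi: Vector_Spaces.linear "(*s)" "(*s)" \<psi> by (fact lin)
  have R: "vec.subspace (range \<psi>)" using psi.subspace_image[OF vec.subspace_UNIV] .
  have "vec.dim (range \<psi>) = CARD('m)"
    using vec.dim_image_eq[OF lin, of UNIV] inj by (simp add: card_cart_basis)
  moreover have "range \<psi> \<inter> U = {0}" using disj vec.subspace_0[OF R] vec.subspace_0[OF U(1)] by blast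
  hence "U \<inter> range \<psi> = {0}" by blast
  hence "vec.dim (U \<inter> range \<psi>) = 0" by simp
  moreover define S where "S = {x + y |x y. x \<in> U \<and> y \<in> range \<psi>}"
  ultimately have "vec.dim S = CARD('n)"
    using vec.dim_sums_Int[OF U(1) R] U(2) unfolding S_def by linarith
  hence "vec.span S = UNIV"
    using vec.dim_eq_full[of S] by (simp add: vec.dimension_def card_cart_basis)
  moreover have "vec.span S = S"
    unfolding vec.span_eq_iff S_def by (rule vec.subspace_sums[OF U(1) R])
  ultimately have full: "S = UNIV" by simp
  have uniq: "y = y'" if "x - \<psi> y \<in> U" "x - \<psi> y' \<in> U" for x y y'
  proof -
    have "\<psi> (y' - y) \<in> U"
      using vec.subspace_diff[OF U(1) that] by (simp add: psi.diff)
    hence "\<psi> (y' - y) = 0" using disj by blast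
    hence "\<psi> y' = \<psi> y" by (simp add: psi.diff)
    thus ?thesis using injD[OF inj] by metis
  qed
  define \<pi> where "\<pi> x = (SOME y. x - \<psi> y \<in> U)" for x
  have pi: "x - \<psi> (\<pi> x) \<in> U" for x
  proof -
    have "x \<in> S" by (simp only: full UNIV_I)
    then obtain u y where "u \<in> U" "x = u + \<psi> y" by (auto simp: S_def)
    hence "x - \<psi> y \<in> U" by simp
    thus ?thesis unfolding \<pi>_def by (rule someI)
  qed
  have pi_eq: "\<pi> x = y" if "x - \<psi> y \<in> U" for x y using uniq[OF pi that] .
  have "Vector_Spaces.linear (*s) (*s) \<pi>"
  proof (unfold_locales)
    fix x y c
    have "(x + y) - \<psi> (\<pi> x + \<pi> y) = (x - \<psi> (\<pi> x)) + (y - \<psi> (\<pi> y))" by (simp add: psi.add)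
    also have "\<dots> \<in> U" by (intro vec.subspace_add[OF U(1)] pi)
    finally show "\<pi> (x + y) = \<pi> x + \<pi> y" by (rule pi_eq)
    have "c *s x - \<psi> (c *s \<pi> x) = c *s (x - \<psi> (\<pi> x))" by (simp add: psi.scale vec.scale_right_diff_distrib)
    also have "\<dots> \<in> U" by (intro vec.subspace_scale[OF U(1)] pi)
    finally show "\<pi> (c *s x) = c *s \<pi> x" by (rule pi_eq)
  qed
  moreover have "\<pi> (\<psi> y) = y" for y by (rule pi_eq) (simp add: vec.subspace_0[OF U(1)])
  moreover have "\<pi> x = 0 \<longleftrightarrow> x \<in> U" for x
  proof
    assume "\<pi> x = 0"
    thus "x \<in> U" using pi[of x] by (simp add: psi.zero)
  next
    assume "x \<in> U"
    thus "\<pi> x = 0" by (intro pi_eq) (simp add: psi.zero)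
  qed
  ultimately show ?thesis by blast
qed

locale vertex_projection = subgeometry_frobenius field_type q t \<phi> W
  for field_type :: "'a::{field,finite} itself" and q t and \<phi> :: "'a ^ 'n \<Rightarrow> 'a ^ 'n" and W +
  fixes U :: "('a ^ 'n) set" and \<psi> :: "'a ^ 2 \<Rightarrow> 'a ^ 'n" and \<pi> :: "'a ^ 'n \<Rightarrow> 'a ^ 2"
  assumes U_subspace: "vec.subspace U" and U_dim: "vec.dim U = t - 2" and U_W: "U \<inter> W \<subseteq> {0}"
    and psi_linear: "Vector_Spaces.linear (*s) (*s) \<psi>" and psi_inj: "inj \<psi>"
    and pi_linear: "Vector_Spaces.linear (*s) (*s) \<pi>"
    and pi_psi: "\<pi> (\<psi> y) = y" and pi_eq_0_iff: "\<pi> x = 0 \<longleftrightarrow> x \<in> U"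
begin

sublocale psi: Vector_Spaces.linear "(*s)" "(*s)" \<psi> by (rule psi_linear)
sublocale pi: Vector_Spaces.linear "(*s)" "(*s)" \<pi> by (rule pi_linear)

lemma pi_W_nonzero: "w \<in> W \<Longrightarrow> w \<noteq> 0 \<Longrightarrow> \<pi> w \<noteq> 0"
  using pi_eq_0_iff U_W by auto

lemma pi_defect: "x - \<psi> (\<pi> x) \<in> U"
  by (simp add: pi_eq_0_iff[symmetric] pi.diff pi_psi)

lemma span_insert_Int_line: "vec.span (insert x U) \<inter> range \<psi> = \<psi> ` vec.span {\<pi> x}"
proof (intro equalityI subsetI)
  fix z assume "z \<in> vec.span (insert x U) \<inter> range \<psi>"
  then obtain y k where y: "z = \<psi> y" and "\<psi> y - k *s x \<in> U"
    by (auto simp: vec.span_breakdown_eq vec.span_eq_iff[THEN iffD2, OF U_subspace])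
  hence "y = k *s \<pi> x" by (simp add: pi_eq_0_iff[symmetric] pi.diff pi.scale pi_psi)
  thus "z \<in> \<psi> ` vec.span {\<pi> x}" unfolding y by (auto simp: vec.span_singleton)
next
  fix z assume "z \<in> \<psi> ` vec.span {\<pi> x}"
  then obtain k where z: "z = \<psi> (k *s \<pi> x)" by (auto simp: vec.span_singleton)
  hence "z - k *s x \<in> U" by (simp add: pi_eq_0_iff[symmetric] pi.diff pi.scale pi_psi)
  thus "z \<in> vec.span (insert x U) \<inter> range \<psi>"
    using z by (auto simp: vec.span_breakdown_eq vec.span_eq_iff[THEN iffD2, OF U_subspace])
qed

lemma pspan_insert_Int_line:
  assumes x: "x \<notin> U"
  shows "pspan (*s) (insert (vec.span {x}) (points_in (*s) U)) \<inter> points_in (*s) (range \<psi>)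
    = {\<psi> ` vec.span {\<pi> x}}"
proof -
  have x0: "x \<noteq> 0" using x vec.subspace_0[OF U_subspace] by auto
  have "\<psi> (\<pi> x) \<noteq> 0" using x pi_eq_0_iff pi_psi[of "\<pi> x"] pi.zero by metis
  hence "points_in (*s) (\<psi> ` vec.span {\<pi> x}) = {\<psi> ` vec.span {\<pi> x}}"
    unfolding linear_image_span_singleton[OF psi_linear] by (rule vec.points_in_span_singleton)
  thus ?thesis
    by (simp add: vec.pspan_insert_points_in[OF U_subspace x0] span_insert_Int_line flip: points_in_Int)
qed

definition L :: "('a ^ 2) set set"
  where "L = (\<lambda>w. vec.span {\<pi> w}) ` (W - {0})"

text \<open>No nonzero vector of \<open>W\<close> lies in \<open>U\<close>, so every join with the
  vertex meets the line in exactly one point, the image under \<open>\<psi>\<close> of the span of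
  \<open>\<pi> w\<close>.\<close>

lemma pull_back_projection:
  assumes \<Sigma>: "\<Sigma> = point_of ` (W - {0})"
  shows "pull_back \<psi> (projection (points_in (*s) U) (points_in (*s) (range \<psi>)) \<Sigma>) = L"
proof -
  have nU: "w \<notin> U" if "w \<in> W - {0}" for w using that U_W by auto
  have "pspan (*s) (insert (vec.span {w}) (points_in (*s) U)) \<inter> points_in (*s) (range \<psi>) = {Q} \<longleftrightarrow>
      Q = \<psi> ` vec.span {\<pi> w}" if "w \<in> W - {0}" for w Q
    using pspan_insert_Int_line[OF nU[OF that]] by auto
  hence "projection (points_in (*s) U) (points_in (*s) (range \<psi>)) \<Sigma> = (\<lambda>w. \<psi> ` vec.span {\<pi> w}) ` (W - {0})"
    unfolding projection_def \<Sigma> by auto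
  moreover have "\<psi> ` P = \<psi> ` vec.span {\<pi> w} \<longleftrightarrow> P = vec.span {\<pi> w}" for P w
    using psi_inj by (rule inj_image_eq_iff)
  ultimately show ?thesis
    using pi_W_nonzero by (auto simp: pull_back_def L_def vec.point_of_in_pg_points)
qed

end

lemma point_2_eq_iff:
  fixes z :: "'a::field ^ 2"
  assumes "z \<noteq> 0"
  shows "vec.span {z} = vec.span {vector [1, y]} \<longleftrightarrow> z $ 1 \<noteq> 0 \<and> z $ 2 / z $ 1 = y"
proof
  assume "vec.span {z} = vec.span {vector [1, y]}"
  hence "z \<in> vec.span {vector [1, y]}" using vec.span_base[of z "{z}"] by simp
  then obtain c where "z = c *s vector [1, y]" by (auto simp: vec.span_singleton)
  hence "z $ 1 = c" "z $ 2 = c * y" by simp_all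
  moreover have "c \<noteq> 0" using assms \<open>z = c *s vector [1, y]\<close> by auto
  ultimately show "z $ 1 \<noteq> 0 \<and> z $ 2 / z $ 1 = y" by simp
next
  assume "z $ 1 \<noteq> 0 \<and> z $ 2 / z $ 1 = y"
  hence "z = z $ 1 *s vector [1, y]" "z $ 1 \<noteq> 0" by (auto simp: vec_eq_iff forall_2)
  thus "vec.span {z} = vec.span {vector [1, y]}" by (metis vec.span_singleton_scale)
qed

lemma (in finite_extension) pseudoregulus_L0_eq:
  "pseudoregulus_L0 q = (\<lambda>y :: 'a. vec.span {vector [1, y]}) ` frob_quot 1 ` (- {0})"
proof -
  have "vec.span {vector [c, c ^ q] :: 'a ^ 2} = vec.span {vector [1, frob_quot 1 c]}" if "c \<noteq> 0" for c
  proof -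
    have nz: "(vector [c, c ^ q] :: 'a ^ 2) \<noteq> 0" using that by (auto simp: vec_eq_iff forall_2)
    show ?thesis by (subst point_2_eq_iff[OF nz]) (simp add: that frob_quot_def)
  qed
  thus ?thesis unfolding pseudoregulus_L0_def by (auto simp: image_image)
qed

section \<open>Pseudoregulus type, transversal points and the form of the vertex\<close>

context vertex_projection
begin

text \<open>Linear representatives of the projectivities in \<open>pseudoregulus_type\<close>, so
  that they can be composed with \<open>\<pi>\<close>.\<close>

definition matches :: "('a ^ 2 \<Rightarrow> 'a ^ 2) \<Rightarrow> bool"
  where "matches B \<longleftrightarrow> Vector_Spaces.linear (*s) (*s) B \<and> bij B \<and> (\<lambda>P. B ` P) ` pseudoregulus_L0 q = L"

lemma L0_points: "P \<in> pseudoregulus_L0 q \<Longrightarrow> P \<in> (pg_points (*s) :: ('a ^ 2) set set)"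
  unfolding pseudoregulus_L0_def by (auto simp: vec_eq_iff forall_2 intro!: vec.point_of_in_pg_points)

lemma PGL_matches:
  "{\<rho> \<in> PGL. \<rho> ` pseudoregulus_L0 q = L} = (\<lambda>B. restrict (\<lambda>P. B ` P) (pg_points (*s))) ` Collect matches"
proof -
  have eq: "restrict (\<lambda>P. B ` P) (pg_points (*s)) ` pseudoregulus_L0 q = (\<lambda>P. B ` P) ` pseudoregulus_L0 q"
    for B :: "'a ^ 2 \<Rightarrow> 'a ^ 2"
    using L0_points by (intro image_cong) auto
  have "{\<rho> \<in> PGL. \<rho> ` pseudoregulus_L0 q = L} = (\<lambda>B. restrict (\<lambda>P. B ` P) (pg_points (*s))) `
      {B. Vector_Spaces.linear (*s) (*s) B \<and> bij B \<and>
        restrict (\<lambda>P. B ` P) (pg_points (*s)) ` pseudoregulus_L0 q = L}"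
    unfolding PGL_def by blast
  moreover have "Collect matches = {B. Vector_Spaces.linear (*s) (*s) B \<and> bij B \<and>
      (\<lambda>P. B ` P) ` pseudoregulus_L0 q = L}"
    by (intro arg_cong[of _ _ Collect] ext) (simp only: matches_def)
  ultimately show ?thesis by (simp only: eq)
qed

definition presents :: "nat \<Rightarrow> ('a ^ 'n \<Rightarrow> 'a) \<Rightarrow> bool"
  where "presents s v \<longleftrightarrow> s < t \<and> coprime s t \<and> admissible v \<and> vertex s v = U"

lemma linear_functional_component:
  assumes "Vector_Spaces.linear (*s) (*s) (f :: 'a ^ 'n \<Rightarrow> 'a ^ 2)"
  shows "functional (\<lambda>x. f x $ j)"
proof -
  interpret f: Vector_Spaces.linear "(*s)" "(*s)" f by (fact assms)
  show ?thesis by (simp add: functional_def f.add f.scale)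
qed

text \<open>The inverse \<open>A\<close> of \<open>B\<close> moves \<open>L\<close> back to the
  standard set, so the two coordinates of \<open>A (\<pi> w)\<close> on \<open>W\<close> have the
  quotients required by \<open>vertex_of_quotients\<close>. The points \<open>(1, 0)\<close> and
  \<open>(0, 1)\<close> are the zeros of the second and the first coordinate, hence of
  \<open>v\<close> and \<open>twist s v\<close>.\<close>

lemma presents_of_matches:
  assumes B: "matches B"
  shows "\<exists>s v. presents s v \<and> B ` vec.span {vector [1, 0]} = {y. v (\<psi> y) = 0} \<and>
    B ` vec.span {vector [0, 1]} = {y. twist s v (\<psi> y) = 0}"
proof -
  from B have lin: "Vector_Spaces.linear (*s) (*s) B" and bij: "bij B"
    and img: "(\<lambda>P. B ` P) ` pseudoregulus_L0 q = L" by (auto simp: matches_def)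
  interpret B: Vector_Spaces.linear "(*s)" "(*s)" B by (fact lin)
  obtain A where A: "Vector_Spaces.linear (*s) (*s) A" "\<And>x. A (B x) = x" "\<And>x. B (A x) = x"
  proof
    show "Vector_Spaces.linear (*s) (*s) (inv_into UNIV B)"
      by (rule vec.inj_linear_imp_inv_linear[OF lin bij_is_inj[OF bij]])
  qed (use bij in \<open>simp_all add: bij_is_inj bij_is_surj surj_f_inv_f\<close>)
  interpret A: Vector_Spaces.linear "(*s)" "(*s)" A by (fact A(1))
  define g where "g x = A (\<pi> x)" for x
  have g_lin: "Vector_Spaces.linear (*s) (*s) g"
    by unfold_locales (simp_all add: g_def pi.add pi.scale A.add A.scale)
  have g0: "g x = 0 \<longleftrightarrow> x \<in> U" for x
    using A(2,3) A.zero B.zero pi_eq_0_iff by (metis g_def)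
  have "(\<lambda>P. A ` P) ` L = pseudoregulus_L0 q"
    unfolding img[symmetric] by (simp add: image_image A(2))
  hence gL: "(\<lambda>w. vec.span {g w}) ` (W - {0}) = pseudoregulus_L0 q"
    by (simp add: L_def image_image linear_image_span_singleton[OF A(1)] g_def)
  have gw: "g w \<noteq> 0" if "w \<in> W" "w \<noteq> 0" for w using that g0 U_W by auto
  have 1: "g w $ 1 \<noteq> 0 \<and> g w $ 2 / g w $ 1 \<in> frob_quot 1 ` (- {0})" if w: "w \<in> W" "w \<noteq> 0" for w
  proof -
    have "vec.span {g w} \<in> pseudoregulus_L0 q" using w gL by blast
    then obtain y where "y \<in> frob_quot 1 ` (- {0})" "vec.span {g w} = vec.span {vector [1, y]}"
      unfolding pseudoregulus_L0_eq by blast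
    thus ?thesis using point_2_eq_iff[OF gw[OF w]] by auto
  qed
  have quot: "(\<lambda>w. g w $ 2 / g w $ 1) ` (W - {0}) = frob_quot 1 ` (- {0})"
  proof (intro equalityI subsetI)
    fix y assume y: "y \<in> frob_quot 1 ` (- {0::'a})"
    hence "vec.span {vector [1, y] :: 'a ^ 2} \<in> (\<lambda>w. vec.span {g w}) ` (W - {0})"
      unfolding gL pseudoregulus_L0_eq by (rule imageI)
    then obtain w where w: "w \<in> W" "w \<noteq> 0" "vec.span {g w} = vec.span {vector [1, y]}" by auto
    hence "g w $ 2 / g w $ 1 = y" using point_2_eq_iff[OF gw[OF w(1,2)]] by auto
    thus "y \<in> (\<lambda>w. g w $ 2 / g w $ 1) ` (W - {0})" using w by blast
  qed (use 1 in blast)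
  have "g w $ 1 \<noteq> 0" if "w \<in> W" "w \<noteq> 0" for w using 1 that by blast
  from vertex_of_quotients[OF linear_functional_component[OF g_lin] linear_functional_component[OF g_lin] this quot]
  obtain s v where sv: "s < t" "coprime s t" "admissible v"
    and ker: "{x. v x = 0} = {x. g x $ 2 = 0}" "{x. twist s v x = 0} = {x. g x $ 1 = 0}"
    by blast
  have v0: "v x = 0 \<longleftrightarrow> g x $ 2 = 0" "twist s v x = 0 \<longleftrightarrow> g x $ 1 = 0" for x
    using ker by blast+
  have "vertex s v = U"
    unfolding vertex_twist v0 using g0 by (auto simp: vec_eq_iff forall_2)
  hence pres: "presents s v" using sv by (simp add: presents_def)
  have comp: "g (\<psi> (B z)) = z" for z by (simp add: g_def pi_psi A(2))
  have "B ` vec.span {vector [1, 0]} = {y. v (\<psi> y) = 0}"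
  proof (intro equalityI subsetI)
    fix y assume "y \<in> {y. v (\<psi> y) = 0}"
    hence "A y $ 2 = 0" by (simp add: v0 g_def pi_psi)
    hence "A y = A y $ 1 *s vector [1, 0]" by (auto simp: vec_eq_iff forall_2)
    hence "A y \<in> vec.span {vector [1, 0]}" by (auto simp: vec.span_singleton)
    thus "y \<in> B ` vec.span {vector [1, 0]}" using A(3) by (metis imageI)
  qed (auto simp: vec.span_singleton v0 comp)
  moreover have "B ` vec.span {vector [0, 1]} = {y. twist s v (\<psi> y) = 0}"
  proof (intro equalityI subsetI)
    fix y assume "y \<in> {y. twist s v (\<psi> y) = 0}"
    hence "A y $ 1 = 0" by (simp add: v0 g_def pi_psi)
    hence "A y = A y $ 2 *s vector [0, 1]" by (auto simp: vec_eq_iff forall_2)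
    hence "A y \<in> vec.span {vector [0, 1]}" by (auto simp: vec.span_singleton)
    thus "y \<in> B ` vec.span {vector [0, 1]}" using A(3) by (metis imageI)
  qed (auto simp: vec.span_singleton v0 comp)
  ultimately show ?thesis using pres by blast
qed

text \<open>The pair \<open>g\<close> of functionals \<open>twist s v\<close> and \<open>v\<close>
  has kernel \<open>U\<close>, as does \<open>\<pi>\<close>, so the two differ by a linear bijection
  \<open>B\<close> of the coordinate plane, and the slopes of \<open>g\<close> on \<open>W\<close>
  are those of the standard set.\<close>

lemma matches_of_presents:
  assumes "presents s v"
  shows "\<exists>B. matches B"
proof -
  from assms have s: "s \<le> t" "coprime s t" and v: "admissible v" and U: "vertex s v = U"
    by (auto simp: presents_def)
  note fv = admissible_functional[OF v] and ft = functional_twist[OF s(1) admissible_functional[OF v]]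
  define g :: "'a ^ 'n \<Rightarrow> 'a ^ 2" where "g x = vector [twist s v x, v x]" for x
  have g12: "g x $ 1 = twist s v x" "g x $ 2 = v x" for x by (simp_all add: g_def)
  have g_add: "g (x + y) = g x + g y" for x y
    by (simp add: vec_eq_iff forall_2 g12 functional_add[OF fv] functional_add[OF ft])
  have g_scale: "g (c *s x) = c *s g x" for c x
    by (simp add: vec_eq_iff forall_2 g12 functional_scale[OF fv] functional_scale[OF ft])
  have g0: "g x = 0 \<longleftrightarrow> x \<in> U" for x
    unfolding U[symmetric] by (auto simp: vec_eq_iff forall_2 g12 vertex_twist)
  define A where "A y = g (\<psi> y)" for y
  have A_lin: "Vector_Spaces.linear (*s) (*s) A"
    by unfold_locales (simp_all add: A_def psi.add psi.scale g_add g_scale)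
  interpret A: Vector_Spaces.linear "(*s)" "(*s)" A by (fact A_lin)
  have "inj A"
  proof (subst A.inj_iff_eq_0, intro allI impI)
    fix y assume "A y = 0"
    hence "\<pi> (\<psi> y) = 0" unfolding A_def g0 pi_eq_0_iff .
    thus "y = 0" by (simp add: pi_psi)
  qed
  define B where "B = inv_into UNIV A"
  have B: "Vector_Spaces.linear (*s) (*s) B"
    unfolding B_def by (rule vec.inj_linear_imp_inv_linear[OF A_lin \<open>inj A\<close>])
  have "surj A" using \<open>inj A\<close> by (simp add: finite_UNIV_inj_surj)
  hence bijB: "bij B" using \<open>inj A\<close> unfolding B_def by (intro bij_imp_bij_inv) (simp add: bij_def)
  have Bg: "B (g x) = \<pi> x" for x
  proof -
    have "g (x - \<psi> (\<pi> x)) = 0" using pi_defect by (simp add: g0)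
    moreover have "g x = g (x - \<psi> (\<pi> x)) + g (\<psi> (\<pi> x))" by (simp flip: g_add)
    ultimately have "g x = A (\<pi> x)" by (simp add: A_def)
    thus ?thesis by (simp add: B_def inv_f_f[OF \<open>inj A\<close>])
  qed
  have point: "vec.span {g w} = vec.span {vector [1, v w / twist s v w]}" if "w \<in> W" "w \<noteq> 0" for w
  proof -
    have "g w \<noteq> 0" using that U_W g0 by auto
    thus ?thesis using quotients_of_vertex(2)[OF s(2,1) v that] by (subst point_2_eq_iff) (simp_all add: g12)
  qed
  have "pseudoregulus_L0 q = (\<lambda>w. vec.span {vector [1, v w / twist s v w] :: 'a ^ 2}) ` (W - {0})"
    unfolding pseudoregulus_L0_eq quotients_of_vertex(1)[OF s(2,1) v, symmetric] image_image ..
  also have "\<dots> = (\<lambda>w. vec.span {g w}) ` (W - {0})"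
    using point by (intro image_cong) auto
  finally have "(\<lambda>P. B ` P) ` pseudoregulus_L0 q = L"
    by (simp add: image_image linear_image_span_singleton[OF B] Bg L_def)
  thus ?thesis using B bijB unfolding matches_def by blast
qed

lemma presents_unique:
  assumes p: "presents s v" "presents s' v'"
  shows "s = s' \<and> {x. v x = 0} = {x. v' x = 0} \<and> {x. twist s v x = 0} = {x. twist s' v' x = 0} \<or>
    s \<noteq> s' \<and> {x. v x = 0} = {x. twist s' v' x = 0} \<and> {x. twist s v x = 0} = {x. v' x = 0}"
  using p by (intro vertex_unique) (auto simp: presents_def)

lemma pseudoregulus_type_iff: "pseudoregulus_type q L \<longleftrightarrow> (\<exists>s v. presents s v)"
proof -
  have "pseudoregulus_type q L \<longleftrightarrow> {\<rho> \<in> PGL. \<rho> ` pseudoregulus_L0 q = L} \<noteq> {}"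
    by (auto simp: pseudoregulus_type_def)
  also have "\<dots> \<longleftrightarrow> (\<exists>B. matches B)" unfolding PGL_matches by auto
  also have "\<dots> \<longleftrightarrow> (\<exists>s v. presents s v)"
  proof
    assume "\<exists>B. matches B"
    then obtain B where "matches B" ..
    from presents_of_matches[OF this] show "\<exists>s v. presents s v" by (elim exE conjE) (intro exI)
  next
    assume "\<exists>s v. presents s v"
    then obtain s v where "presents s v" by (elim exE)
    thus "\<exists>B. matches B" by (rule matches_of_presents)
  qed
  finally show ?thesis .
qed

text \<open>Each admissible projectivity comes with its own presentation, but by
  \<open>presents_unique\<close> its two kernels are those of \<open>v\<close> and
  \<open>twist s v\<close>, possibly exchanged; the union in the definition therefore has only two
  members.\<close>

lemma transversal_points_eq:
  assumes p: "presents s v"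
  shows "transversal_points q L = {{y. v (\<psi> y) = 0}, {y. twist s v (\<psi> y) = 0}}"
proof -
  have e: "vec.span {vector [1, 0] :: 'a ^ 2} \<in> pg_points (*s)" "vec.span {vector [0, 1] :: 'a ^ 2} \<in> pg_points (*s)"
    by (auto simp: vec_eq_iff forall_2 intro!: vec.point_of_in_pg_points)
  have pair: "{B ` vec.span {vector [1, 0]}, B ` vec.span {vector [0, 1]}} =
      {{y. v (\<psi> y) = 0}, {y. twist s v (\<psi> y) = 0}}" if B: "matches B" for B
  proof -
    obtain s' v' where sv': "presents s' v'" "B ` vec.span {vector [1, 0]} = {y. v' (\<psi> y) = 0}"
        "B ` vec.span {vector [0, 1]} = {y. twist s' v' (\<psi> y) = 0}"
      using presents_of_matches[OF B] by blast
    from presents_unique[OF p sv'(1)] have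
      "(\<forall>x. v x = 0 \<longleftrightarrow> v' x = 0) \<and> (\<forall>x. twist s v x = 0 \<longleftrightarrow> twist s' v' x = 0) \<or>
       (\<forall>x. v x = 0 \<longleftrightarrow> twist s' v' x = 0) \<and> (\<forall>x. twist s v x = 0 \<longleftrightarrow> v' x = 0)"
      by blast
    thus ?thesis unfolding sv'(2,3) by (elim disjE conjE) (simp_all add: insert_commute)
  qed
  have "transversal_points q L = (\<Union>B\<in>Collect matches. {B ` vec.span {vector [1, 0]}, B ` vec.span {vector [0, 1]}})"
    unfolding transversal_points_def PGL_matches using e by simp
  also have "\<dots> = (\<Union>B\<in>Collect matches. {{y. v (\<psi> y) = 0}, {y. twist s v (\<psi> y) = 0}})"
    using pair by (intro SUP_cong) auto
  also have "\<dots> = {{y. v (\<psi> y) = 0}, {y. twist s v (\<psi> y) = 0}}"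
    using matches_of_presents[OF p] by auto
  finally show ?thesis .
qed

lemma card_L:
  assumes "presents s v"
  shows "card L = (q ^ t - 1) div (q - 1)"
proof -
  obtain B :: "'a ^ 2 \<Rightarrow> 'a ^ 2" where "matches B" using matches_of_presents[OF assms] by blast
  hence B: "bij B" "(\<lambda>P. B ` P) ` pseudoregulus_L0 q = L" by (simp_all add: matches_def)
  have "inj (\<lambda>P. B ` P)" using bij_is_inj[OF B(1)] by (auto simp: inj_def inj_image_eq_iff)
  hence "card L = card (pseudoregulus_L0 q :: ('a ^ 2) set set)"
    unfolding B(2)[symmetric] by (intro card_image) (auto intro: inj_on_subset)
  also have "inj (\<lambda>y :: 'a. vec.span {vector [1, y] :: 'a ^ 2})"
  proof (rule injI)
    fix y z :: 'a assume eq: "vec.span {vector [1, y] :: 'a ^ 2} = vec.span {vector [1, z]}"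
    have "(vector [1, y] :: 'a ^ 2) \<noteq> 0" by (auto simp: vec_eq_iff forall_2)
    thus "y = z" using point_2_eq_iff[of "vector [1, y] :: 'a ^ 2" z] eq by simp
  qed
  hence "card (pseudoregulus_L0 q :: ('a ^ 2) set set) = card (frob_quot 1 ` (- {0}))"
    unfolding pseudoregulus_L0_eq by (intro card_image) (auto intro: inj_on_subset)
  finally show ?thesis by (simp add: card_frob_quot)
qed

end

section \<open>Linear sets and hyperplanes over the subfield\<close>

lemma (in Vector_Spaces.linear) dim_injective_image:
  assumes V: "vs1.subspace V" and inj: "inj_on f V"
  shows "vs2.dim (f ` V) = vs1.dim V"
proof -
  obtain B where B: "B \<subseteq> V" "vs1.independent B" "V \<subseteq> vs1.span B" "card B = vs1.dim V"
    using vs1.basis_exists by metis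
  have span: "vs1.span B = V" using B V by (simp add: vs1.span_subspace)
  have "vs2.independent (f ` B)"
    using B(2) inj by (intro independent_injective_image) (simp_all add: span)
  hence "vs2.dim (vs2.span (f ` B)) = card (f ` B)" by (rule vs2.dim_span_eq_card_independent)
  also have "card (f ` B) = card B" using inj B(1) by (intro card_image) (rule inj_on_subset)
  finally show ?thesis by (simp add: span_image span B(4))
qed

lemma sub_scale_finite_dimensional:
  assumes "field_embedding (emb :: 'k::field \<Rightarrow> 'a::{field,finite})"
  shows "\<exists>B. finite_dimensional_vector_space (sub_scale emb :: 'k \<Rightarrow> 'a ^ 'n \<Rightarrow> 'a ^ 'n) B"
proof -
  interpret sub: vector_space "sub_scale emb :: 'k \<Rightarrow> 'a ^ 'n \<Rightarrow> 'a ^ 'n"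
    using assms by (rule vector_space_sub_scale)
  obtain B :: "('a ^ 'n) set" where "sub.independent B" "UNIV \<subseteq> sub.span B"
    using sub.maximal_independent_subset[of UNIV] by blast
  hence "finite_dimensional_vector_space (sub_scale emb :: 'k \<Rightarrow> 'a ^ 'n \<Rightarrow> 'a ^ 'n) B"
    by unfold_locales auto
  thus ?thesis by blast
qed

lemma sub_scale_subspace:
  assumes emb: "field_embedding emb" and U: "vec.subspace U"
  shows "module.subspace (sub_scale emb) U"
proof -
  interpret sub: vector_space "sub_scale emb" using emb by (rule vector_space_sub_scale)
  show ?thesis
    by (rule sub.subspaceI) (auto simp: sub_scale_def vec.subspace_0[OF U] vec.subspace_add[OF U] vec.subspace_scale[OF U])
qed

lemma sub_scale_span_subset:
  assumes "field_embedding emb"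
  shows "module.span (sub_scale emb) S \<subseteq> vec.span S"
proof -
  interpret sub: vector_space "sub_scale emb" using assms by (rule vector_space_sub_scale)
  show ?thesis
    by (intro sub.span_minimal vec.span_superset sub_scale_subspace[OF assms] vec.subspace_span)
qed

context vertex_projection
begin

text \<open>\<open>\<pi>\<close> is injective on \<open>W\<close> because its kernel meets
  \<open>W\<close> trivially, so the image of \<open>W\<close> is a subspace over the small field of
  dimension \<open>t\<close>, and it defines the linear set.\<close>

lemma linear_set_L:
  fixes emb :: "'k::field \<Rightarrow> 'a"
  assumes emb: "field_embedding emb"
    and W: "module.subspace (sub_scale emb) W" "vector_space.dim (sub_scale emb) W = t"
  shows "linear_set emb t L"
proof -
  interpret sub: vector_space "sub_scale emb :: 'k \<Rightarrow> 'a ^ 'n \<Rightarrow> 'a ^ 'n"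
    using emb by (rule vector_space_sub_scale)
  interpret sub2: vector_space "sub_scale emb :: 'k \<Rightarrow> 'a ^ 2 \<Rightarrow> 'a ^ 2"
    using emb by (rule vector_space_sub_scale)
  interpret lin: Vector_Spaces.linear "sub_scale emb :: 'k \<Rightarrow> 'a ^ 'n \<Rightarrow> 'a ^ 'n" "sub_scale emb" \<pi>
    by unfold_locales (simp_all add: pi.add pi.scale sub_scale_def)
  have "inj_on \<pi> W"
  proof (rule inj_onI)
    fix w w' assume w: "w \<in> W" "w' \<in> W" "\<pi> w = \<pi> w'"
    have "w - w' \<in> W" by (rule sub.subspace_diff[OF W(1) w(1,2)])
    moreover have "\<pi> (w - w') = 0" using w(3) by (simp add: pi.diff)
    ultimately have "w - w' = 0" using pi_W_nonzero by blast
    thus "w = w'" by simp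
  qed
  hence dim: "sub2.dim (\<pi> ` W) = t" using lin.dim_injective_image[OF W(1)] W(2) by simp
  have sub: "sub2.subspace (\<pi> ` W)" by (rule lin.subspace_image[OF W(1)])
  let ?S = "points_in (sub_scale emb :: 'k \<Rightarrow> 'a ^ 2 \<Rightarrow> 'a ^ 2) (\<pi> ` W)"
  have "L = {P \<in> pg_points (*s). field_reduction emb P \<inter> ?S \<noteq> {}}"
  proof (intro equalityI subsetI)
    fix P assume "P \<in> L"
    then obtain w where w: "w \<in> W" "w \<noteq> 0" "P = vec.span {\<pi> w}" by (auto simp: L_def)
    have nz: "\<pi> w \<noteq> 0" by (rule pi_W_nonzero[OF w(1,2)])
    have "sub2.span {\<pi> w} \<in> ?S" unfolding sub2.points_in_iff[OF sub] using w nz by blast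
    moreover have "sub2.span {\<pi> w} \<in> field_reduction emb P"
      using sub_scale_span_subset[OF emb] sub2.point_of_in_pg_points[OF nz]
      by (auto simp: field_reduction_def points_in_def w(3))
    moreover have "P \<in> pg_points (*s)" using nz by (simp add: w(3) vec.point_of_in_pg_points)
    ultimately show "P \<in> {P \<in> pg_points (*s). field_reduction emb P \<inter> ?S \<noteq> {}}" by blast
  next
    fix P assume "P \<in> {P \<in> pg_points (*s). field_reduction emb P \<inter> ?S \<noteq> {}}"
    then obtain Q where P: "P \<in> pg_points (*s)" and Q: "Q \<subseteq> P" "Q \<in> ?S"
      by (auto simp: field_reduction_def points_in_def)
    then obtain w where w: "w \<in> W" "\<pi> w \<noteq> 0" "Q = sub2.span {\<pi> w}"
      unfolding sub2.points_in_iff[OF sub] by blast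
    have "\<pi> w \<in> P" using Q(1) w(3) sub2.span_base[of "\<pi> w" "{\<pi> w}"] by blast
    hence "P = vec.span {\<pi> w}" using P w(2) vec.span_singleton_eq by (auto simp: vec.pg_points_iff)
    moreover have "w \<noteq> 0" using w(2) pi.zero by metis
    ultimately show "P \<in> L" using w(1) by (auto simp: L_def)
  qed
  moreover have "psubspace (sub_scale emb) ?S" unfolding psubspace_def using sub by blast
  moreover have "pdim (sub_scale emb) ?S = int t - 1" by (simp add: sub2.pdim_points_in[OF sub] dim)
  ultimately show ?thesis unfolding linear_set_def by blast
qed

text \<open>The span of points of \<open>\<Sigma>\<close> is stable under the powers of
  \<open>\<phi>\<close>. If it contained the vertex it would be the whole space, but a hyperplane of
  the subgeometry spans dimension at most \<open>t - 1\<close>.\<close>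

lemma vertex_not_in_hyperplane:
  fixes emb :: "'k::field \<Rightarrow> 'a"
  assumes emb: "field_embedding emb" and \<Sigma>: "\<Sigma> = point_of ` (W - {0})"
    and pres: "presents s v" and H: "subgeometry_hyperplane emb \<Sigma> H"
  shows "\<not> points_in (*s) U \<subseteq> pspan (*s) H"
proof
  assume sub: "points_in (*s) U \<subseteq> pspan (*s) H"
  from pres have s: "coprime s t" and v: "admissible v" and U: "vertex s v = U"
    by (auto simp: presents_def)
  interpret sub: vector_space "sub_scale emb :: 'k \<Rightarrow> 'a ^ 'n \<Rightarrow> 'a ^ 'n"
    using emb by (rule vector_space_sub_scale)
  \<comment> \<open>The hyperplane may be given in another space \<open>W'\<close> that defines
    \<open>\<Sigma>\<close>; what is carried over to \<open>W\<close> is that \<open>H\<close>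
    consists of points of \<open>\<Sigma>\<close>.\<close>
  obtain W' U' where W': "subgeometry_of emb W' \<Sigma>" "U' \<subseteq> W'" "sub.dim U' = CARD('n) - 1"
    and H_eq: "H = point_of ` (U' - {0})"
    using H by (auto simp: subgeometry_hyperplane_def)
  have H\<Sigma>: "H \<subseteq> \<Sigma>" using W' by (auto simp: H_eq subgeometry_of_def)
  let ?X = "vec.span (\<Union>H)"
  obtain B where B: "B \<subseteq> U'" "sub.independent B" "U' \<subseteq> sub.span B" "card B = sub.dim U'"
    using sub.basis_exists by metis
  have "\<Union>H \<subseteq> vec.span B"
    using B(3) sub_scale_span_subset[OF emb, of B]
    unfolding H_eq by (auto simp: vec.span_singleton intro!: vec.span_scale)
  hence "?X \<subseteq> vec.span B" by (intro vec.span_minimal) auto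
  hence "vec.dim ?X \<le> card B" by (intro vec.dim_le_card) auto
  moreover have "?X = UNIV"
  proof (rule stable_subspace_containing_vertex[OF s v])
    show "(\<phi> ^^ s) x \<in> ?X" if "x \<in> ?X" for x
      using that
    proof (induction rule: vec.span_induct_alt)
      case (step c x y)
      then obtain P where P: "P \<in> H" "x \<in> P" by blast
      then obtain w where w: "w \<in> W" "P = vec.span {w}" using H\<Sigma> by (auto simp: \<Sigma>)
      have "(\<phi> ^^ s) ` P = P" by (simp add: w iter_image_span iter_W)
      hence "(\<phi> ^^ s) x \<in> \<Union>H" using P by blast
      thus ?case using step by (simp add: iter_add iter_scale vec.span_add vec.span_scale vec.span_base)
    qed (simp add: iter_0 vec.span_zero)
    have "U \<subseteq> ?X"
      using sub by (simp add: pspan_def vec.points_in_subset_iff[OF U_subspace vec.subspace_span])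
    thus "vertex s v \<subseteq> ?X" by (simp add: U)
  qed simp
  ultimately have "vec.dim (UNIV :: ('a ^ 'n) set) \<le> t - 1" using B(4) W'(3) card_n by simp
  thus False using card_n t_ge_3 by (simp add: card_cart_basis)
qed

text \<open>If \<open>u\<close> were nonzero at \<open>w0\<close> in \<open>W\<close>, its kernel in
  \<open>W\<close> would have codimension 1 over the small field, as the ratios
  \<open>u w / u w0\<close> lie in that field. Every \<open>x\<close> is a multiple of
  \<open>w0\<close> with factor \<open>u x / u w0\<close>, plus a vector in the span of that kernel;
  for \<open>x\<close> in \<open>U\<close> the factor is 0, so the hyperplane would contain the
  vertex.\<close>

lemma functional_vanishes_unless_hyperplane:
  fixes emb :: "'k::{field,finite} \<Rightarrow> 'a"
  assumes emb: "field_embedding emb" and q: "CARD('k) = q" and W: "subgeometry_of emb W \<Sigma>"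
    and noH: "\<And>H. subgeometry_hyperplane emb \<Sigma> H \<Longrightarrow> \<not> points_in (*s) U \<subseteq> pspan (*s) H"
    and u: "functional u" "\<forall>x\<in>U. u x = 0" "\<forall>w\<in>W. u w ^ q = u w"
  shows "\<forall>w\<in>W. u w = 0"
proof (rule ccontr)
  assume "\<not> ?thesis"
  then obtain w0 where w0: "w0 \<in> W" "u w0 \<noteq> 0" by blast
  obtain Bs where "finite_dimensional_vector_space (sub_scale emb :: 'k \<Rightarrow> 'a ^ 'n \<Rightarrow> 'a ^ 'n) Bs"
    using sub_scale_finite_dimensional[OF emb] by blast
  then interpret sub: finite_dimensional_vector_space "sub_scale emb :: 'k \<Rightarrow> 'a ^ 'n \<Rightarrow> 'a ^ 'n" Bs .
  have WS: "sub.subspace W" "sub.dim W = CARD('n)" using W by (auto simp: subgeometry_of_def)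
  define U' where "U' = {w \<in> W. u w = 0}"
  have scaleW: "emb k *s w \<in> W" if "w \<in> W" for k w
    using sub.subspace_scale[OF WS(1) that, of k] by (simp add: sub_scale_def)
  have U': "sub.subspace U'"
    unfolding U'_def
    by (rule sub.subspaceI)
      (auto simp: sub.subspace_0[OF WS(1)] sub.subspace_add[OF WS(1)] scaleW
        functional_0[OF u(1)] functional_add[OF u(1)] functional_scale[OF u(1)] sub_scale_def)
  have spanU': "sub.span U' = U'" using U' by (simp add: sub.span_eq_iff)
  have quot: "\<exists>k. u w / u w0 = emb k \<and> w - sub_scale emb k w0 \<in> U'" if w: "w \<in> W" for w
  proof -
    have "(u w / u w0) ^ q = u w / u w0" using u(3) w w0(1) by (simp add: power_divide)
    then obtain k where k: "u w / u w0 = emb k" using range_embedding_eq[OF emb] q by auto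
    have "u (w - sub_scale emb k w0) = 0"
      using w0 by (simp add: sub_scale_def functional_diff[OF u(1)] functional_scale[OF u(1)] flip: k)
    moreover have "w - sub_scale emb k w0 \<in> W"
      by (intro sub.subspace_diff[OF WS(1)] sub.subspace_scale[OF WS(1)] w w0)
    ultimately show ?thesis using k by (auto simp: U'_def)
  qed
  have "W \<subseteq> sub.span (insert w0 U')"
    unfolding sub.span_insert spanU' using quot by blast
  moreover have "sub.span (insert w0 U') \<subseteq> W"
    using w0 WS(1) by (intro sub.span_minimal) (auto simp: U'_def)
  ultimately have "sub.span (insert w0 U') = W" by blast
  hence "sub.dim (insert w0 U') = CARD('n)" using sub.dim_span[of "insert w0 U'"] WS(2) by simp
  moreover have "w0 \<notin> U'" using w0 by (simp add: U'_def)
  ultimately have dim: "sub.dim U' = CARD('n) - 1" by (simp add: sub.dim_insert spanU')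
  define H where "H = point_of ` (U' - {0})"
  have "subgeometry_hyperplane emb \<Sigma> H"
    unfolding subgeometry_hyperplane_def
    by (intro exI[of _ W] exI[of _ U']) (use W U' dim in \<open>auto simp: H_def U'_def\<close>)
  moreover have "U \<subseteq> vec.span (\<Union>H)"
  proof
    fix x assume x: "x \<in> U"
    have HU': "w \<in> vec.span (\<Union>H)" if "w \<in> U'" for w
    proof (cases "w = 0")
      case False
      hence "w \<in> \<Union>H" using that vec.span_base[of w "{w}"] by (auto simp: H_def)
      thus ?thesis by (rule vec.span_base)
    qed (simp add: vec.span_zero)
    have "x \<in> vec.span W" by (simp add: span_W)
    hence "x - (u x / u w0) *s w0 \<in> vec.span (\<Union>H)"
    proof (induction rule: vec.span_induct_alt)
      case (step c w y)
      have "w - (u w / u w0) *s w0 \<in> vec.span (\<Union>H)"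
        using quot[OF step(1)] HU' by (auto simp: sub_scale_def)
      hence "c *s (w - (u w / u w0) *s w0) + (y - (u y / u w0) *s w0) \<in> vec.span (\<Union>H)"
        using step by (intro vec.span_add vec.span_scale)
      thus ?case
        by (simp add: functional_add[OF u(1)] functional_scale[OF u(1)] algebra_simps
            vec.scale_right_diff_distrib vec.scale_left_distrib add_divide_distrib)
    qed (simp add: functional_0[OF u(1)] vec.span_zero)
    thus "x \<in> vec.span (\<Union>H)" using u(2) x by simp
  qed
  hence "points_in (*s) U \<subseteq> pspan (*s) H" by (auto simp: pspan_def points_in_def)
  ultimately show False using noH by blast
qed

text \<open>For \<open>t = 3\<close> the right side means that the vertex, a point, is moved, and
  the left side that the empty set has dimension \<open>- 1\<close>.\<close>

lemma pdim_vertex_Int: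
  "pdim (*s) (points_in (*s) U \<inter> coll s ` points_in (*s) U) = int t - 4 \<longleftrightarrow>
    vec.dim (U \<inter> (\<phi> ^^ s) ` U) = t - 3"
proof -
  have "coll s ` points_in (*s) U = (\<lambda>P. (\<phi> ^^ s) ` P) ` points_in (*s) U"
    by (intro image_cong) (auto simp: coll_apply points_in_def)
  hence "points_in (*s) U \<inter> coll s ` points_in (*s) U = points_in (*s) (U \<inter> (\<phi> ^^ s) ` U)"
    by (simp add: iter_image_points_in[OF U_subspace] points_in_Int)
  moreover have "vec.subspace (U \<inter> (\<phi> ^^ s) ` U)"
    by (intro vec.subspace_inter U_subspace subspace_iter_image)
  ultimately show ?thesis using t_ge_3 by (simp add: vec.pdim_points_in) linarith
qed

lemma presents_iff_intersection:
  fixes emb :: "'k::{field,finite} \<Rightarrow> 'a"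
  assumes emb: "field_embedding emb" and q: "CARD('k) = q" and W: "subgeometry_of emb W \<Sigma>"
  shows "(\<exists>s v. presents s v) \<longleftrightarrow>
    (\<exists>\<sigma>. stabilizer_generator \<Sigma> \<sigma> \<and>
      pdim (*s) (points_in (*s) U \<inter> \<sigma> ` points_in (*s) U) = int t - 4) \<and>
    (\<forall>H. subgeometry_hyperplane emb \<Sigma> H \<longrightarrow> \<not> points_in (*s) U \<subseteq> pspan (*s) H)"
proof -
  have \<Sigma>: "\<Sigma> = point_of ` (W - {0})" using W by (simp add: subgeometry_of_def)
  show ?thesis
  proof (intro iffI conjI allI impI)
    assume "\<exists>s v. presents s v"
    then obtain s v where p: "presents s v" by (elim exE)
    hence s: "s < t" "coprime s t" and v: "admissible v" "vertex s v = U" by (auto simp: presents_def)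
    have "vec.dim (U \<inter> (\<phi> ^^ s) ` U) = t - 3"
      using dim_vertex_Int[OF s(2) v(1)] v(2) U_dim by simp
    moreover have "stabilizer_generator \<Sigma> (coll s)" using s stabilizer_generator_iff[OF \<Sigma>] by blast
    ultimately show "\<exists>\<sigma>. stabilizer_generator \<Sigma> \<sigma> \<and>
        pdim (*s) (points_in (*s) U \<inter> \<sigma> ` points_in (*s) U) = int t - 4"
      using pdim_vertex_Int by blast
    show "\<not> points_in (*s) U \<subseteq> pspan (*s) H" if "subgeometry_hyperplane emb \<Sigma> H" for H
      by (rule vertex_not_in_hyperplane[OF emb \<Sigma> p that])
  next
    assume ii: "(\<exists>\<sigma>. stabilizer_generator \<Sigma> \<sigma> \<and>
        pdim (*s) (points_in (*s) U \<inter> \<sigma> ` points_in (*s) U) = int t - 4) \<and>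
      (\<forall>H. subgeometry_hyperplane emb \<Sigma> H \<longrightarrow> \<not> points_in (*s) U \<subseteq> pspan (*s) H)"
    then obtain \<sigma> where \<sigma>: "stabilizer_generator \<Sigma> \<sigma>"
      "pdim (*s) (points_in (*s) U \<inter> \<sigma> ` points_in (*s) U) = int t - 4" by blast
    then obtain s where s: "s < t" "coprime s t" "\<sigma> = coll s"
      unfolding stabilizer_generator_iff[OF \<Sigma>] by blast
    have dim: "vec.dim (U \<inter> (\<phi> ^^ s) ` U) = t - 3" using \<sigma>(2) pdim_vertex_Int by (simp add: s(3))
    have "\<exists>v. admissible v \<and> vertex s v = U"
    proof (rule vertex_of_intersection[OF s(2) U_subspace U_dim U_W dim])
      fix u :: "'a ^ 'n \<Rightarrow> 'a"
      assume "functional u" "\<forall>x\<in>U. u x = 0" "\<forall>w\<in>W. u w ^ q = u w"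
      thus "\<forall>w\<in>W. u w = 0"
        using functional_vanishes_unless_hyperplane[OF emb q W] ii by blast
    qed
    thus "\<exists>s v. presents s v" using s by (auto simp: presents_def)
  qed
qed

section \<open>Uniqueness of the generating point, and the transversal points as joins\<close>

lemma generating_point_presents:
  assumes \<Sigma>: "\<Sigma> = point_of ` (W - {0})"
  shows "stabilizer_generator \<Sigma> \<sigma> \<and> generating_point (points_in (*s) U) \<sigma> P \<longleftrightarrow>
    (\<exists>s v. presents s v \<and> \<sigma> = coll s \<and> P = generator_of s v)"
  unfolding stabilizer_generator_iff[OF \<Sigma>] presents_def
  using generating_point_iff[OF _ U_subspace] by blast

text \<open>The collineation determines \<open>s\<close> below \<open>t\<close>, which excludes the
  exchanged case of \<open>presents_unique\<close>; the functionals then have the same kernel and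
  define the same point.\<close>

lemma generating_point_unique:
  assumes \<Sigma>: "\<Sigma> = point_of ` (W - {0})" and gen: "stabilizer_generator \<Sigma> \<sigma>"
    and P: "generating_point (points_in (*s) U) \<sigma> P" "generating_point (points_in (*s) U) \<sigma> P'"
  shows "P = P'"
proof -
  obtain s v where sv: "presents s v" "\<sigma> = coll s" "P = generator_of s v"
    using generating_point_presents[OF \<Sigma>] gen P(1) by blast
  obtain s' v' where sv': "presents s' v'" "\<sigma> = coll s'" "P' = generator_of s' v'"
    using generating_point_presents[OF \<Sigma>] gen P(2) by blast
  have "s mod t = s' mod t" using sv(2) sv'(2) by (intro coll_eq_imp_cong) simp
  hence s: "s = s'" using sv(1) sv'(1) by (simp add: presents_def)
  hence "v x = 0 \<longleftrightarrow> v' x = 0" for x using presents_unique[OF sv(1) sv'(1)] by blast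
  thus ?thesis by (simp add: sv(3) sv'(3) s generator_of_def)
qed

lemma transversal_points_join:
  assumes p: "presents s v"
  defines "A \<equiv> \<psi> ` {y. v (\<psi> y) = 0}" and "B \<equiv> \<psi> ` {y. twist s v (\<psi> y) = 0}"
  shows "A \<noteq> B"
    and "points_in (*s) (range \<psi>) \<inter>
      pspan (*s) (insert ((coll s ^^ (t - 2)) (generator_of s v)) (points_in (*s) U)) = {A}"
    and "points_in (*s) (range \<psi>) \<inter>
      pspan (*s) (insert ((coll s ^^ (t - 1)) (generator_of s v)) (points_in (*s) U)) = {B}"
    and "(\<lambda>T. \<psi> ` T) ` transversal_points q L = {A, B}"
proof -
  from p have s: "coprime s t" and v: "admissible v" and U: "vertex s v = U"
    by (auto simp: presents_def)
  have join: "points_in (*s) (range \<psi>) \<inter> pspan (*s) (insert (vec.span {x}) (points_in (*s) U)) =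
      {\<psi> ` {y. \<psi> y \<in> X}} \<and> (\<exists>y. y \<noteq> 0 \<and> \<psi> y \<in> X)"
    if x: "x \<notin> U" and X: "vec.span (insert x U) = X" for x X
  proof -
    have "\<psi> ` {y. \<psi> y \<in> X} = X \<inter> range \<psi>" by auto
    also have "\<dots> = \<psi> ` vec.span {\<pi> x}" using span_insert_Int_line[of x] X by simp
    finally have eq: "\<psi> ` {y. \<psi> y \<in> X} = \<psi> ` vec.span {\<pi> x}" .
    hence "\<pi> x \<in> {y. \<psi> y \<in> X}"
      unfolding inj_image_eq_iff[OF psi_inj] by (simp add: vec.span_base)
    moreover have "\<pi> x \<noteq> 0" using x by (simp add: pi_eq_0_iff)
    ultimately show ?thesis using pspan_insert_Int_line[OF x] unfolding eq by (auto simp: Int_commute)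
  qed
  obtain x where x: "x \<notin> U" "(coll s ^^ (t - 2)) (generator_of s v) = vec.span {x}"
      "vec.span (insert x U) = {x. v x = 0}"
    using generator_join(1)[OF s v] U by auto
  show "points_in (*s) (range \<psi>) \<inter>
      pspan (*s) (insert ((coll s ^^ (t - 2)) (generator_of s v)) (points_in (*s) U)) = {A}"
    using join[OF x(1,3)] by (simp add: x(2) A_def)
  obtain z where z: "z \<notin> U" "(coll s ^^ (t - 1)) (generator_of s v) = vec.span {z}"
      "vec.span (insert z U) = {x. v ((\<phi> ^^ s) x) = 0}"
    using generator_join(2)[OF s v] U by auto
  show "points_in (*s) (range \<psi>) \<inter>
      pspan (*s) (insert ((coll s ^^ (t - 1)) (generator_of s v)) (points_in (*s) U)) = {B}"
    using join[OF z(1,3)] by (simp add: z(2) B_def twist_eq_0_iff)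
  \<comment> \<open>A nonzero vector over a common point would be killed by both functionals, so it
    would lie in \<open>U\<close>, which the line avoids.\<close>
  show "A \<noteq> B"
  proof
    assume "A = B"
    hence eq: "{y. v (\<psi> y) = 0} = {y. twist s v (\<psi> y) = 0}"
      by (simp add: A_def B_def inj_image_eq_iff[OF psi_inj])
    obtain y where y: "y \<noteq> 0" "v (\<psi> y) = 0" using join[OF x(1,3)] by auto
    hence "\<psi> y \<in> U" using eq by (auto simp: vertex_twist simp flip: U)
    hence "\<pi> (\<psi> y) = 0" by (simp add: pi_eq_0_iff)
    thus False using y(1) by (simp add: pi_psi)
  qed
  show "(\<lambda>T. \<psi> ` T) ` transversal_points q L = {A, B}"
    by (simp add: transversal_points_eq[OF p] A_def B_def)
qed

end

theorem theorem2p3: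
  fixes emb :: "'k::{field,finite} \<Rightarrow> 'a::{field,finite}"
    and q t :: nat
    and \<Sigma> \<Gamma> l0 :: "('a ^ 'n) set set"
    and \<psi> :: "'a ^ 2 \<Rightarrow> 'a ^ 'n"
  assumes "CARD('k) = q" and "q > 2"
    and "CARD('n) = t" and "t \<ge> 3"
    and "CARD('a) = q ^ t"
    and "field_embedding emb"
    and "canonical_subgeometry emb \<Sigma>"
    and "psubspace (*s) \<Gamma>" and "pdim (*s) \<Gamma> = int t - 3"
    and "psubspace (*s) l0" and "pdim (*s) l0 = 1"
    and "\<Sigma> \<inter> \<Gamma> = {}" and "l0 \<inter> \<Gamma> = {}"
    and "line_coordinates \<psi> l0"
  defines "L \<equiv> pull_back \<psi> (projection \<Gamma> l0 \<Sigma>)"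
  defines "cond_i \<equiv> scattered_linear_set emb L \<and> pseudoregulus_type q L"
  defines "cond_ii \<equiv>
      (\<exists>\<sigma>. stabilizer_generator \<Sigma> \<sigma> \<and> pdim (*s) (\<Gamma> \<inter> \<sigma> ` \<Gamma>) = int t - 4) \<and>
      (\<forall>H. subgeometry_hyperplane emb \<Sigma> H \<longrightarrow> \<not> \<Gamma> \<subseteq> pspan (*s) H)"
  defines "cond_iii \<equiv> (\<exists>P \<sigma>. stabilizer_generator \<Sigma> \<sigma> \<and> generating_point \<Gamma> \<sigma> P)"
  shows "(cond_i \<longleftrightarrow> cond_ii) \<and> (cond_ii \<longleftrightarrow> cond_iii) \<and>
    (cond_i \<longrightarrow>
      (\<forall>\<sigma>. stabilizer_generator \<Sigma> \<sigma> \<and> (\<exists>P. generating_point \<Gamma> \<sigma> P) \<longrightarrow>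
        (\<exists>!P. generating_point \<Gamma> \<sigma> P)) \<and>
      (\<forall>\<sigma> P. stabilizer_generator \<Sigma> \<sigma> \<and> generating_point \<Gamma> \<sigma> P \<longrightarrow>
        (\<exists>A B. A \<noteq> B \<and>
          l0 \<inter> pspan (*s) (insert ((\<sigma> ^^ (t - 2)) P) \<Gamma>) = {A} \<and>
          l0 \<inter> pspan (*s) (insert ((\<sigma> ^^ (t - 1)) P) \<Gamma>) = {B} \<and>
          (\<lambda>T. \<psi> ` T) ` transversal_points q L = {A, B})))"
proof -
  have frob: "(x + y) ^ q = x ^ q + y ^ q" for x y :: 'a
    using frobenius_additive[OF \<open>field_embedding emb\<close>] \<open>CARD('k) = q\<close> by simp
  interpret fe: finite_extension "TYPE('a)" q t
    using assms frob by unfold_locales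
  obtain W where W: "subgeometry_of emb W \<Sigma>"
    using \<open>canonical_subgeometry emb \<Sigma>\<close> by (auto simp: canonical_subgeometry_def)
  hence \<Sigma>: "\<Sigma> = point_of ` (W - {0})" and W': "module.subspace (sub_scale emb) W"
      "vector_space.dim (sub_scale emb) W = t"
    using \<open>CARD('n) = t\<close> by (auto simp: subgeometry_of_def)
  obtain \<phi> where "subgeometry_frobenius q t \<phi> W"
    using fe.subgeometry_frobenius_exists[OF \<open>field_embedding emb\<close> \<open>CARD('k) = q\<close> \<open>CARD('n) = t\<close> W] by blast
  then interpret sf: subgeometry_frobenius "TYPE('a)" q t \<phi> W .
  obtain U where U: "vec.subspace U" and \<Gamma>: "\<Gamma> = points_in (*s) U"
    using \<open>psubspace (*s) \<Gamma>\<close> by (auto simp: psubspace_def)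
  have dimU: "vec.dim U = t - 2"
    using \<open>pdim (*s) \<Gamma> = int t - 3\<close> vec.pdim_points_in[OF U] \<open>t \<ge> 3\<close> unfolding \<Gamma> by linarith
  have psi: "Vector_Spaces.linear (*s) (*s) \<psi>" "inj \<psi>" and l0: "l0 = points_in (*s) (range \<psi>)"
    using \<open>line_coordinates \<psi> l0\<close> by (auto simp: line_coordinates_def)
  interpret psi: Vector_Spaces.linear "(*s)" "(*s)" \<psi> by (fact psi(1))
  have UW: "U \<inter> W \<subseteq> {0}"
  proof
    fix w assume w: "w \<in> U \<inter> W"
    show "w \<in> {0}"
    proof (rule ccontr)
      assume "w \<notin> {0}"
      hence "vec.span {w} \<in> \<Sigma>" "vec.span {w} \<in> \<Gamma>"
        using w unfolding \<Sigma> \<Gamma> vec.points_in_iff[OF U] by blast+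
      thus False using \<open>\<Sigma> \<inter> \<Gamma> = {}\<close> by blast
    qed
  qed
  have R: "vec.subspace (range \<psi>)" using psi.subspace_image[OF vec.subspace_UNIV] .
  \<comment> \<open>Disjointness of the line and the vertex as point sets becomes trivial
    intersection of subspaces, as needed for the projection \<open>\<pi>\<close>.\<close>
  have disj: "range \<psi> \<inter> U \<subseteq> {0}"
  proof
    fix x assume x: "x \<in> range \<psi> \<inter> U"
    show "x \<in> {0}"
    proof (rule ccontr)
      assume "x \<notin> {0}"
      hence "vec.span {x} \<in> l0" "vec.span {x} \<in> \<Gamma>"
        using x unfolding l0 \<Gamma> vec.points_in_iff[OF U] vec.points_in_iff[OF R] by blast+
      thus False using \<open>l0 \<inter> \<Gamma> = {}\<close> by blast
    qed
  qed
  have "vec.dim U + CARD(2) = CARD('n)" using dimU \<open>CARD('n) = t\<close> \<open>t \<ge> 3\<close> by simp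
  from projection_along_exists[OF U this psi disj] obtain \<pi> where
    \<pi>: "Vector_Spaces.linear (*s) (*s) \<pi>" "\<And>y. \<pi> (\<psi> y) = y" "\<And>x. \<pi> x = 0 \<longleftrightarrow> x \<in> U" by blast
  interpret vp: vertex_projection "TYPE('a)" q t \<phi> W U \<psi> \<pi>
    by (intro vertex_projection.intro vertex_projection_axioms.intro sf.subgeometry_frobenius_axioms
        U dimU UW psi \<pi>)
  have L: "L = vp.L" unfolding L_def \<Gamma> l0 by (rule vp.pull_back_projection[OF \<Sigma>])
  have i: "cond_i \<longleftrightarrow> (\<exists>s v. vp.presents s v)"
  proof
    assume "cond_i"
    thus "\<exists>s v. vp.presents s v" unfolding cond_i_def L vp.pseudoregulus_type_iff by blast
  next
    assume p: "\<exists>s v. vp.presents s v"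
    then obtain s v where "vp.presents s v" by (elim exE)
    \<comment> \<open>The rank is \<open>t\<close>, and \<open>card_L\<close> gives the number of
      points that this rank demands.\<close>
    hence "scattered_linear_set emb L"
      using vp.card_L vp.linear_set_L[OF \<open>field_embedding emb\<close> W'] \<open>CARD('k) = q\<close>
      unfolding scattered_linear_set_def L by blast
    thus "cond_i" using p unfolding cond_i_def L vp.pseudoregulus_type_iff by blast
  qed
  have ii: "cond_ii \<longleftrightarrow> (\<exists>s v. vp.presents s v)"
    unfolding cond_ii_def \<Gamma>
    by (rule vp.presents_iff_intersection[OF \<open>field_embedding emb\<close> \<open>CARD('k) = q\<close> W, symmetric])
  note gp = vp.generating_point_presents[OF \<Sigma>, folded \<Gamma>]
  have iii: "cond_iii \<longleftrightarrow> (\<exists>s v. vp.presents s v)"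
    unfolding cond_iii_def gp by blast
  have a: "\<exists>!P. generating_point \<Gamma> \<sigma> P"
    if "stabilizer_generator \<Sigma> \<sigma>" "\<exists>P. generating_point \<Gamma> \<sigma> P" for \<sigma>
    using that vp.generating_point_unique[OF \<Sigma> that(1), folded \<Gamma>] by blast
  have b: "\<exists>A B. A \<noteq> B \<and>
        l0 \<inter> pspan (*s) (insert ((\<sigma> ^^ (t - 2)) P) \<Gamma>) = {A} \<and>
        l0 \<inter> pspan (*s) (insert ((\<sigma> ^^ (t - 1)) P) \<Gamma>) = {B} \<and>
        (\<lambda>T. \<psi> ` T) ` transversal_points q L = {A, B}"
    if gen: "stabilizer_generator \<Sigma> \<sigma> \<and> generating_point \<Gamma> \<sigma> P" for \<sigma> P
  proof -
    obtain s v where sv: "vp.presents s v" "\<sigma> = sf.coll s" "P = sf.generator_of s v"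
      using gen unfolding gp by blast
    show ?thesis
      unfolding sv(2,3) L l0 \<Gamma>
      by (intro exI[of _ "\<psi> ` {y. v (\<psi> y) = 0}"] exI[of _ "\<psi> ` {y. sf.twist s v (\<psi> y) = 0}"]
          conjI vp.transversal_points_join[OF sv(1)])
  qed
  show ?thesis
  proof (intro conjI impI allI)
    show "cond_i \<longleftrightarrow> cond_ii" "cond_ii \<longleftrightarrow> cond_iii" by (simp_all only: i ii iii)
    show "\<exists>!P. generating_point \<Gamma> \<sigma> P"
      if "stabilizer_generator \<Sigma> \<sigma> \<and> (\<exists>P. generating_point \<Gamma> \<sigma> P)" for \<sigma>
      using a that by simp
  qed (rule b)
qed

end
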